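(* The problems p-#Even Subgraph and p-#Odd Subgraph are both #W[1]-complete under fpt Turing reductions.
   Context: All graphs are finite and simple. p-#Even Subgraph (respectively p-#Odd Subgraph): the input is a graph $G=(V,E)$ and an integer $k$; the parameter is $k$; the output is the number of $k$-element subsets $U\subseteq V$ such that the induced subgraph $G[U]$ has an even (respectively odd) number of edges. A parameterised counting problem is a pair $(\Pi,\kappa)$ with $\Pi:\Sigma^*\to\mathbb{N}_0$ a function ($\Sigma$ a finite alphabet) and $\kappa:\Sigma^*\to\mathbb{N}$ a polynomial-time computable parameterisation. An algorithm is an fpt-algorithm with respect to $\kappa$ if its running time on input $I$ is at most $h(\kappa(I))|I|^c$ for some computable $h$ and constant $c$. An fpt Turing reduction from $(\Pi,\kappa)$ to $(\Pi',\kappa')$ is an algorithm with an oracle to $\Pi'$ that computes $\Pi$, is an fpt-algorithm with respect to $\kappa$, and for which there is a computable $g:\mathbb{N}\to\mathbb{N}$ such that every oracle query $y$ posed on input $x$ satisfies $\kappa'(y)\le g(\kappa(x))$. #W[1] is the parameterised counting class of Flum and Grohe (equivalently, the class of parameterised counting problems having an fpt parsimonious reduction to the problem p-#Clique of counting $k$-vertex cliques in a graph, parameterised by $k$). A problem is #W[1]-complete under fpt Turing reductions if it belongs to #W[1] and every problem in #W[1] has an fpt Turing reduction to it. *)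

theory Defs
  imports Main
begin

section \<open>Oracle algorithms on strings\<close>

text \<open>
  Algorithms are structured programs over finitely many registers. A register is a stack of symbols,
  and a basic instruction touches only the top of one stack, so the model is equivalent to
  multitape Turing machines up to polynomial factors in the running time. Symbols are natural
  numbers, but a program names only finitely many of them and, apart from the digits of oracle
  answers, can push only these. The command
  \<open>Until r s c\<close> repeats \<open>c\<close> as long as the top of \<open>r\<close> differs from \<open>s\<close>, where the top \<open>None\<close> means
  that the stack is empty.
\<close>

type_synonym word = "nat list"
type_synonym store = "nat \<Rightarrow> word"

datatype program =
    Skip
  | Push nat nat
  | Pop nat
  | Query nat nat
  | Seq program program
  | Cond nat "nat option" program program
  | Until nat "nat option" program

primrec top_symbol :: "word \<Rightarrow> nat option" where
  "top_symbol [] = None"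
| "top_symbol (a # w) = Some a"

text \<open>Binary numerals over the symbols 0 and 1, least significant bit first and without leading
  zeros.\<close>

fun binary :: "nat \<Rightarrow> word" where
  "binary 0 = []"
| "binary (Suc n) = Suc n mod 2 # binary (Suc n div 2)"

text \<open>
  \<open>exec f c s t qs s'\<close>: with oracle \<open>f\<close>, program \<open>c\<close> started in \<open>s\<close> halts after \<open>t\<close> steps in \<open>s'\<close>,
  having posed exactly the oracle queries \<open>qs\<close>. A query is charged for its own length and for the
  length of the binary answer.
\<close>

inductive exec :: "(word \<Rightarrow> nat) \<Rightarrow> program \<Rightarrow> store \<Rightarrow> nat \<Rightarrow> word list \<Rightarrow> store \<Rightarrow> bool"
  for f :: "word \<Rightarrow> nat" where
  Skip: "exec f Skip s 1 [] s"
| Push: "exec f (Push r a) s 1 [] (s(r := a # s r))"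
| Pop: "exec f (Pop r) s 1 [] (s(r := tl (s r)))"
| Query: "exec f (Query q r) s (1 + length (s q) + length (binary (f (s q)))) [s q]
           (s(r := binary (f (s q))))"
| Seq: "exec f c1 s t1 qs1 s' \<Longrightarrow> exec f c2 s' t2 qs2 s''
         \<Longrightarrow> exec f (Seq c1 c2) s (t1 + t2) (qs1 @ qs2) s''"
| CondT: "top_symbol (s r) = a \<Longrightarrow> exec f c1 s t qs s'
         \<Longrightarrow> exec f (Cond r a c1 c2) s (1 + t) qs s'"
| CondF: "top_symbol (s r) \<noteq> a \<Longrightarrow> exec f c2 s t qs s'
         \<Longrightarrow> exec f (Cond r a c1 c2) s (1 + t) qs s'"
| UntilT: "top_symbol (s r) = a \<Longrightarrow> exec f (Until r a c) s 1 [] s"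
| UntilF: "top_symbol (s r) \<noteq> a \<Longrightarrow> exec f c s t1 qs1 s' \<Longrightarrow> exec f (Until r a c) s' t2 qs2 s''
         \<Longrightarrow> exec f (Until r a c) s (1 + t1 + t2) (qs1 @ qs2) s''"

inductive_cases exec_SkipE: "exec f Skip s t qs s'"
inductive_cases exec_PushE: "exec f (Push r a) s t qs s'"
inductive_cases exec_PopE: "exec f (Pop r) s t qs s'"
inductive_cases exec_QueryE: "exec f (Query q r) s t qs s'"
inductive_cases exec_SeqE: "exec f (Seq c1 c2) s t qs s'"
inductive_cases exec_CondE: "exec f (Cond r a c1 c2) s t qs s'"
inductive_cases exec_UntilE: "exec f (Until r a c) s t qs s'"

lemma exec_deterministic:
  "exec f c s t qs s' \<Longrightarrow> exec f c s u ps s'' \<Longrightarrow> u = t \<and> ps = qs \<and> s'' = s'"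
proof (induction arbitrary: u ps s'' rule: exec.induct)
  case (Seq c1 s t1 qs1 s' c2 t2 qs2 s2)
  from Seq.prems obtain u1 ps1 v u2 ps2 where
    *: "exec f c1 s u1 ps1 v" "exec f c2 v u2 ps2 s''" "u = u1 + u2" "ps = ps1 @ ps2"
    by (rule exec_SeqE)
  from Seq.IH(1)[OF *(1)] *(2) have "exec f c2 s' u2 ps2 s''" by simp
  from Seq.IH(1)[OF *(1)] Seq.IH(2)[OF this] *(3,4) show ?case by simp
next
  case (CondT s r a c1 t qs s' c2)
  from CondT.prems CondT.hyps(1) obtain u' where "exec f c1 s u' ps s''" "u = 1 + u'"
    by (auto elim: exec_CondE)
  with CondT.IH show ?case by simp
next
  case (CondF s r a c2 t qs s' c1)
  from CondF.prems CondF.hyps(1) obtain u' where "exec f c2 s u' ps s''" "u = 1 + u'"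
    by (auto elim: exec_CondE)
  with CondF.IH show ?case by simp
next
  case (UntilT s r a c)
  from UntilT.prems show ?case by (rule exec_UntilE) (use UntilT.hyps in simp_all)
next
  case (UntilF s r a c t1 qs1 s' t2 qs2 s2)
  from UntilF.prems UntilF.hyps(1) obtain u1 ps1 v u2 ps2 where
    *: "exec f c s u1 ps1 v" "exec f (Until r a c) v u2 ps2 s''"
      "u = Suc (u1 + u2)" "ps = ps1 @ ps2"
    by - (erule exec_UntilE, erule (1) notE, rule that)
  from UntilF.IH(1)[OF *(1)] *(2) have "exec f (Until r a c) s' u2 ps2 s''" by simp
  from UntilF.IH(1)[OF *(1)] UntilF.IH(2)[OF this] *(3,4) show ?case by simp
qed (erule exec_SkipE exec_PushE exec_PopE exec_QueryE, simp)+

text \<open>Input and output are held in register 0; all other registers are initially empty.\<close>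

definition runs :: "(word \<Rightarrow> nat) \<Rightarrow> program \<Rightarrow> word \<Rightarrow> word \<Rightarrow> nat \<Rightarrow> word list \<Rightarrow> bool" where
  "runs f c x y t qs \<longleftrightarrow> (\<exists>s. exec f c ((\<lambda>_. [])(0 := x)) t qs s \<and> s 0 = y)"

primrec oracle_free :: "program \<Rightarrow> bool" where
  "oracle_free Skip \<longleftrightarrow> True"
| "oracle_free (Push r a) \<longleftrightarrow> True"
| "oracle_free (Pop r) \<longleftrightarrow> True"
| "oracle_free (Query q r) \<longleftrightarrow> False"
| "oracle_free (Seq c1 c2) \<longleftrightarrow> oracle_free c1 \<and> oracle_free c2"
| "oracle_free (Cond r a c1 c2) \<longleftrightarrow> oracle_free c1 \<and> oracle_free c2"
| "oracle_free (Until r a c) \<longleftrightarrow> oracle_free c"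

text \<open>For oracle-free programs the oracle is irrelevant; the zero function is a dummy.\<close>

definition runs_plain :: "program \<Rightarrow> word \<Rightarrow> word \<Rightarrow> nat \<Rightarrow> bool" where
  "runs_plain c x y t \<longleftrightarrow> oracle_free c \<and> runs (\<lambda>_. 0) c x y t []"

definition computable :: "(nat \<Rightarrow> nat) \<Rightarrow> bool" where
  "computable g \<longleftrightarrow> (\<exists>c. \<forall>n. \<exists>t. runs_plain c (binary n) (binary (g n)) t)"


section \<open>Parameterised counting problems and reductions\<close>

text \<open>\<open>count_of\<close> and \<open>param\<close> are only meaningful on words over \<open>alphabet\<close>.\<close>

record problem =
  alphabet :: "nat set"
  count_of :: "word \<Rightarrow> nat"
  param :: "word \<Rightarrow> nat"

text \<open>Time bounds below use \<open>Suc (length x)\<close> in place of \<open>length x\<close>: otherwise the bound would be 0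
  on the empty word. On nonempty words the difference is a constant factor.\<close>

definition poly_time_on :: "nat set \<Rightarrow> (word \<Rightarrow> word) \<Rightarrow> bool" where
  "poly_time_on A F \<longleftrightarrow> (\<exists>c a e. \<forall>x\<in>lists A. \<exists>t. runs_plain c x (F x) t \<and> t \<le> a * Suc (length x) ^ e)"

definition parameterised_counting_problem :: "problem \<Rightarrow> bool" where
  "parameterised_counting_problem P \<longleftrightarrow>
     finite (alphabet P) \<and> poly_time_on (alphabet P) (\<lambda>x. binary (param P x))"

definition fpt_parsimonious_reducible :: "problem \<Rightarrow> problem \<Rightarrow> bool" where
  "fpt_parsimonious_reducible P P' \<longleftrightarrow>
     (\<exists>R c h e g. computable h \<and> computable g \<and>
        (\<forall>x\<in>lists (alphabet P).
           R x \<in> lists (alphabet P') \<and>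
           count_of P x = count_of P' (R x) \<and>
           param P' (R x) \<le> g (param P x) \<and>
           (\<exists>t. runs_plain c x (R x) t \<and> t \<le> h (param P x) * Suc (length x) ^ e)))"

definition fpt_turing_reducible :: "problem \<Rightarrow> problem \<Rightarrow> bool" where
  "fpt_turing_reducible P P' \<longleftrightarrow>
     (\<exists>c h e g. computable h \<and> computable g \<and>
        (\<forall>x\<in>lists (alphabet P). \<exists>t qs.
           runs (count_of P') c x (binary (count_of P x)) t qs \<and>
           t \<le> h (param P x) * Suc (length x) ^ e \<and>
           (\<forall>y\<in>set qs. y \<in> lists (alphabet P') \<and> param P' y \<le> g (param P x))))"


section \<open>Graph problems\<close>

definition simple_graph :: "'a set \<Rightarrow> 'a set set \<Rightarrow> bool" where
  "simple_graph V E \<longleftrightarrow> finite V \<and> (\<forall>e\<in>E. e \<subseteq> V \<and> card e = 2)"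

definition induced_edges :: "'a set set \<Rightarrow> 'a set \<Rightarrow> 'a set set" where
  "induced_edges E U = {e \<in> E. e \<subseteq> U}"

definition count_cliques :: "'a set \<Rightarrow> 'a set set \<Rightarrow> nat \<Rightarrow> nat" where
  "count_cliques V E k =
     card {U. U \<subseteq> V \<and> card U = k \<and> (\<forall>u\<in>U. \<forall>v\<in>U. u \<noteq> v \<longrightarrow> {u, v} \<in> E)}"

definition count_even_subgraphs :: "'a set \<Rightarrow> 'a set set \<Rightarrow> nat \<Rightarrow> nat" where
  "count_even_subgraphs V E k =
     card {U. U \<subseteq> V \<and> card U = k \<and> even (card (induced_edges E U))}"

definition count_odd_subgraphs :: "'a set \<Rightarrow> 'a set set \<Rightarrow> nat \<Rightarrow> nat" where
  "count_odd_subgraphs V E k =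
     card {U. U \<subseteq> V \<and> card U = k \<and> odd (card (induced_edges E U))}"

text \<open>
  An instance consists of a graph with vertex set \<open>{..<n}\<close> and a number \<open>k\<close>. It is written as the
  binary numeral of \<open>k\<close>, the separator 2, and the adjacency matrix row by row.
\<close>

definition encode_instance :: "nat \<Rightarrow> nat set set \<Rightarrow> nat \<Rightarrow> word" where
  "encode_instance n E k =
     binary k @ [2] @
     concat (map (\<lambda>i. map (\<lambda>j. if {i, j} \<in> E then 1 else 0) [0..<n]) [0..<n])"

text \<open>Words that encode no instance get count 0 and parameter 0.\<close>

definition graph_problem :: "(nat set \<Rightarrow> nat set set \<Rightarrow> nat \<Rightarrow> nat) \<Rightarrow> problem" where
  "graph_problem F =
    \<lparr> alphabet = {0, 1, 2},
      count_of = (\<lambda>x. if \<exists>n E k. simple_graph {..<n} E \<and> x = encode_instance n E k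
        then THE m. \<exists>n E k. simple_graph {..<n} E \<and> x = encode_instance n E k \<and> m = F {..<n} E k
        else 0),
      param = (\<lambda>x. if \<exists>n E k. simple_graph {..<n} E \<and> x = encode_instance n E k
        then THE k. \<exists>n E. simple_graph {..<n} E \<and> x = encode_instance n E k
        else 0) \<rparr>"

text \<open>The descriptions above are well defined, since instances are determined by their encodings.\<close>

lemma set_binary: "set (binary n) \<subseteq> {0, 1}"
  by (induction n rule: binary.induct) auto

lemma binary_inj: "binary m = binary n \<Longrightarrow> m = n"
proof (induction m arbitrary: n rule: binary.induct)
  case 1
  then show ?case by (cases n) auto
next
  case (2 m)
  then obtain n' where n: "n = Suc n'" by (cases n) auto
  with 2 have "Suc m div 2 = Suc n' div 2" "Suc m mod 2 = Suc n' mod 2" by auto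
  then show ?case unfolding n by (metis div_mult_mod_eq)
qed

lemma append_sep_inj:
  "a \<notin> set u \<Longrightarrow> a \<notin> set v \<Longrightarrow> u @ a # xs = v @ a # ys \<Longrightarrow> u = v \<and> xs = ys"
  by (induction u arbitrary: v; case_tac v) auto

lemma concat_map_inj:
  assumes "concat (map f is) = concat (map g is)" "\<forall>i\<in>set is. length (f i) = length (g i)"
  shows "\<forall>i\<in>set is. f i = g i"
  using assms by (induction "is") auto

lemma encode_instance_inj:
  assumes "simple_graph {..<n} E" "simple_graph {..<n'} E'"
    and eq: "encode_instance n E k = encode_instance n' E' k'"
  shows "n = n' \<and> E = E' \<and> k = k'"
proof -
  let ?M = "\<lambda>n E. concat (map (\<lambda>i. map (\<lambda>j. if {i, j} \<in> E then 1 else 0 :: nat) [0..<n]) [0..<n])"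
  have two: "2 \<notin> set (binary k)" "2 \<notin> set (binary k')"
    using set_binary[of k] set_binary[of k'] by auto
  have *: "binary k = binary k' \<and> ?M n E = ?M n' E'"
    by (rule append_sep_inj[OF two]) (use eq in \<open>simp add: encode_instance_def\<close>)
  have len: "length (?M m F) = m * m" for m F
    by (simp add: length_concat comp_def sum_list_triv)
  from * have "n * n = n' * n'" by (metis len)
  then have n: "n = n'"
    by (metis le_antisym nat_le_linear power2_eq_square power2_nat_le_eq_le)
  have "\<forall>i\<in>set [0..<n]. map (\<lambda>j. if {i, j} \<in> E then 1 else 0 :: nat) [0..<n]
      = map (\<lambda>j. if {i, j} \<in> E' then 1 else 0) [0..<n]"
    by (rule concat_map_inj) (use * n in auto)
  then have adj: "{i, j} \<in> E \<longleftrightarrow> {i, j} \<in> E'" if "i < n" "j < n" for i j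
    using that by (fastforce split: if_splits)
  have "e \<in> E \<longleftrightarrow> e \<in> E'" for e
  proof (cases "e \<subseteq> {..<n} \<and> card e = 2")
    case True
    then obtain i j where "e = {i, j}" "i < n" "j < n" by (auto simp: card_2_iff)
    then show ?thesis using adj by simp
  next
    case False
    then show ?thesis using assms(1,2) n by (auto simp: simple_graph_def)
  qed
  then show ?thesis using n * binary_inj by blast
qed

lemma graph_problem_encode_instance:
  assumes "simple_graph {..<n} E"
  shows "count_of (graph_problem F) (encode_instance n E k) = F {..<n} E k"
    and "param (graph_problem F) (encode_instance n E k) = k"
proof -
  have ex: "\<exists>n' E' k'. simple_graph {..<n'} E' \<and> encode_instance n E k = encode_instance n' E' k'"
    using assms by blast
  have "(THE m. \<exists>n' E' k'. simple_graph {..<n'} E' \<and>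
      encode_instance n E k = encode_instance n' E' k' \<and> m = F {..<n'} E' k') = F {..<n} E k"
    by (rule the_equality) (use assms encode_instance_inj in blast)+
  with ex show "count_of (graph_problem F) (encode_instance n E k) = F {..<n} E k"
    by (simp add: graph_problem_def)
  have "(THE k'. \<exists>n' E'. simple_graph {..<n'} E' \<and>
      encode_instance n E k = encode_instance n' E' k') = k"
    by (rule the_equality) (use assms encode_instance_inj in blast)+
  with ex show "param (graph_problem F) (encode_instance n E k) = k"
    by (simp add: graph_problem_def)
qed

definition p_clique :: problem where
  "p_clique = graph_problem count_cliques"

definition p_even_subgraph :: problem where
  "p_even_subgraph = graph_problem count_even_subgraphs"

definition p_odd_subgraph :: problem where
  "p_odd_subgraph = graph_problem count_odd_subgraphs"


section \<open>The class sharp W[1]\<close>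

text \<open>Defined by its standard complete problem \<open>p_clique\<close>, as the closure under fpt parsimonious
  reductions.\<close>

definition sharp_W1 :: "problem set" where
  "sharp_W1 = {P. parameterised_counting_problem P \<and> fpt_parsimonious_reducible P p_clique}"

definition sharp_W1_complete :: "problem \<Rightarrow> bool" where
  "sharp_W1_complete P \<longleftrightarrow> P \<in> sharp_W1 \<and> (\<forall>Q\<in>sharp_W1. fpt_turing_reducible Q P)"

end

theory Submission
  imports Defs "HOL-Library.Nat_Bijection"
begin

text \<open>
  Even and odd subgraphs are treated together: \<open>count_parity par\<close> counts the \<open>k\<close>-sets that
  induce an odd number of edges if \<open>par\<close> holds, and an even number otherwise.

  \<^emph>\<open>Membership.\<close> Adjacency compares only two vertices at a time, so a clique cannot check a
  parity directly. It can check a guess, however. The new graph has as vertices the triples of a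
  position \<open>i < k\<close>, a vertex \<open>u\<close> and a mask that proposes which of the \<open>k\<close> positions are joined.
  Two triples are adjacent if they have the same mask, the number of edges that it proposes has
  the right parity, their positions and vertices are in the same order, and the mask tells the
  truth about this pair. For \<open>k \<ge> 2\<close> a \<open>k\<close>-clique is then a \<open>k\<close>-set of the right parity together
  with its true pattern of edges (\<open>count_mask_cliques\<close>). The reduction is parsimonious, keeps
  \<open>k\<close>, and multiplies the size by a factor that depends on \<open>k\<close> only.

  \<^emph>\<open>Hardness.\<close> Take \<open>k\<close> copies of the vertex set. For a set \<open>S\<close> of pairs of copies, keep the
  edges between copies \<open>i < j\<close> with \<open>(i, j) \<in> S\<close>, oriented such that the vertices increase with
  the copies. For a \<open>k\<close>-set \<open>U\<close> of the new vertices, the alternating sum over \<open>S\<close> of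
  \<open>(- 1) ^ e\<close>, with \<open>e\<close> the number of edges within \<open>U\<close>, is a product over the pairs \<open>i < j\<close>. Its
  factor for \<open>(i, j)\<close> vanishes unless \<open>U\<close> has an odd number of edges between the two copies. If
  no factor vanishes, then \<open>U\<close> meets each copy exactly once and is an increasing clique. Thus
  the alternating sum of the oracle's answers for all \<open>S\<close> is the number of \<open>k\<close>-cliques times a
  known power of 2 (\<open>cliques_from_parities\<close>). The same argument that isolates the edges thereby
  also isolates the colourful sets.

  \<^emph>\<open>Programs.\<close> The reductions are not programmed individually. The predicate \<open>wc\<close> says that a
  word depending on given words can be computed in polynomial time, measured with respect to
  their lengths and a budget. It is closed under composition, arithmetic on unary numbers,
  bounded sums and quantifiers, recursion with small values (\<open>wc_rec\<close>) and oracle queries. Since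
  the reductions and the validity of encodings are defined by such means, programs for them are
  obtained by resolution with the closure rules. The budget \<open>k + 2 ^ (k * k)\<close> is the point where
  the parameter enters the running time. Large counts are summed in binary by a closed formula
  for the carries. Finally, an arbitrary reduction to \<open>p_clique\<close> is composed with the second
  reduction (\<open>runs_compose\<close>), and the resulting time bound is computable (\<open>computable_bound\<close>).
\<close>


section \<open>Running programs with a time budget\<close>

text \<open>
  Of a run only an upper bound \<open>T\<close> on the time and a property \<open>Q\<close> of all queries are recorded.
  Unlike the exact time and the list of queries, both are easy to combine.
\<close>

definition does ::
  "(word \<Rightarrow> nat) \<Rightarrow> (word \<Rightarrow> bool) \<Rightarrow> program \<Rightarrow> store \<Rightarrow> nat \<Rightarrow> store \<Rightarrow> bool" where
  "does f Q c s T s' \<longleftrightarrow> (\<exists>t qs. exec f c s t qs s' \<and> t \<le> T \<and> (\<forall>q\<in>set qs. Q q))"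

lemma doesI: "exec f c s t qs s' \<Longrightarrow> t \<le> T \<Longrightarrow> \<forall>q\<in>set qs. Q q \<Longrightarrow> does f Q c s T s'"
  unfolding does_def by blast

lemma doesE:
  assumes "does f Q c s T s'"
  obtains t qs where "exec f c s t qs s'" "t \<le> T" "\<forall>q\<in>set qs. Q q"
  using assms unfolding does_def by blast

lemma does_mono: "does f Q c s T s' \<Longrightarrow> T \<le> T' \<Longrightarrow> does f Q c s T' s'"
  unfolding does_def by (meson le_trans)

lemma does_Skip: "does f Q Skip s 1 s"
  by (rule doesI[OF exec.Skip]) simp_all

lemma does_Push: "s' = s(r := a # s r) \<Longrightarrow> does f Q (Push r a) s 1 s'"
  using doesI[OF exec.Push] by simp

lemma does_Pop: "s' = s(r := tl (s r)) \<Longrightarrow> does f Q (Pop r) s 1 s'"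
  using doesI[OF exec.Pop] by simp

lemma does_Query:
  "Q (s q) \<Longrightarrow> s' = s(r := binary (f (s q))) \<Longrightarrow>
    does f Q (Query q r) s (1 + length (s q) + length (binary (f (s q)))) s'"
  using doesI[OF exec.Query] by simp

lemma does_Seq:
  assumes "does f Q c1 s T1 s'" "does f Q c2 s' T2 s''"
  shows "does f Q (Seq c1 c2) s (T1 + T2) s''"
proof -
  obtain t1 q1 where 1: "exec f c1 s t1 q1 s'" "t1 \<le> T1" "\<forall>q\<in>set q1. Q q" by (rule doesE[OF assms(1)])
  obtain t2 q2 where 2: "exec f c2 s' t2 q2 s''" "t2 \<le> T2" "\<forall>q\<in>set q2. Q q" by (rule doesE[OF assms(2)])
  show ?thesis by (rule doesI[OF exec.Seq[OF 1(1) 2(1)]]) (use 1 2 in auto)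
qed

lemma does_Cond:
  assumes "does f Q (if top_symbol (s r) = a then c1 else c2) s T s'"
  shows "does f Q (Cond r a c1 c2) s (Suc T) s'"
proof -
  obtain t qs where t: "exec f (if top_symbol (s r) = a then c1 else c2) s t qs s'" "t \<le> T"
    "\<forall>q\<in>set qs. Q q" by (rule doesE[OF assms])
  then have "exec f (Cond r a c1 c2) s (1 + t) qs s'"
    using exec.CondT[of s r a f c1 t qs s' c2] exec.CondF[of s r a f c2 t qs s' c1]
    by (cases "top_symbol (s r) = a") simp_all
  then show ?thesis by (rule doesI) (use t in auto)
qed

text \<open>
  \<open>S i\<close> is the store after \<open>i\<close> rounds; the bound \<open>T\<close> has to hold for every round.
\<close>

lemma does_Until:
  assumes "\<And>i. i < n \<Longrightarrow> does f Q c (S i) T (S (Suc i))"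
    and "\<And>i. i < n \<Longrightarrow> top_symbol (S i r) \<noteq> a" and "top_symbol (S n r) = a"
  shows "does f Q (Until r a c) (S 0) (Suc (n * Suc T)) (S n)"
  using assms
proof (induction n arbitrary: S)
  case 0
  then show ?case by (intro doesI[OF exec.UntilT]) auto
next
  case (Suc n)
  have "does f Q (Until r a c) (S (Suc 0)) (Suc (n * Suc T)) (S (Suc n))"
    by (rule Suc.IH[of "\<lambda>i. S (Suc i)"]) (use Suc.prems in auto)
  then obtain t2 q2 where 2: "exec f (Until r a c) (S (Suc 0)) t2 q2 (S (Suc n))"
    "t2 \<le> Suc (n * Suc T)" "\<forall>q\<in>set q2. Q q" by (rule doesE)
  obtain t1 q1 where 1: "exec f c (S 0) t1 q1 (S (Suc 0))" "t1 \<le> T" "\<forall>q\<in>set q1. Q q"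
    using Suc.prems(1)[of 0] by (auto elim: doesE)
  have "top_symbol (S 0 r) \<noteq> a" using Suc.prems(2)[of 0] by simp
  from exec.UntilF[OF this 1(1) 2(1)] show ?case by (rule doesI) (use 1 2 in auto)
qed

lemma exec_length: "exec f c s t qs s' \<Longrightarrow> length (s' r) \<le> length (s r) + t"
  by (induction rule: exec.induct) (auto intro: le_trans)

lemma does_length: "does f Q c s T s' \<Longrightarrow> length (s' r) \<le> length (s r) + T"
  by (erule doesE) (meson exec_length add_left_mono le_trans)

lemma exec_oracle_free:
  "exec f c s t qs s' \<Longrightarrow> oracle_free c \<Longrightarrow> qs = [] \<and> exec f' c s t [] s'"
proof (induction rule: exec.induct)
  case (Seq c1 s t1 qs1 s' c2 t2 qs2 s2)
  then show ?case using exec.Seq[of f' c1 s t1 "[]" s' c2 t2 "[]" s2] by simp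
next
  case (UntilF s r a c t1 qs1 s' t2 qs2 s2)
  then show ?case using exec.UntilF[of s r a f' c t1 "[]" s' t2 "[]" s2] by simp
qed (auto intro: exec.intros simp del: plus_1_eq_Suc One_nat_def)


subsection \<open>Moving register contents\<close>

abbreviation ternary :: "word \<Rightarrow> bool" where
  "ternary w \<equiv> set w \<subseteq> {0, 1, 2}"

definition clear :: "nat \<Rightarrow> program" where
  "clear r = Until r None (Pop r)"

lemma oracle_free_clear [simp]: "oracle_free (clear r)" by (simp add: clear_def)

lemma does_clear:
  assumes "length (s r) \<le> L" "s' = s(r := [])"
  shows "does f Q (clear r) s (Suc (2 * L)) s'"
proof -
  let ?S = "\<lambda>i. s(r := drop i (s r))"
  have "does f Q (Until r None (Pop r)) (?S 0) (Suc (length (s r) * Suc 1)) (?S (length (s r)))"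
  proof (rule does_Until)
    fix i assume i: "i < length (s r)"
    show "does f Q (Pop r) (?S i) 1 (?S (Suc i))" by (rule does_Pop) (simp add: drop_Suc tl_drop)
    show "top_symbol (?S i r) \<noteq> None" using i by (cases "drop i (s r)") auto
  qed auto
  then show ?thesis unfolding clear_def using assms by (auto elim: does_mono)
qed

primrec push_all :: "nat list \<Rightarrow> nat \<Rightarrow> program" where
  "push_all [] a = Skip"
| "push_all (d # ds) a = Seq (Push d a) (push_all ds a)"

lemma oracle_free_push_all [simp]: "oracle_free (push_all ds a)" by (induction ds) auto

lemma does_push_all:
  assumes "distinct ds"
  shows "does f Q (push_all ds a) s (Suc (length ds)) (\<lambda>q. if q \<in> set ds then a # s q else s q)"
  using assms
proof (induction ds arbitrary: s)
  case Nil
  then show ?case using does_Skip by simp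
next
  case (Cons d ds)
  let ?s = "s(d := a # s d)"
  have "does f Q (Seq (Push d a) (push_all ds a)) s (1 + Suc (length ds))
      (\<lambda>q. if q \<in> set ds then a # ?s q else ?s q)"
    by (rule does_Seq[OF does_Push[OF refl] Cons.IH]) (use Cons.prems in auto)
  moreover have "(\<lambda>q. if q \<in> set ds then a # ?s q else ?s q) =
      (\<lambda>q. if q \<in> set (d # ds) then a # s q else s q)"
    using Cons.prems by auto
  ultimately show ?case by simp
qed

text \<open>
  Emptying a stack into others reverses its contents; doing so twice restores them, which is how
  registers are copied. A program can only move symbols that it names.
\<close>

definition pour :: "nat \<Rightarrow> nat list \<Rightarrow> program" where
  "pour r ds = Until r None
     (Cond r (Some 0) (Seq (Pop r) (push_all ds 0))
     (Cond r (Some 1) (Seq (Pop r) (push_all ds 1)) (Seq (Pop r) (push_all ds 2))))"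

lemma oracle_free_pour [simp]: "oracle_free (pour r ds)" by (simp add: pour_def)

lemma does_pour:
  assumes "distinct ds" "r \<notin> set ds" "ternary (s r)" "length (s r) \<le> L"
    and "s' = (\<lambda>q. if q = r then [] else if q \<in> set ds then rev (s r) @ s q else s q)"
  shows "does f Q (pour r ds) s (Suc (L * (length ds + 5))) s'"
proof -
  let ?w = "s r"
  let ?S = "\<lambda>i q. if q = r then drop i ?w else if q \<in> set ds then rev (take i ?w) @ s q else s q"
  let ?p = "\<lambda>a. Seq (Pop r) (push_all ds a)"
  let ?b = "Cond r (Some 0) (?p 0) (Cond r (Some 1) (?p 1) (?p 2))"
  have "does f Q (Until r None ?b) (?S 0) (Suc (length ?w * Suc (length ds + 4))) (?S (length ?w))"
  proof (rule does_Until)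
    fix i assume i: "i < length ?w"
    then have dr: "drop i ?w = ?w ! i # drop (Suc i) ?w" by (simp add: Cons_nth_drop_Suc)
    then show "top_symbol (?S i r) \<noteq> None" by simp
    have top: "top_symbol (?S i r) = Some (?w ! i)" using dr by simp
    let ?s = "(?S i)(r := tl (?S i r))"
    have "(\<lambda>q. if q \<in> set ds then ?w ! i # ?s q else ?s q) = ?S (Suc i)"
      using assms(2) i dr by (auto simp: take_Suc_conv_app_nth)
    then have step: "does f Q (?p (?w ! i)) (?S i) (1 + Suc (length ds)) (?S (Suc i))"
      using does_Seq[OF does_Pop[OF refl] does_push_all[OF assms(1), of f Q "?w ! i" ?s]] by simp
    have "?w ! i \<in> {0, 1, 2}" using assms(3) i nth_mem by blast
    then have sym: "?w ! i = 0 \<or> ?w ! i = 1 \<or> ?w ! i = 2" by simp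
    have "does f Q (if top_symbol (?S i r) = Some 1 then ?p 1 else ?p 2) (?S i)
        (1 + Suc (length ds)) (?S (Suc i))" if "?w ! i \<noteq> 0"
      unfolding top using step sym that by auto
    note else_branch = does_Cond[OF this]
    have "does f Q (if top_symbol (?S i r) = Some 0 then ?p 0 else Cond r (Some 1) (?p 1) (?p 2)) (?S i)
        (Suc (1 + Suc (length ds))) (?S (Suc i))"
      unfolding top using else_branch does_mono[OF step, of "Suc (1 + Suc (length ds))"]
      by (cases "?w ! i = 0") auto
    from does_Cond[OF this] show "does f Q ?b (?S i) (length ds + 4) (?S (Suc i))"
      by (simp add: numeral_eq_Suc)
  qed auto
  moreover have "?S 0 = s" "?S (length ?w) = s'" using assms(5) by auto
  ultimately have "does f Q (pour r ds) s (Suc (length ?w * Suc (length ds + 4))) s'"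
    unfolding pour_def by simp
  moreover have "length ?w * Suc (length ds + 4) \<le> L * (length ds + 5)"
    by (rule mult_le_mono) (use assms(4) in auto)
  ultimately show ?thesis by (auto elim: does_mono)
qed

lemma does_pour1:
  assumes "r \<noteq> d" "ternary (s r)" "length (s r) \<le> L" "s' = s(r := [], d := rev (s r) @ s d)"
  shows "does f Q (pour r [d]) s (Suc (6 * L)) s'"
proof -
  have "s' = (\<lambda>q. if q = r then [] else if q \<in> set [d] then rev (s r) @ s q else s q)"
    using assms by auto
  from does_pour[OF _ _ assms(2,3) this, of f Q] assms(1) show ?thesis by (simp add: mult.commute)
qed

lemma does_pour2:
  assumes "r \<noteq> d" "r \<noteq> e" "d \<noteq> e" "ternary (s r)" "length (s r) \<le> L"
    "s' = s(r := [], d := rev (s r) @ s d, e := rev (s r) @ s e)"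
  shows "does f Q (pour r [d, e]) s (Suc (7 * L)) s'"
proof -
  have "s' = (\<lambda>q. if q = r then [] else if q \<in> set [d, e] then rev (s r) @ s q else s q)"
    using assms by auto
  from does_pour[OF _ _ assms(4,5) this, of f Q] assms(1-3) show ?thesis by (simp add: mult.commute)
qed

text \<open>
  In contrast to \<open>pour\<close>, draining forgets the symbols and keeps only their number. It turns any
  word into the unary numeral of its length.
\<close>

definition drain :: "nat \<Rightarrow> nat \<Rightarrow> program" where
  "drain r d = Until r None (Seq (Pop r) (Push d 0))"

lemma oracle_free_drain [simp]: "oracle_free (drain r d)" by (simp add: drain_def)

lemma does_drain:
  assumes "r \<noteq> d" "length (s r) \<le> L" "s' = s(r := [], d := replicate (length (s r)) 0 @ s d)"
  shows "does f Q (drain r d) s (Suc (3 * L)) s'"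
proof -
  let ?S = "\<lambda>i. s(r := drop i (s r), d := replicate i 0 @ s d)"
  have "does f Q (Until r None (Seq (Pop r) (Push d 0))) (?S 0) (Suc (length (s r) * Suc (1 + 1)))
      (?S (length (s r)))"
  proof (rule does_Until)
    fix i assume i: "i < length (s r)"
    show "does f Q (Seq (Pop r) (Push d 0)) (?S i) (1 + 1) (?S (Suc i))"
      by (rule does_Seq[OF does_Pop[OF refl] does_Push]) (use assms in \<open>auto simp: drop_Suc tl_drop\<close>)
    show "top_symbol (?S i r) \<noteq> None" using i assms by (cases "drop i (s r)") auto
  qed (use assms in auto)
  moreover have "?S 0 = s" "?S (length (s r)) = s'" using assms by auto
  ultimately have "does f Q (drain r d) s (Suc (length (s r) * Suc (1 + 1))) s'"
    unfolding drain_def by simp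
  then show ?thesis by (rule does_mono) (use assms(2) in simp)
qed


section \<open>Polynomial bounds\<close>

definition poly_bounded :: "(nat \<Rightarrow> nat) \<Rightarrow> bool" where
  "poly_bounded T \<longleftrightarrow> (\<exists>K d. \<forall>n. T n \<le> K * Suc n ^ d)"

lemma poly_bounded_const: "poly_bounded (\<lambda>n. c)"
  unfolding poly_bounded_def by (rule exI[of _ c], rule exI[of _ 0]) auto

lemma poly_bounded_id: "poly_bounded (\<lambda>n. n)"
  unfolding poly_bounded_def by (rule exI[of _ 1], rule exI[of _ 1]) auto

lemma poly_bounded_monomial: "poly_bounded (\<lambda>n. K * Suc n ^ d)"
  unfolding poly_bounded_def by blast

lemma poly_bounded_add:
  assumes "poly_bounded S" "poly_bounded T"
  shows "poly_bounded (\<lambda>n. S n + T n)"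
proof -
  obtain K d L e where *: "\<And>n. S n \<le> K * Suc n ^ d" "\<And>n. T n \<le> L * Suc n ^ e"
    using assms unfolding poly_bounded_def by blast
  have "S n + T n \<le> (K + L) * Suc n ^ (d + e)" for n
  proof -
    have "Suc n ^ d \<le> Suc n ^ (d + e)" "Suc n ^ e \<le> Suc n ^ (d + e)"
      by (intro power_increasing; simp)+
    then have "K * Suc n ^ d + L * Suc n ^ e \<le> (K + L) * Suc n ^ (d + e)"
      by (simp add: add_mult_distrib add_mono)
    with * show ?thesis by (meson add_mono le_trans)
  qed
  then show ?thesis unfolding poly_bounded_def by blast
qed

lemma poly_bounded_mult:
  assumes "poly_bounded S" "poly_bounded T"
  shows "poly_bounded (\<lambda>n. S n * T n)"
proof -
  obtain K d L e where *: "\<And>n. S n \<le> K * Suc n ^ d" "\<And>n. T n \<le> L * Suc n ^ e"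
    using assms unfolding poly_bounded_def by blast
  have "S n * T n \<le> (K * L) * Suc n ^ (d + e)" for n
    using mult_mono[OF *] by (simp add: power_add mult.assoc mult.left_commute)
  then show ?thesis unfolding poly_bounded_def by blast
qed

lemma poly_bounded_comp:
  assumes "poly_bounded S" "poly_bounded T"
  shows "poly_bounded (\<lambda>n. S (T n))"
proof -
  obtain K d L e where *: "\<And>n. S n \<le> K * Suc n ^ d" "\<And>n. T n \<le> L * Suc n ^ e"
    using assms unfolding poly_bounded_def by blast
  have "S (T n) \<le> (K * Suc L ^ d) * Suc n ^ (e * d)" for n
  proof -
    have "Suc (T n) \<le> Suc L * Suc n ^ e"
      using add_mono[OF one_le_power[of "Suc n" e] *(2)[of n]] by simp
    then have "Suc (T n) ^ d \<le> Suc L ^ d * Suc n ^ (e * d)"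
      by (metis power_mono power_mult power_mult_distrib zero_le)
    then show ?thesis using *(1)[of "T n"] by (metis le_trans mult.assoc mult_le_mono2)
  qed
  then show ?thesis unfolding poly_bounded_def by blast
qed

lemma poly_bounded_Suc: "poly_bounded T \<Longrightarrow> poly_bounded (\<lambda>n. Suc (T n))"
  using poly_bounded_add[of T "\<lambda>_. 1"] poly_bounded_const by simp

lemmas poly_bounded_intros =
  poly_bounded_const poly_bounded_id poly_bounded_Suc poly_bounded_add poly_bounded_mult


section \<open>Computable word functions\<close>

definition st :: "word list \<Rightarrow> store" where
  "st ws = (\<lambda>r. if r < length ws then ws ! r else [])"

abbreviation agree :: "nat \<Rightarrow> store \<Rightarrow> word list \<Rightarrow> bool" where
  "agree b s ws \<equiv> (\<forall>r<b. s r = st ws r)"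

abbreviation vol :: "word list \<Rightarrow> nat" where
  "vol ws \<equiv> sum_list (map length ws)"

abbreviation ok :: "word list \<Rightarrow> bool" where
  "ok ws \<equiv> (\<forall>w\<in>set ws. ternary w)"

text \<open>
  The central notion. An instance is described by a ghost parameter \<open>g\<close>. The program \<open>c\<close> finds
  the \<open>m\<close> words \<open>W g\<close> in the first registers and adds \<open>V g\<close> as the next one. It relies on the
  registers below \<open>b\<close> only, of which those from \<open>m\<close> on are empty, and changes none but register
  \<open>m\<close>; hence an enclosing program can keep data above \<open>b\<close>, and programs are combined without
  renaming registers.

  The time is polynomial in the total length of the words plus a budget \<open>p g\<close>. The budget admits
  running times that are superpolynomial in the parameter of a problem: it is chosen as a
  function of the parameter. The predicate \<open>Q g\<close> restricts the queries, and \<open>pl\<close> forbids them.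
  All words use the symbols 0, 1, 2, because a program can copy only symbols that it names.
\<close>

definition computes :: "bool \<Rightarrow> (word \<Rightarrow> nat) \<Rightarrow> ('g \<Rightarrow> word \<Rightarrow> bool) \<Rightarrow> ('g \<Rightarrow> nat) \<Rightarrow>
    ('g \<Rightarrow> word list) \<Rightarrow> ('g \<Rightarrow> word) \<Rightarrow> nat \<Rightarrow> nat \<Rightarrow> program \<Rightarrow> (nat \<Rightarrow> nat) \<Rightarrow> bool" where
  "computes pl f Q p W V m b c T \<longleftrightarrow>
     m < b \<and> (pl \<longrightarrow> oracle_free c) \<and> poly_bounded T \<and> mono T \<and>
     (\<forall>g. length (W g) = m \<and> (ok (W g) \<longrightarrow> ternary (V g) \<and>
       (\<forall>s. agree b s (W g) \<longrightarrow> does f (Q g) c s (T (p g + vol (W g))) (s(m := V g)))))"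

definition wc :: "bool \<Rightarrow> (word \<Rightarrow> nat) \<Rightarrow> ('g \<Rightarrow> word \<Rightarrow> bool) \<Rightarrow> ('g \<Rightarrow> nat) \<Rightarrow>
    ('g \<Rightarrow> word list) \<Rightarrow> ('g \<Rightarrow> word) \<Rightarrow> bool" where
  "wc pl f Q p W V \<longleftrightarrow> (\<exists>m b c T. computes pl f Q p W V m b c T)"

text \<open>
  Numbers are held in unary, truth values as the numbers 0 and 1. Polynomial time therefore
  means polynomial in the values of the numbers, which is the right measure for vertices and
  loop counters.
\<close>

abbreviation uc :: "bool \<Rightarrow> (word \<Rightarrow> nat) \<Rightarrow> ('g \<Rightarrow> word \<Rightarrow> bool) \<Rightarrow> ('g \<Rightarrow> nat) \<Rightarrow>
    ('g \<Rightarrow> word list) \<Rightarrow> ('g \<Rightarrow> nat) \<Rightarrow> bool" where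
  "uc pl f Q p W F \<equiv> wc pl f Q p W (\<lambda>g. replicate (F g) 0)"

abbreviation dc :: "bool \<Rightarrow> (word \<Rightarrow> nat) \<Rightarrow> ('g \<Rightarrow> word \<Rightarrow> bool) \<Rightarrow> ('g \<Rightarrow> nat) \<Rightarrow>
    ('g \<Rightarrow> word list) \<Rightarrow> ('g \<Rightarrow> bool) \<Rightarrow> bool" where
  "dc pl f Q p W P \<equiv> uc pl f Q p W (\<lambda>g. of_bool (P g))"

text \<open>
  A polynomial bound may be replaced by a monomial, which is monotone. Monotonicity is what lets
  an enclosing program bound the time of a part whose registers hold intermediate results.
\<close>

lemma wcI:
  fixes W :: "'g \<Rightarrow> word list"
  assumes "m < b" "pl \<Longrightarrow> oracle_free c" "poly_bounded T" "\<And>g. length (W g) = m"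
    and "\<And>g. ok (W g) \<Longrightarrow> ternary (V g)"
    and "\<And>g s. ok (W g) \<Longrightarrow> agree b s (W g) \<Longrightarrow>
      does f (Q g) c s (T (p g + vol (W g))) (s(m := V g))"
  shows "wc pl f Q p W V"
proof -
  obtain K d where T: "\<And>n. T n \<le> K * Suc n ^ d"
    using assms(3) unfolding poly_bounded_def by blast
  define T' where "T' = (\<lambda>n. K * Suc n ^ d)"
  have "mono T'" unfolding T'_def by (intro monoI mult_le_mono power_mono) auto
  moreover have "poly_bounded T'" unfolding T'_def by (rule poly_bounded_monomial)
  moreover have "does f (Q g) c s (T' (p g + vol (W g))) (s(m := V g))"
    if "ok (W g)" "agree b s (W g)" for g s
    using does_mono[OF assms(6)[OF that]] T unfolding T'_def by blast
  ultimately show ?thesis unfolding wc_def computes_def using assms(1,2,4,5)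
    by (intro exI[of _ m] exI[of _ b] exI[of _ c] exI[of _ T']) blast
qed

lemma wcE:
  assumes "wc pl f Q p W V"
  obtains m b c T where "computes pl f Q p W V m b c T"
  using assms unfolding wc_def by blast

lemma computesD:
  assumes "computes pl f Q p W V m b c T"
  shows "m < b" "pl \<Longrightarrow> oracle_free c" "poly_bounded T" "mono T"
    "\<And>g. length (W g) = m" "\<And>g. ok (W g) \<Longrightarrow> ternary (V g)"
    "\<And>g. ok (W g) \<Longrightarrow> length (V g) \<le> T (p g + vol (W g))"
    "\<And>g s. ok (W g) \<Longrightarrow> agree b s (W g) \<Longrightarrow>
      does f (Q g) c s (T (p g + vol (W g))) (s(m := V g))"
proof -
  show *: "m < b" "pl \<Longrightarrow> oracle_free c" "poly_bounded T" "mono T"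
    "\<And>g. length (W g) = m" "\<And>g. ok (W g) \<Longrightarrow> ternary (V g)"
    "\<And>g s. ok (W g) \<Longrightarrow> agree b s (W g) \<Longrightarrow>
      does f (Q g) c s (T (p g + vol (W g))) (s(m := V g))"
    using assms unfolding computes_def by blast+
  \<comment> \<open>A program cannot write more symbols than it makes steps.\<close>
  show "length (V g) \<le> T (p g + vol (W g))" if "ok (W g)" for g
    using does_length[OF *(7)[OF that, of "st (W g)"], of m] *(5)[of g] by (simp add: st_def)
qed

definition fixed :: "('g \<Rightarrow> word list) \<Rightarrow> bool" where
  "fixed W \<longleftrightarrow> (\<exists>m. \<forall>g. length (W g) = m)"

definition elem :: "('g \<Rightarrow> word list) \<Rightarrow> ('g \<Rightarrow> word) \<Rightarrow> bool" where
  "elem W w \<longleftrightarrow> (\<exists>r m. r < m \<and> (\<forall>g. length (W g) = m \<and> W g ! r = w g))"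

lemma wc_fixed: "wc pl f Q p W V \<Longrightarrow> fixed W"
  unfolding wc_def computes_def fixed_def by blast

lemma st_length [simp]: "length ws = m \<Longrightarrow> st ws m = []"
  by (simp add: st_def)

lemma wc_word:
  assumes "fixed W" "ternary w"
  shows "wc pl f Q p W (\<lambda>g. w)"
proof -
  obtain m where m: "\<And>g. length (W g) = m" using assms by (auto simp: fixed_def)
  have *: "\<exists>c. oracle_free c \<and> (\<forall>s Q. s m = [] \<longrightarrow> does f Q c s (Suc (length w)) (s(m := w)))"
  proof (induction w)
    case Nil
    show ?case by (rule exI[of _ Skip]) (auto simp: fun_upd_idem does_Skip[simplified])
  next
    case (Cons a w)
    then obtain c where c: "oracle_free c"
      "\<And>s Q. s m = [] \<Longrightarrow> does f Q c s (Suc (length w)) (s(m := w))" by blast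
    have "does f Q (Seq c (Push m a)) s (Suc (length (a # w))) (s(m := a # w))"
      if "s m = []" for s Q
    proof -
      have "does f Q (Seq c (Push m a)) s (Suc (length w) + 1) (s(m := a # w))"
        by (rule does_Seq[OF c(2)[of s, OF that] does_Push]) simp
      then show ?thesis by simp
    qed
    with c(1) show ?case by (metis oracle_free.simps(2,5))
  qed
  then obtain c where c: "oracle_free c"
      "\<And>s Q. s m = [] \<Longrightarrow> does f Q c s (Suc (length w)) (s(m := w))" by blast
  show ?thesis
    by (rule wcI[of m "Suc m" pl c "\<lambda>_. Suc (length w)"])
      (use m c assms in \<open>auto intro: poly_bounded_const\<close>)
qed

lemma wc_elem:
  fixes W :: "'g \<Rightarrow> word list"
  assumes "elem W w"
  shows "wc pl f Q p W w"
proof -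
  obtain r m where r: "r < m" "\<And>g. length (W g) = m" "\<And>g. W g ! r = w g"
    using assms by (auto simp: elem_def)
  show ?thesis
  proof (rule wcI[where m = m and b = "m + 2" and c = "Seq (pour r [Suc m]) (pour (Suc m) [r, m])"
        and T = "\<lambda>n. Suc (6 * n) + Suc (7 * n)"])
    have w: "ternary (w g)" if "ok (W g)" for g using that r by (metis nth_mem)
    then show "ternary (w g)" if "ok (W g)" for g using that .
    fix g s assume ok: "ok (W g)" and ag: "agree (m + 2) s (W g)"
    have s: "s r = w g" "s m = []" "s (Suc m) = []" using ag r by (auto simp: st_def)
    have "length (w g) \<in> set (map length (W g))" using r nth_mem[of r "W g"] by auto
    then have len: "length (w g) \<le> p g + vol (W g)"
      using member_le_sum_list[of "length (w g)" "map length (W g)"] by simp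
    show "does f (Q g) (Seq (pour r [Suc m]) (pour (Suc m) [r, m])) s
        (Suc (6 * (p g + vol (W g))) + Suc (7 * (p g + vol (W g)))) (s(m := w g))"
      by (rule does_Seq[OF does_pour1[OF _ _ _ refl] does_pour2]) (use r s w[OF ok] len in auto)
  next
    show "poly_bounded (\<lambda>n. Suc (6 * n) + Suc (7 * n))" by (intro poly_bounded_intros)
  qed (use r in auto)
qed

lemma agree_beyond: "agree b s ws \<Longrightarrow> length ws \<le> r \<Longrightarrow> r < b \<Longrightarrow> s r = []"
  by (simp add: st_def)

text \<open>
  The pattern of all binary constructions: the first result is moved to a register \<open>b\<close> above
  both programs while the second is computed. Each move reverses the word; here the second move
  restores the order.
\<close>

lemma wc_append:
  fixes W :: "'g \<Rightarrow> word list"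
  assumes "wc pl f Q p W X" "wc pl f Q p W Y"
  shows "wc pl f Q p W (\<lambda>g. X g @ Y g)"
proof -
  obtain m b1 c1 T1 where c1: "computes pl f Q p W X m b1 c1 T1"
    by (rule wcE[OF assms(1)])
  note 1 = computesD[OF c1]
  obtain m' b2 c2 T2 where c2: "computes pl f Q p W Y m' b2 c2 T2"
    by (rule wcE[OF assms(2)])
  note 2 = computesD[OF c2]
  have m': "m' = m" using 1(5) 2(5) by metis
  define b where "b = max b1 b2"
  have b: "m < b" "b1 \<le> b" "b2 \<le> b" using 1 unfolding b_def by auto
  let ?c = "Seq c1 (Seq (pour m [b]) (Seq c2 (pour b [m])))"
  let ?T = "\<lambda>n. T1 n + (Suc (6 * T1 n) + (T2 n + Suc (6 * T1 n)))"
  show ?thesis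
  proof (rule wcI[where m = m and b = "Suc b" and
        c = ?c and T = ?T])
    fix g s assume ok: "ok (W g)" and ag: "agree (Suc b) s (W g)"
    let ?n = "p g + vol (W g)"
    have s: "s m = []" "s b = []" using ag b 1(5)[of g] by (auto intro: agree_beyond)
    show "does f (Q g) ?c s (?T ?n) (s(m := X g @ Y g))"
    proof (intro does_Seq)
      show "does f (Q g) c1 s (T1 ?n) (s(m := X g))"
        using ok ag b by (intro 1(8)) auto
      show "does f (Q g) (pour m [b]) (s(m := X g)) (Suc (6 * T1 ?n)) (s(b := rev (X g)))"
        using ok s b 1(6,7)[of g] by (intro does_pour1) auto
      show "does f (Q g) c2 (s(b := rev (X g))) (T2 ?n) (s(b := rev (X g), m := Y g))"
        using ok ag b 2(8)[of g "s(b := rev (X g))"] m' by auto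
      show "does f (Q g) (pour b [m]) (s(b := rev (X g), m := Y g)) (Suc (6 * T1 ?n))
          (s(m := X g @ Y g))"
        using ok s b 1(6,7)[of g] by (intro does_pour1) (auto simp: fun_eq_iff)
    qed
  qed (use 1 2 b in \<open>auto intro!: poly_bounded_intros\<close>)
qed

lemma wc_length:
  fixes W :: "'g \<Rightarrow> word list"
  assumes "wc pl f Q p W X"
  shows "uc pl f Q p W (\<lambda>g. length (X g))"
proof -
  obtain m b c T where c1: "computes pl f Q p W X m b c T"
    by (rule wcE[OF assms(1)])
  note 1 = computesD[OF c1]
  show ?thesis
  proof (rule wcI[where m = m and b = "Suc b" and
        c = "Seq c (Seq (drain m b) (drain b m))" and
        T = "\<lambda>n. T n + (Suc (3 * T n) + Suc (3 * T n))"])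
    fix g s assume ok: "ok (W g)" and ag: "agree (Suc b) s (W g)"
    let ?n = "p g + vol (W g)"
    have s: "s m = []" "s b = []" using ag 1(1) 1(5)[of g] by (auto intro: agree_beyond)
    show "does f (Q g) (Seq c (Seq (drain m b) (drain b m))) s
        (T ?n + (Suc (3 * T ?n) + Suc (3 * T ?n)))
        (s(m := replicate (length (X g)) 0))"
    proof (intro does_Seq)
      show "does f (Q g) c s (T ?n) (s(m := X g))"
        using ok ag by (intro 1(8)) auto
      show "does f (Q g) (drain m b) (s(m := X g)) (Suc (3 * T ?n))
          (s(b := replicate (length (X g)) 0))"
        using ok s 1(1) 1(7)[of g] by (intro does_drain) auto
      show "does f (Q g) (drain b m) (s(b := replicate (length (X g)) 0))
          (Suc (3 * T ?n)) (s(m := replicate (length (X g)) 0))"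
        using ok s 1(1) 1(7)[of g] by (intro does_drain) (auto simp: fun_eq_iff)
    qed
  qed (use 1 in \<open>auto intro!: poly_bounded_intros\<close>)
qed

text \<open>
  Dropping gives truncated subtraction on unary numbers and, followed by a look at the top
  symbol, random access to the symbols of a word.
\<close>

lemma wc_drop:
  fixes W :: "'g \<Rightarrow> word list"
  assumes "uc pl f Q p W E" "wc pl f Q p W X"
  shows "wc pl f Q p W (\<lambda>g. drop (E g) (X g))"
proof -
  obtain m b1 c1 T1 where c1: "computes pl f Q p W (\<lambda>g. replicate (E g) 0) m b1 c1 T1"
    by (rule wcE[OF assms(1)])
  note 1 = computesD[OF c1]
  obtain m' b2 c2 T2 where c2: "computes pl f Q p W X m' b2 c2 T2"
    by (rule wcE[OF assms(2)])
  note 2 = computesD[OF c2]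
  have m': "m' = m" using 1(5) 2(5) by metis
  define b where "b = max b1 b2"
  have b: "m < b" "b1 \<le> b" "b2 \<le> b" using 1 unfolding b_def by auto
  let ?c = "Until b None (Seq (Pop b) (Pop m))"
  show ?thesis
  proof (rule wcI[where m = m and b = "Suc b" and
        c = "Seq c1 (Seq (pour m [b]) (Seq c2 ?c))" and
        T = "\<lambda>n. T1 n + (Suc (6 * T1 n) + (T2 n + Suc (3 * T1 n)))"])
    fix g s assume ok: "ok (W g)" and ag: "agree (Suc b) s (W g)"
    let ?n = "p g + vol (W g)"
    have s: "s m = []" "s b = []" using ag b 1(5)[of g] by (auto intro: agree_beyond)
    show "does f (Q g) (Seq c1 (Seq (pour m [b]) (Seq c2 ?c))) s
        (T1 ?n + (Suc (6 * T1 ?n) + (T2 ?n +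
         Suc (3 * T1 ?n)))) (s(m := drop (E g) (X g)))"
    proof (intro does_Seq)
      show "does f (Q g) c1 s (T1 ?n) (s(m := replicate (E g) 0))"
        using ok ag b by (intro 1(8)) auto
      show "does f (Q g) (pour m [b]) (s(m := replicate (E g) 0)) (Suc (6 * T1 ?n))
          (s(b := replicate (E g) 0))"
        using ok s b 1(6,7)[of g] by (intro does_pour1) auto
      show "does f (Q g) c2 (s(b := replicate (E g) 0)) (T2 ?n)
          (s(b := replicate (E g) 0, m := X g))"
        using ok ag b 2(8)[of g "s(b := replicate (E g) 0)"] m' by auto
      let ?S = "\<lambda>i. s(b := replicate (E g - i) 0, m := drop i (X g))"
      have "does f (Q g) ?c (?S 0) (Suc (E g * Suc 2)) (?S (E g))"
      proof (rule does_Until)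
        fix i assume i: "i < E g"
        have "does f (Q g) (Seq (Pop b) (Pop m)) (?S i) (1 + 1) (?S (Suc i))"
          by (rule does_Seq[OF does_Pop[OF refl] does_Pop]) (use i b in \<open>auto simp: fun_eq_iff drop_Suc tl_drop\<close>)
        then show "does f (Q g) (Seq (Pop b) (Pop m)) (?S i) 2 (?S (Suc i))"
          by (simp add: numeral_eq_Suc)
        show "top_symbol (?S i b) \<noteq> None" using i b by (cases "E g - i") auto
      qed (use b in auto)
      moreover have "?S (E g) = s(m := drop (E g) (X g))" using s by (auto simp: fun_eq_iff)
      ultimately show "does f (Q g) ?c (s(b := replicate (E g) 0, m := X g))
          (Suc (3 * T1 ?n)) (s(m := drop (E g) (X g)))"
        using does_mono[of f "Q g" ?c "?S 0" "Suc (E g * Suc 2)" "?S (E g)"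
            "Suc (3 * T1 ?n)"] 1(7)[OF ok] by simp
    qed
  next
    fix g assume "ok (W g)"
    then show "ternary (drop (E g) (X g))" using 2(6)[of g] set_drop_subset by (metis order_trans)
  qed (use 1 2 b in \<open>auto intro!: poly_bounded_intros\<close>)
qed

lemma wc_top:
  fixes W :: "'g \<Rightarrow> word list"
  assumes "wc pl f Q p W X"
  shows "dc pl f Q p W (\<lambda>g. top_symbol (X g) = Some a)"
proof -
  obtain m b c T where c1: "computes pl f Q p W X m b c T"
    by (rule wcE[OF assms(1)])
  note 1 = computesD[OF c1]
  let ?c = "Cond m (Some a) (Seq (clear m) (Push m 0)) (clear m)"
  show ?thesis
  proof (rule wcI[where m = m and b = b and c = "Seq c ?c" and
        T = "\<lambda>n. T n + Suc (Suc (2 * T n) + 1)"])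
    fix g s assume ok: "ok (W g)" and ag: "agree b s (W g)"
    have s: "s m = []" using ag 1(1) 1(5)[of g] by (auto intro: agree_beyond)
    let ?s = "s(m := replicate (of_bool (top_symbol (X g) = Some a)) 0)"
    let ?n = "T (p g + vol (W g))"
    show "does f (Q g) (Seq c ?c) s (?n + Suc (Suc (2 * ?n) + 1)) ?s"
    proof (rule does_Seq)
      show "does f (Q g) c s ?n (s(m := X g))" using ok ag by (intro 1(8)) auto
      have cl: "does f (Q g) (clear m) (s(m := X g)) (Suc (2 * ?n)) (s(m := []))"
        using 1(7)[OF ok] by (intro does_clear) auto
      have "does f (Q g) (if top_symbol ((s(m := X g)) m) = Some a
          then Seq (clear m) (Push m 0) else clear m) (s(m := X g)) (Suc (2 * ?n) + 1) ?s"
      proof (cases "top_symbol (X g) = Some a")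
        case True
        then show ?thesis using does_Seq[OF cl does_Push[of _ _ m 0]] by simp
      next
        case False
        then show ?thesis using does_mono[OF cl, of "Suc (2 * ?n) + 1"] by simp
      qed
      then show "does f (Q g) ?c (s(m := X g)) (Suc (Suc (2 * ?n) + 1)) ?s" by (rule does_Cond)
    qed
  qed (use 1 in \<open>auto intro!: poly_bounded_intros\<close>)
qed

text \<open>
  Weakening. The program for \<open>V\<close> writes its result where \<open>X g\<close> is stored, so \<open>X g\<close> is put aside
  above \<open>b\<close> for that time.
\<close>

lemma wc_snoc:
  fixes W :: "'g \<Rightarrow> word list"
  assumes "wc pl f Q p W V"
  shows "wc pl f Q p (\<lambda>g. W g @ [X g]) V"
proof -
  obtain m b c T where c: "computes pl f Q p W V m b c T" by (rule wcE[OF assms(1)])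
  note 1 = computesD[OF c]
  let ?c = "Seq (pour m [b + 1]) (Seq c (Seq (pour m [b + 2])
    (Seq (pour (b + 1) [m]) (pour (b + 2) [Suc m]))))"
  let ?T = "\<lambda>n. Suc (6 * n) + (T n + (Suc (6 * T n) + (Suc (6 * n) + Suc (6 * T n))))"
  show ?thesis
  proof (rule wcI[where m = "Suc m" and b = "b + 3" and
        c = ?c and T = ?T])
    fix g s assume ok: "ok (W g @ [X g])" and ag: "agree (b + 3) s (W g @ [X g])"
    have ok1: "ok (W g)" and X: "ternary (X g)" using ok by auto
    have s: "s m = X g" "s (Suc m) = []" "s (b + 1) = []" "s (b + 2) = []"
      and ag1: "\<And>r. r < m \<Longrightarrow> s r = st (W g) r" "\<And>r. m < r \<Longrightarrow> r < b \<Longrightarrow> s r = []"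
      using ag 1(1) 1(5)[of g] by (auto simp: st_def nth_append)
    let ?n = "p g + vol (W g @ [X g])"
    have T: "T (p g + vol (W g)) \<le> T ?n" by (rule monoD[OF 1(4)]) simp
    have V: "ternary (V g)" "length (V g) \<le> T ?n" using 1(6)[OF ok1] 1(7)[OF ok1] T by auto
    show "does f (Q g) ?c s (?T ?n) (s(Suc m := V g))"
    proof (intro does_Seq)
      let ?s1 = "s(m := [], b + 1 := rev (X g))"
      show "does f (Q g) (pour m [b + 1]) s (Suc (6 * ?n)) ?s1"
        by (rule does_pour1) (use 1(1) X s in auto)
      have "agree b ?s1 (W g)" using ag1 1(5)[of g] by (auto simp: st_def)
      then show "does f (Q g) c ?s1 (T ?n) (?s1(m := V g))"
        using does_mono[OF 1(8)[OF ok1] T] by blast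
      show "does f (Q g) (pour m [b + 2]) (?s1(m := V g)) (Suc (6 * T ?n)) (?s1(b + 2 := rev (V g)))"
        by (rule does_pour1) (use 1(1) V s in \<open>auto simp: fun_eq_iff\<close>)
      show "does f (Q g) (pour (b + 1) [m]) (?s1(b + 2 := rev (V g))) (Suc (6 * ?n)) (s(b + 2 := rev (V g)))"
        by (rule does_pour1) (use 1(1) X s in \<open>auto simp: fun_eq_iff\<close>)
      show "does f (Q g) (pour (b + 2) [Suc m]) (s(b + 2 := rev (V g))) (Suc (6 * T ?n)) (s(Suc m := V g))"
        by (rule does_pour1) (use 1(1) V s in \<open>auto simp: fun_eq_iff\<close>)
    qed
  qed (use 1 in \<open>auto intro!: poly_bounded_intros\<close>)
qed

text \<open>
  Below a binder the ghost parameter is a pair of the outer parameter and the bound index; with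
  \<open>fst\<close> for \<open>h\<close>, facts about the outer parameter are carried over.
\<close>

lemma wc_reindex:
  assumes "wc pl f Q p W V"
  shows "wc pl f (\<lambda>z. Q (h z)) (\<lambda>z. p (h z)) (\<lambda>z. W (h z)) (\<lambda>z. V (h z))"
  using assms unfolding wc_def computes_def by blast

text \<open>
  The side condition for values that are not the result of a single polynomial program:
  intermediate results of a recursion and answers of the oracle.
\<close>

definition size_bounded :: "('g \<Rightarrow> nat) \<Rightarrow> ('g \<Rightarrow> word list) \<Rightarrow> ('g \<Rightarrow> nat) \<Rightarrow> bool" where
  "size_bounded p W M \<longleftrightarrow> (\<exists>R. poly_bounded R \<and> (\<forall>g. ok (W g) \<longrightarrow> M g \<le> R (p g + vol (W g))))"

lemma size_bounded_length: "wc pl f Q p W V \<Longrightarrow> size_bounded p W (\<lambda>g. length (V g))"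
  unfolding size_bounded_def by (metis computesD(3,7) wcE)

lemma size_bounded_value: "uc pl f Q p W F \<Longrightarrow> size_bounded p W F"
  using size_bounded_length[of pl f Q p W "\<lambda>g. replicate (F g) 0"] by simp

lemma size_bounded_budget: "(\<And>g. M g \<le> p g) \<Longrightarrow> size_bounded p W M"
  unfolding size_bounded_def using poly_bounded_id trans_le_add1 by blast

lemma wc_query:
  fixes W :: "'g \<Rightarrow> word list"
  assumes "wc pl f Q p W X" "\<not> pl" "\<And>g. Q g (X g)"
    and "size_bounded p W (\<lambda>g. length (binary (f (X g))))"
  shows "wc pl f Q p W (\<lambda>g. binary (f (X g)))"
proof -
  obtain m b c T where c: "computes pl f Q p W X m b c T" by (rule wcE[OF assms(1)])
  note 1 = computesD[OF c]
  obtain R where R: "poly_bounded R"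
    "\<And>g. ok (W g) \<Longrightarrow> length (binary (f (X g))) \<le> R (p g + vol (W g))"
    using assms(4) unfolding size_bounded_def by blast
  show ?thesis
  proof (rule wcI[where m = m and b = b and c = "Seq c (Query m m)" and T = "\<lambda>n. T n + (1 + T n + R n)"])
    fix g s assume ok: "ok (W g)" and ag: "agree b s (W g)"
    let ?n = "p g + vol (W g)"
    have "does f (Q g) (Query m m) (s(m := X g)) (1 + length (X g) + length (binary (f (X g))))
        (s(m := binary (f (X g))))"
      using does_Query[of "Q g" "s(m := X g)" m _ m f] assms(3)[of g] by simp
    then have "does f (Q g) (Query m m) (s(m := X g)) (1 + T ?n + R ?n) (s(m := binary (f (X g))))"
      by (rule does_mono) (use 1(7)[OF ok] R(2)[OF ok] in auto)
    then show "does f (Q g) (Seq c (Query m m)) s (T ?n + (1 + T ?n + R ?n)) (s(m := binary (f (X g))))"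
      using 1(8)[OF ok ag] by (rule does_Seq[rotated])
  next
    show "poly_bounded (\<lambda>n. T n + (1 + T n + R n))" by (intro poly_bounded_intros 1(3) R(1))
  next
    show "ternary (binary (f (X g)))" for g using set_binary by blast
  qed (use 1 assms(2) in auto)
qed

text \<open>
  Primitive recursion in which every intermediate value stays small. The two trailing registers
  of the step hold the index in unary and the value reached so far.
\<close>

lemma wc_rec:
  fixes W :: "'g \<Rightarrow> word list" and V :: "'g \<Rightarrow> nat \<Rightarrow> word"
  assumes "uc pl f Q p W n" "wc pl f Q p W (\<lambda>g. V g 0)"
    and "wc pl f (\<lambda>z. Q (fst z)) (\<lambda>z. p (fst z))
      (\<lambda>z. (W (fst z) @ [replicate (snd z) 0]) @ [V (fst z) (snd z)]) (\<lambda>z. V (fst z) (Suc (snd z)))"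
    and "size_bounded p W M" "\<And>g i. i \<le> n g \<Longrightarrow> length (V g i) \<le> M g"
  shows "wc pl f Q p W (\<lambda>g. V g (n g))"
proof -
  obtain m b1 c1 T1 where c1: "computes pl f Q p W (\<lambda>g. replicate (n g) 0) m b1 c1 T1"
    by (rule wcE[OF assms(1)])
  note 1 = computesD[OF c1]
  obtain m' b2 c2 T2 where c2: "computes pl f Q p W (\<lambda>g. V g 0) m' b2 c2 T2"
    by (rule wcE[OF assms(2)])
  note 2 = computesD[OF c2]
  obtain m'' b3 c3 T3 where c3: "computes pl f (\<lambda>z. Q (fst z)) (\<lambda>z. p (fst z))
      (\<lambda>z. (W (fst z) @ [replicate (snd z) 0]) @ [V (fst z) (snd z)]) (\<lambda>z. V (fst z) (Suc (snd z)))
      m'' b3 c3 T3" by (rule wcE[OF assms(3)])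
  note 3 = computesD[OF c3]
  obtain R where R: "poly_bounded R" "\<And>g. ok (W g) \<Longrightarrow> M g \<le> R (p g + vol (W g))"
    using assms(4) unfolding size_bounded_def by blast
  have m: "m' = m" "m'' = m + 2" using 1(5) 2(5) 3(5)[of "(undefined, undefined)"] by auto
  define b where "b = max b1 (max b2 b3)"
  have b: "m + 2 < b" "b1 \<le> b" "b2 \<le> b" "b3 \<le> b" using 3(1) m unfolding b_def by auto
  have ternV: "ternary (V g i)" if "ok (W g)" for g i
  proof (induction i)
    case 0
    show ?case using 2(6) that by blast
  next
    case (Suc i)
    moreover have "ternary (replicate i 0)" by auto
    ultimately show ?case using 3(6)[of "(g, i)"] that by auto
  qed
  \<comment> \<open>In each round the index is at most \<open>T1 k\<close> and the value reached so far has length at most \<open>R k\<close>.\<close>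
  let ?B = "\<lambda>k. T3 (k + T1 k + R k)"
  let ?body = "Seq (Pop b) (Seq c3 (Seq (clear (m + 1)) (Seq (pour (m + 2) [b + 1])
     (Seq (pour (b + 1) [m + 1]) (Push m 0)))))"
  let ?tb = "\<lambda>k. 1 + (?B k + (Suc (2 * R k) + (Suc (6 * R k) + (Suc (6 * R k) + 1))))"
  let ?c = "Seq c1 (Seq (pour m [b]) (Seq c2 (Seq (pour m [b + 1]) (Seq (pour (b + 1) [m + 1])
     (Seq (Until b None ?body) (Seq (clear m) (Seq (pour (m + 1) [b + 1]) (pour (b + 1) [m]))))))))"
  let ?T = "\<lambda>k. T1 k + (Suc (6 * T1 k) + (T2 k + (Suc (6 * R k) + (Suc (6 * R k) +
     (Suc (T1 k * Suc (?tb k)) + (Suc (2 * T1 k) + (Suc (6 * R k) + Suc (6 * R k))))))))"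
  show ?thesis
  proof (rule wcI[where m = m and b = "b + 2" and c = ?c and T = ?T])
    fix g s assume ok: "ok (W g)" and ag: "agree (b + 2) s (W g)"
    let ?k = "p g + vol (W g)"
    have s: "s m = []" "s (m + 1) = []" "s (m + 2) = []" "s b = []" "s (b + 1) = []"
      using ag b 1(5)[of g] by (auto intro: agree_beyond)
    have len: "length (V g i) \<le> R ?k" if "i \<le> n g" for i
      using assms(5)[OF that] R(2)[OF ok] by simp
    have n: "n g \<le> T1 ?k" using 1(7)[OF ok] by simp
    let ?S = "\<lambda>i. s(b := replicate (n g - i) 0, m := replicate i 0, m + 1 := V g i)"
    show "does f (Q g) ?c s (?T ?k) (s(m := V g (n g)))"
    proof (intro does_Seq)
      show "does f (Q g) c1 s (T1 ?k) (s(m := replicate (n g) 0))"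
        using ok ag b by (intro 1(8)) auto
      show "does f (Q g) (pour m [b]) (s(m := replicate (n g) 0)) (Suc (6 * T1 ?k))
          (s(b := replicate (n g) 0))"
        by (rule does_pour1) (use b s n in \<open>auto simp: fun_eq_iff\<close>)
      have "agree b2 (s(b := replicate (n g) 0)) (W g)" using ag b by auto
      from 2(8)[of g "s(b := replicate (n g) 0)", OF ok this]
      show "does f (Q g) c2 (s(b := replicate (n g) 0)) (T2 ?k)
          (s(b := replicate (n g) 0, m := V g 0))" using m by simp
      show "does f (Q g) (pour m [b + 1]) (s(b := replicate (n g) 0, m := V g 0)) (Suc (6 * R ?k))
          (s(b := replicate (n g) 0, b + 1 := rev (V g 0)))"
        by (rule does_pour1) (use b s ternV[OF ok, of 0] len[of 0] in \<open>auto simp: fun_eq_iff\<close>)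
      show "does f (Q g) (pour (b + 1) [m + 1]) (s(b := replicate (n g) 0, b + 1 := rev (V g 0)))
          (Suc (6 * R ?k)) (?S 0)"
        by (rule does_pour1) (use b s ternV[OF ok, of 0] len[of 0] in \<open>auto simp: fun_eq_iff\<close>)
      have "does f (Q g) (Until b None ?body) (?S 0) (Suc (n g * Suc (?tb ?k))) (?S (n g))"
      proof (rule does_Until)
        fix i assume i: "i < n g"
        show "top_symbol (?S i b) \<noteq> None" using i b by (cases "n g - i") auto
        let ?s = "s(b := replicate (n g - Suc i) 0, m := replicate i 0, m + 1 := V g i)"
        have ok3: "ok ((W g @ [replicate i 0]) @ [V g i])" using ok ternV[OF ok] by auto
        have lt: "length (V g i) \<le> R ?k" "length (V g (Suc i)) \<le> R ?k"
          using len i by auto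
        show "does f (Q g) ?body (?S i) (?tb ?k) (?S (Suc i))"
        proof (intro does_Seq)
          show "does f (Q g) (Pop b) (?S i) 1 ?s"
            by (rule does_Pop) (use b i in \<open>auto simp: fun_eq_iff\<close>)
          have "agree b3 ?s ((W g @ [replicate i 0]) @ [V g i])"
            using ag b 1(5)[of g] by (auto simp: st_def nth_append)
          from 3(8)[of "(g, i)" ?s, simplified fst_conv snd_conv, OF ok3 this]
          have "does f (Q g) c3 ?s (T3 (p g + vol ((W g @ [replicate i 0]) @ [V g i])))
              (?s(m + 2 := V g (Suc i)))" using m by simp
          moreover have "T3 (p g + vol ((W g @ [replicate i 0]) @ [V g i])) \<le> ?B ?k"
            by (rule monoD[OF 3(4)]) (use i n lt in simp)
          ultimately show "does f (Q g) c3 ?s (?B ?k) (?s(m + 2 := V g (Suc i)))"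
            by (rule does_mono)
          let ?s2 = "s(b := replicate (n g - Suc i) 0, m := replicate i 0, m + 2 := V g (Suc i))"
          show "does f (Q g) (clear (m + 1)) (?s(m + 2 := V g (Suc i))) (Suc (2 * R ?k)) ?s2"
            by (rule does_clear) (use b s lt in \<open>auto simp: fun_eq_iff\<close>)
          let ?s3 = "s(b := replicate (n g - Suc i) 0, m := replicate i 0, b + 1 := rev (V g (Suc i)))"
          show "does f (Q g) (pour (m + 2) [b + 1]) ?s2 (Suc (6 * R ?k)) ?s3"
            by (rule does_pour1) (use b s lt ternV[OF ok, of "Suc i"] in \<open>auto simp: fun_eq_iff\<close>)
          let ?s4 = "s(b := replicate (n g - Suc i) 0, m := replicate i 0, m + 1 := V g (Suc i))"
          show "does f (Q g) (pour (b + 1) [m + 1]) ?s3 (Suc (6 * R ?k)) ?s4"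
            by (rule does_pour1) (use b s lt ternV[OF ok, of "Suc i"] in \<open>auto simp: fun_eq_iff\<close>)
          show "does f (Q g) (Push m 0) ?s4 1 (?S (Suc i))"
            by (rule does_Push) (use b in \<open>auto simp: fun_eq_iff\<close>)
        qed
      qed (use b in auto)
      then show "does f (Q g) (Until b None ?body) (?S 0) (Suc (T1 ?k * Suc (?tb ?k))) (?S (n g))"
        by (rule does_mono) (use n in \<open>simp del: mult_Suc_right\<close>)
      show "does f (Q g) (clear m) (?S (n g)) (Suc (2 * T1 ?k)) (s(m + 1 := V g (n g)))"
        by (rule does_clear) (use b s n in \<open>auto simp: fun_eq_iff\<close>)
      show "does f (Q g) (pour (m + 1) [b + 1]) (s(m + 1 := V g (n g))) (Suc (6 * R ?k))
          (s(b + 1 := rev (V g (n g))))"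
        by (rule does_pour1)
          (use b s len[of "n g"] ternV[OF ok, of "n g"] in \<open>auto simp: fun_eq_iff\<close>)
      show "does f (Q g) (pour (b + 1) [m]) (s(b + 1 := rev (V g (n g)))) (Suc (6 * R ?k))
          (s(m := V g (n g)))"
        by (rule does_pour1)
          (use b s len[of "n g"] ternV[OF ok, of "n g"] in \<open>auto simp: fun_eq_iff\<close>)
    qed
  next
    show "poly_bounded ?T"
      by (intro poly_bounded_intros poly_bounded_comp[OF 3(3)] 1(3) 2(3) R(1))
  qed (use 1 2 3 b ternV in auto)
qed


section \<open>Closure properties\<close>

text \<open>
  The closure rules are meant to be applied by resolution, so that a program for a function
  results from the syntax of the term that defines it. Below binders the registers are those of
  the outer layout followed by the bound index; \<open>leaf_rules\<close> find a variable in such a layout by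
  comparing it with the last register and otherwise discarding that register.
\<close>

lemma wc_last: "fixed W \<Longrightarrow> wc pl f Q p (\<lambda>z. W z @ [X z]) X"
proof (rule wc_elem)
  assume "fixed W"
  then obtain m where "\<And>g. length (W g) = m" unfolding fixed_def by blast
  then show "elem (\<lambda>z. W z @ [X z]) X"
    unfolding elem_def by (intro exI[of _ m] exI[of _ "Suc m"]) (simp add: nth_append)
qed

lemmas wc_fst = wc_reindex[where h = fst]

lemma fixed_snoc: "fixed W \<Longrightarrow> fixed (\<lambda>z. W z @ [X z])"
  and fixed_fst: "fixed W \<Longrightarrow> fixed (\<lambda>z. W (fst z))"
  by (auto simp: fixed_def)

lemma wc_cong: "wc pl f Q p W V \<Longrightarrow> (\<And>g. V g = V' g) \<Longrightarrow> wc pl f Q p W V'"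
  by (metis ext)

lemma uc_cong: "uc pl f Q p W F \<Longrightarrow> (\<And>g. F g = F' g) \<Longrightarrow> uc pl f Q p W F'"
  by simp

lemma uc_const: "fixed W \<Longrightarrow> uc pl f Q p W (\<lambda>g. n)"
  by (rule wc_word) auto

lemma uc_plus:
  assumes "uc pl f Q p W F" "uc pl f Q p W G"
  shows "uc pl f Q p W (\<lambda>g. F g + G g)"
  using wc_append[OF assms] by (simp add: replicate_add)

lemma uc_Suc:
  assumes "uc pl f Q p W F"
  shows "uc pl f Q p W (\<lambda>g. Suc (F g))"
  using uc_plus[OF assms uc_const[OF wc_fixed[OF assms], of _ _ _ _ 1]] by simp

lemma uc_minus:
  assumes "uc pl f Q p W F" "uc pl f Q p W G"
  shows "uc pl f Q p W (\<lambda>g. F g - G g)"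
  using wc_drop[OF assms(2,1)] by (simp add: drop_replicate)

definition has :: "word \<Rightarrow> nat \<Rightarrow> nat \<Rightarrow> bool" where
  "has w i a \<longleftrightarrow> i < length w \<and> w ! i = a"

lemma dc_has:
  assumes "wc pl f Q p W X" "uc pl f Q p W E"
  shows "dc pl f Q p W (\<lambda>g. has (X g) (E g) a)"
proof -
  have "top_symbol (drop i w) = Some a \<longleftrightarrow> has w i a" for i w
    by (cases "i < length w") (auto simp: has_def Cons_nth_drop_Suc[symmetric])
  then show ?thesis using wc_top[OF wc_drop[OF assms(2,1)], of a] by simp
qed

lemmas leaf_rules = wc_last wc_snoc wc_fst fixed_snoc fixed_fst

text \<open>
  Bounded sums are recursions whose values stay small of their own accord, because no summand is
  larger than the time spent on it. Products, bounded quantifiers and division are expressed by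
  sums.
\<close>

lemma uc_sum:
  assumes "uc pl f Q p W n"
    and "uc pl f (\<lambda>z. Q (fst z)) (\<lambda>z. p (fst z)) (\<lambda>z. W (fst z) @ [replicate (snd z) 0])
      (\<lambda>z. G (fst z) (snd z))"
  shows "uc pl f Q p W (\<lambda>g. \<Sum>i<n g. G g i)"
proof -
  let ?V = "\<lambda>g i. replicate (\<Sum>j<i. G g j) 0 :: word"
  have fx: "fixed W" using wc_fixed[OF assms(1)] .
  have "wc pl f Q p W (\<lambda>g. ?V g (n g))"
  proof (rule wc_rec[where V = ?V and M = "\<lambda>g. \<Sum>j<n g. G g j"])
    show "wc pl f (\<lambda>z. Q (fst z)) (\<lambda>z. p (fst z))
      (\<lambda>z. (W (fst z) @ [replicate (snd z) 0]) @ [?V (fst z) (snd z)]) (\<lambda>z. ?V (fst z) (Suc (snd z)))"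
      unfolding sum.lessThan_Suc by (rule uc_plus wc_last wc_snoc[OF assms(2)] fx leaf_rules)+
    show "wc pl f Q p W (\<lambda>g. ?V g 0)" using uc_const[OF fx, of _ _ _ _ 0] by simp
    obtain T1 where T1: "poly_bounded T1" "\<And>g. ok (W g) \<Longrightarrow> n g \<le> T1 (p g + vol (W g))"
      using size_bounded_value[OF assms(1)] unfolding size_bounded_def by blast
    obtain m b c T where "computes pl f (\<lambda>z. Q (fst z)) (\<lambda>z. p (fst z))
      (\<lambda>z. W (fst z) @ [replicate (snd z) 0]) (\<lambda>z. replicate (G (fst z) (snd z)) 0) m b c T"
      by (rule wcE[OF assms(2)])
    note T = computesD(3,4,7)[OF this]
    have "(\<Sum>j<n g. G g j) \<le> T1 (p g + vol (W g)) * T (p g + vol (W g) + T1 (p g + vol (W g)))"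
      if ok: "ok (W g)" for g
    proof -
      let ?k = "p g + vol (W g)"
      have "G g j \<le> T (?k + T1 ?k)" if "j < n g" for j
      proof -
        have "ok (W g @ [replicate j 0])" using ok by auto
        then have "G g j \<le> T (?k + j)" using T(3)[of "(g, j)"] by (simp add: add.assoc)
        also have "\<dots> \<le> T (?k + T1 ?k)" by (rule monoD[OF T(2)]) (use T1(2)[OF ok] that in simp)
        finally show ?thesis .
      qed
      then have "(\<Sum>j<n g. G g j) \<le> n g * T (?k + T1 ?k)"
        using sum_bounded_above[of "{..<n g}" "G g" "T (?k + T1 ?k)"] by simp
      also have "\<dots> \<le> T1 ?k * T (?k + T1 ?k)" using T1(2)[OF ok] by (rule mult_le_mono1)
      finally show ?thesis .
    qed
    then show "size_bounded p W (\<lambda>g. \<Sum>j<n g. G g j)" unfolding size_bounded_def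
      by (intro exI[of _ "\<lambda>k. T1 k * T (k + T1 k)"])
        (auto intro!: poly_bounded_intros poly_bounded_comp[OF T(1)] T1(1))
    show "length (?V g i) \<le> (\<Sum>j<n g. G g j)" if "i \<le> n g" for g i
      using that by (auto intro!: sum_mono2)
  qed (rule assms)
  then show ?thesis .
qed

lemma uc_times:
  assumes "uc pl f Q p W F" "uc pl f Q p W G"
  shows "uc pl f Q p W (\<lambda>g. F g * G g)"
  by (rule uc_cong, rule uc_sum[where n = F and G = "\<lambda>g i. G g"]) (rule assms leaf_rules | simp)+

lemma uc_power:
  assumes "uc pl f Q p W F"
  shows "uc pl f Q p W (\<lambda>g. F g ^ d)"
  by (induction d) (use uc_const[OF wc_fixed[OF assms], of _ _ _ _ 1] uc_times[OF assms] in auto)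

lemma dc_not:
  assumes "dc pl f Q p W P"
  shows "dc pl f Q p W (\<lambda>g. \<not> P g)"
  by (rule uc_cong[OF uc_minus[OF uc_const[OF wc_fixed[OF assms], of _ _ _ _ 1] assms]]) simp

lemma dc_conj:
  assumes "dc pl f Q p W P" "dc pl f Q p W R"
  shows "dc pl f Q p W (\<lambda>g. P g \<and> R g)"
  by (rule uc_cong[OF uc_times[OF assms]]) simp

lemma dc_disj:
  assumes "dc pl f Q p W P" "dc pl f Q p W R"
  shows "dc pl f Q p W (\<lambda>g. P g \<or> R g)"
  by (rule uc_cong[OF dc_not[OF dc_conj[OF dc_not[OF assms(1)] dc_not[OF assms(2)]]]]) simp

lemma dc_imp:
  assumes "dc pl f Q p W P" "dc pl f Q p W R"
  shows "dc pl f Q p W (\<lambda>g. P g \<longrightarrow> R g)"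
  by (rule uc_cong[OF dc_disj[OF dc_not[OF assms(1)] assms(2)]]) simp

lemma dc_iff:
  assumes "dc pl f Q p W P" "dc pl f Q p W R"
  shows "dc pl f Q p W (\<lambda>g. P g \<longleftrightarrow> R g)"
  by (rule uc_cong[OF dc_conj[OF dc_imp[OF assms] dc_imp[OF assms(2,1)]]]) auto

lemma dc_le:
  assumes "uc pl f Q p W F" "uc pl f Q p W G"
  shows "dc pl f Q p W (\<lambda>g. F g \<le> G g)"
proof -
  have "uc pl f Q p W (\<lambda>g. 1 - (F g - G g))"
    by (rule uc_minus uc_const assms wc_fixed[OF assms(1)])+
  then show ?thesis by (rule uc_cong) auto
qed

lemma dc_less:
  assumes "uc pl f Q p W F" "uc pl f Q p W G"
  shows "dc pl f Q p W (\<lambda>g. F g < G g)"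
  by (rule uc_cong[OF dc_le[OF uc_Suc[OF assms(1)] assms(2)]]) (simp add: Suc_le_eq)

lemma dc_eq:
  fixes F G :: "'g \<Rightarrow> nat"
  assumes "uc pl f Q p W F" "uc pl f Q p W G"
  shows "dc pl f Q p W (\<lambda>g. F g = G g)"
  by (rule uc_cong[OF dc_conj[OF dc_le[OF assms] dc_le[OF assms(2,1)]]]) auto

lemma dc_all_less:
  assumes "uc pl f Q p W n"
    and "dc pl f (\<lambda>z. Q (fst z)) (\<lambda>z. p (fst z)) (\<lambda>z. W (fst z) @ [replicate (snd z) 0])
      (\<lambda>z. P (fst z) (snd z))"
  shows "dc pl f Q p W (\<lambda>g. \<forall>i<n g. P g i)"
proof -
  have "dc pl f Q p W (\<lambda>g. (\<Sum>i<n g. of_bool (\<not> P g i)) = (0 :: nat))"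
    by (rule dc_eq uc_sum assms dc_not uc_const wc_fixed[OF assms(1)])+
  then show ?thesis by (rule uc_cong) auto
qed

text \<open>
  The quotient is the number of positive multiples of the divisor up to the dividend; the factor
  \<open>of_bool (0 < G g)\<close> accounts for division by 0.
\<close>

lemma uc_div:
  assumes "uc pl f Q p W F" "uc pl f Q p W G"
  shows "uc pl f Q p W (\<lambda>g. F g div G g)"
proof -
  note fx = wc_fixed[OF assms(1)]
  have "uc pl f Q p W (\<lambda>g. of_bool (0 < G g) * (\<Sum>i<F g. of_bool (Suc i * G g \<le> F g)))"
    by (rule uc_const uc_times dc_less dc_le uc_sum uc_Suc assms leaf_rules fx)+
  moreover have "of_bool (0 < b) * (\<Sum>i<a. of_bool (Suc i * b \<le> a)) = a div b" for a b :: nat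
  proof (cases "b = 0")
    case False
    have "i < a div b \<longleftrightarrow> i < a \<and> Suc i * b \<le> a" for i
    proof -
      have "Suc i * 1 \<le> Suc i * b" by (rule mult_le_mono2) (use False in simp)
      then show ?thesis
        using False less_eq_div_iff_mult_less_eq[of b "Suc i" a] by (auto simp: Suc_le_eq)
    qed
    then have "{i. i < a \<and> Suc i * b \<le> a} = {..<a div b}" by auto
    moreover have "(\<Sum>i<a. of_bool (Suc i * b \<le> a) :: nat) = card {i. i < a \<and> Suc i * b \<le> a}"
      by (simp add: sum_of_bool_eq Int_def)
    ultimately show ?thesis using False by simp
  qed simp
  ultimately show ?thesis by (rule uc_cong)
qed

lemma uc_mod:
  assumes "uc pl f Q p W F" "uc pl f Q p W G"
  shows "uc pl f Q p W (\<lambda>g. F g mod G g)"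
  by (rule uc_cong[OF uc_minus[OF assms(1) uc_times[OF uc_div[OF assms] assms(2)]]])
    (metis minus_div_mult_eq_mod)

lemma dc_odd:
  assumes "uc pl f Q p W F"
  shows "dc pl f Q p W (\<lambda>g. odd (F g))"
proof -
  have "uc pl f Q p W (\<lambda>g. F g mod 2)" by (rule uc_mod uc_const assms wc_fixed[OF assms])+
  then show ?thesis by (rule uc_cong) (auto simp: odd_iff_mod_2_eq_one)
qed

text \<open>
  Both words are computed, and the unwanted one is dropped entirely.
\<close>

lemma wc_if:
  assumes "dc pl f Q p W P" "wc pl f Q p W X" "wc pl f Q p W Y"
  shows "wc pl f Q p W (\<lambda>g. if P g then X g else Y g)"
proof -
  have "wc pl f Q p W (\<lambda>g. drop (of_bool (\<not> P g) * length (X g)) (X g) @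
      drop (of_bool (P g) * length (Y g)) (Y g))"
    by (rule wc_append wc_drop uc_times dc_not wc_length assms)+
  then show ?thesis by (rule wc_cong) simp
qed

lemma uc_if:
  assumes "dc pl f Q p W P" "uc pl f Q p W F" "uc pl f Q p W G"
  shows "uc pl f Q p W (\<lambda>g. if P g then F g else G g)"
  using wc_if[OF assms] by (simp add: if_distrib[of "\<lambda>n. replicate n 0"])

lemma wc_map:
  assumes "uc pl f Q p W n"
    and "uc pl f (\<lambda>z. Q (fst z)) (\<lambda>z. p (fst z)) (\<lambda>z. W (fst z) @ [replicate (snd z) 0])
      (\<lambda>z. G (fst z) (snd z))"
    and "\<And>g i. G g i \<le> 2"
  shows "wc pl f Q p W (\<lambda>g. map (G g) [0..<n g])"
proof -
  let ?V = "\<lambda>g i. map (G g) [0..<i]"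
  note fx = wc_fixed[OF assms(1)]
  show ?thesis
  proof (rule wc_rec[where V = ?V and M = n])
    let ?W = "\<lambda>z. (W (fst z) @ [replicate (snd z) 0]) @ [?V (fst z) (snd z)]"
    have G: "uc pl f (\<lambda>z. Q (fst z)) (\<lambda>z. p (fst z)) ?W (\<lambda>z. G (fst z) (snd z))"
      by (rule wc_snoc assms)+
    note fx' = wc_fixed[OF G]
    have "wc pl f (\<lambda>z. Q (fst z)) (\<lambda>z. p (fst z)) ?W
        (\<lambda>z. if G (fst z) (snd z) = 0 then [0] else if G (fst z) (snd z) = 1 then [1] else [2])"
      by (rule wc_if dc_eq G uc_const fx' wc_word[OF fx'] | simp)+
    moreover have "(if G g i = 0 then [0] else if G g i = 1 then [1] else [2]) = [G g i]" for g i
      using assms(3)[of g i] by auto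
    ultimately have "wc pl f (\<lambda>z. Q (fst z)) (\<lambda>z. p (fst z)) ?W (\<lambda>z. [G (fst z) (snd z)])"
      by simp
    from wc_append[OF wc_last this] fx
    show "wc pl f (\<lambda>z. Q (fst z)) (\<lambda>z. p (fst z)) ?W (\<lambda>z. ?V (fst z) (Suc (snd z)))"
      by (simp add: fixed_snoc fixed_fst)
    show "wc pl f Q p W (\<lambda>g. ?V g 0)" using wc_word[OF fx, of "[]"] by simp
    show "size_bounded p W n" using size_bounded_value[OF assms(1)] .
  qed (use assms in auto)
qed


subsection \<open>Powers of two and binary numerals\<close>

text \<open>
  Shifting is done by repeated halving and never enlarges the number, whereas \<open>2 ^ E g\<close> may be
  exponential. This is why \<open>uc_pow2\<close> has a size condition, and why digits are extracted by
  shifting.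
\<close>

lemma uc_shift:
  assumes "uc pl f Q p W F" "uc pl f Q p W E"
  shows "uc pl f Q p W (\<lambda>g. F g div 2 ^ E g)"
proof -
  let ?V = "\<lambda>g i. replicate (F g div 2 ^ i) 0 :: word"
  note fx = wc_fixed[OF assms(1)]
  have "wc pl f Q p W (\<lambda>g. ?V g (E g))"
  proof (rule wc_rec[where V = ?V and M = F])
    have "wc pl f (\<lambda>z. Q (fst z)) (\<lambda>z. p (fst z))
        (\<lambda>z. (W (fst z) @ [replicate (snd z) 0]) @ [?V (fst z) (snd z)])
        (\<lambda>z. replicate ((F (fst z) div 2 ^ snd z) div 2) 0)"
      by (rule uc_div wc_last uc_const leaf_rules fx)+
    then show "wc pl f (\<lambda>z. Q (fst z)) (\<lambda>z. p (fst z))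
        (\<lambda>z. (W (fst z) @ [replicate (snd z) 0]) @ [?V (fst z) (snd z)])
        (\<lambda>z. ?V (fst z) (Suc (snd z)))"
      by (simp only: power_Suc2 div_mult2_eq)
  qed (use assms size_bounded_value[OF assms(1)] in auto)
  then show ?thesis .
qed

lemma uc_pow2:
  assumes "uc pl f Q p W E" "size_bounded p W (\<lambda>g. 2 ^ E g)"
  shows "uc pl f Q p W (\<lambda>g. 2 ^ E g)"
proof -
  let ?V = "\<lambda>g i. replicate (2 ^ i) 0 :: word"
  note fx = wc_fixed[OF assms(1)]
  have "wc pl f Q p W (\<lambda>g. ?V g (E g))"
  proof (rule wc_rec[where V = ?V and M = "\<lambda>g. 2 ^ E g"])
    show "wc pl f (\<lambda>z. Q (fst z)) (\<lambda>z. p (fst z))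
        (\<lambda>z. (W (fst z) @ [replicate (snd z) 0]) @ [?V (fst z) (snd z)])
        (\<lambda>z. ?V (fst z) (Suc (snd z)))"
      unfolding power_Suc by (rule uc_times wc_last uc_const leaf_rules fx)+
    show "wc pl f Q p W (\<lambda>g. ?V g 0)" using uc_const[OF fx, of _ _ _ _ 1] by simp
  qed (use assms in \<open>auto intro: power_increasing\<close>)
  then show ?thesis .
qed

text \<open>
  The value of a binary word, least significant digit first. Symbols other than 1 count as the
  digit 0.
\<close>

primrec bval :: "word \<Rightarrow> nat" where
  "bval [] = 0"
| "bval (b # w) = of_bool (b = 1) + 2 * bval w"

text \<open>
  Horner's scheme from the most significant digit: the value of the last \<open>i\<close> digits. No value on
  the way exceeds the final one.
\<close>

primrec bval_prefix :: "word \<Rightarrow> nat \<Rightarrow> nat" where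
  "bval_prefix w 0 = 0"
| "bval_prefix w (Suc i) = 2 * bval_prefix w i + of_bool (has w (length w - Suc i) 1)"

lemma bval_prefix: "i \<le> length w \<Longrightarrow> bval_prefix w i = bval (drop (length w - i) w)"
proof (induction i)
  case (Suc i)
  then have *: "length w - Suc i < length w" "Suc (length w - Suc i) = length w - i" by auto
  have "drop (length w - Suc i) w = w ! (length w - Suc i) # drop (length w - i) w"
    using Cons_nth_drop_Suc[OF *(1)] *(2) by simp
  with Suc * show ?case by (simp add: has_def)
qed simp

lemma bval_drop_le: "bval (drop i w) \<le> bval w"
proof (induction w arbitrary: i)
  case (Cons a w)
  have "bval (drop j w) \<le> bval (a # w)" for j using Cons[of j] by simp
  then show ?case by (cases i) auto
qed simp

lemma uc_bval:
  assumes "wc pl f Q p W X" "size_bounded p W (\<lambda>g. bval (X g))"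
  shows "uc pl f Q p W (\<lambda>g. bval (X g))"
proof -
  let ?V = "\<lambda>g i. replicate (bval_prefix (X g) i) 0 :: word"
  note fx = wc_fixed[OF assms(1)]
  have "wc pl f Q p W (\<lambda>g. ?V g (length (X g)))"
  proof (rule wc_rec[where V = ?V and M = "\<lambda>g. bval (X g)"])
    show "wc pl f (\<lambda>z. Q (fst z)) (\<lambda>z. p (fst z))
        (\<lambda>z. (W (fst z) @ [replicate (snd z) 0]) @ [?V (fst z) (snd z)])
        (\<lambda>z. ?V (fst z) (Suc (snd z)))"
      unfolding bval_prefix.simps
      by (rule uc_plus uc_times wc_last uc_const uc_minus uc_Suc dc_has wc_length assms(1) leaf_rules fx)+
    show "wc pl f Q p W (\<lambda>g. ?V g 0)" using uc_const[OF fx, of _ _ _ _ 0] by simp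
    show "length (?V g i) \<le> bval (X g)" if "i \<le> length (X g)" for g i
      using that by (simp add: bval_prefix bval_drop_le)
  qed (rule wc_length assms)+
  then show ?thesis by (simp add: bval_prefix)
qed

lemma bval_binary [simp]: "bval (binary n) = n"
proof (induction n rule: binary.induct)
  case (2 n)
  have "of_bool (Suc n mod 2 = 1) = Suc n mod 2" by auto
  with 2 show ?case by simp
qed simp

lemma binary_bval:
  assumes "set w \<subseteq> {0, 1}" "w \<noteq> [] \<Longrightarrow> last w = 1"
  shows "binary (bval w) = w"
  using assms
proof (induction w)
  case (Cons b w)
  have w: "binary (bval w) = w" using Cons by (cases w) auto
  have b: "b = 0 \<or> b = 1" using Cons.prems by auto
  have "bval (b # w) \<noteq> 0"
  proof
    assume "bval (b # w) = 0"
    then have "b = 0" "bval w = 0" using b by auto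
    with w have "w = []" by simp
    with \<open>b = 0\<close> Cons.prems(2) show False by simp
  qed
  then obtain k where k: "bval (b # w) = Suc k" by (cases "bval (b # w)") auto
  have "Suc k mod 2 = b" "Suc k div 2 = bval w" unfolding k[symmetric] using b by auto
  with w k show ?case by simp
qed simp

lemma less_length_binary: "i < length (binary n) \<longleftrightarrow> 0 < n div 2 ^ i"
proof (induction n arbitrary: i rule: binary.induct)
  case (2 n)
  then show ?case by (cases i) (auto simp: div_mult2_eq)
qed simp

lemma nth_binary: "i < length (binary n) \<Longrightarrow> binary n ! i = of_bool (odd (n div 2 ^ i))"
proof (induction n arbitrary: i rule: binary.induct)
  case (2 n)
  then show ?case by (cases i) (auto simp: div_mult2_eq odd_iff_mod_2_eq_one)
qed simp

lemma length_binary_le: "n < 2 ^ k \<Longrightarrow> length (binary n) \<le> k"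
  using less_length_binary[of k n] by (simp add: not_less[symmetric])

text \<open>
  A description of binary numerals by sums and shifts. The index of every digit is below \<open>n\<close>, so
  \<open>n\<close> itself bounds the count of the digits.
\<close>

lemma binary_eq_map:
  "binary n = map (\<lambda>i. of_bool (odd (n div 2 ^ i))) [0..<\<Sum>i<n. of_bool (0 < n div 2 ^ i)]"
proof -
  have le: "length (binary n) \<le> n" by (rule length_binary_le) (rule less_exp)
  have "(\<Sum>i<n. of_bool (0 < n div 2 ^ i) :: nat) = (\<Sum>i<n. of_bool (i < length (binary n)))"
    by (simp only: less_length_binary)
  also have "\<dots> = card ({..<n} \<inter> {..<length (binary n)})"
    by (simp add: lessThan_def)
  also have "{..<n} \<inter> {..<length (binary n)} = {..<length (binary n)}" using le by auto
  finally have len: "(\<Sum>i<n. of_bool (0 < n div 2 ^ i)) = length (binary n)" by simp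
  show ?thesis unfolding len by (rule nth_equalityI) (simp_all add: nth_binary)
qed

lemma wc_binary:
  assumes "uc pl f Q p W F"
  shows "wc pl f Q p W (\<lambda>g. binary (F g))"
  unfolding binary_eq_map
  by (rule wc_map uc_sum dc_less dc_odd uc_shift uc_const wc_last assms leaf_rules wc_fixed[OF assms] | simp)+


section \<open>Recognising encoded instances\<close>

text \<open>
  The notions below are defined for arbitrary words by bounded sums and quantifiers, in reach of
  the closure rules. On an encoded instance, \<open>sep\<close> is the position of the separator, which is
  also the number of digits of \<open>k\<close>, and \<open>side\<close> is the number of vertices, the integer square
  root of the length of the matrix.
\<close>

definition sep :: "word \<Rightarrow> nat" where
  "sep x = (\<Sum>i<length x. of_bool (\<forall>j<Suc i. \<not> has x j 2))"

definition side :: "word \<Rightarrow> nat" where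
  "side x = (\<Sum>i<length x. of_bool (Suc i * Suc i \<le> length x - Suc (sep x)))"

definition adj :: "word \<Rightarrow> nat \<Rightarrow> nat \<Rightarrow> bool" where
  "adj x i j \<longleftrightarrow> has x (Suc (sep x) + i * side x + j) 1"

definition valid :: "word \<Rightarrow> bool" where
  "valid x \<longleftrightarrow> has x (sep x) 2 \<and> (\<forall>i<length x. i = sep x \<or> has x i 0 \<or> has x i 1) \<and>
     (sep x = 0 \<or> has x (sep x - 1) 1) \<and> side x * side x = length x - Suc (sep x) \<and>
     (\<forall>i<side x. \<not> adj x i i \<and> (\<forall>j<side x. adj x i j \<longrightarrow> adj x j i))"

text \<open>
  The numeral of \<open>k\<close>, the numbers \<open>k\<close> and \<open>n\<close>, and the edges of an encoded instance. For words
  that encode nothing they describe the empty graph with \<open>k = 0\<close>, in accordance with \<open>param\<close>.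
\<close>

definition kword :: "word \<Rightarrow> word" where
  "kword x = (if valid x then map (\<lambda>i. of_bool (has x i 1)) [0..<sep x] else [])"

definition knum :: "word \<Rightarrow> nat" where
  "knum x = bval (kword x)"

definition nnum :: "word \<Rightarrow> nat" where
  "nnum x = (if valid x then side x else 0)"

definition edges :: "word \<Rightarrow> nat set set" where
  "edges x = {{i, j} | i j. i < nnum x \<and> j < nnum x \<and> adj x i j}"

text \<open>
  The encoding of a graph that is given by an adjacency relation. The matrix is indexed by a
  single number, so that it can be written by one loop.
\<close>

definition instance_word :: "word \<Rightarrow> nat \<Rightarrow> (nat \<Rightarrow> nat \<Rightarrow> bool) \<Rightarrow> word" where
  "instance_word w n A = w @ [2] @ map (\<lambda>q. of_bool (A (q div n) (q mod n))) [0..<n * n]"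

lemma concat_map_rows:
  assumes "n > 0"
  shows "concat (map (\<lambda>i. map (h i) [0..<n]) [0..<m]) = map (\<lambda>q. h (q div n) (q mod n)) [0..<m * n]"
proof (induction m)
  case (Suc m)
  have "map (h m) [0..<n] = map (\<lambda>q. h (q div n) (q mod n)) [m * n..<m * n + n]"
  proof (rule nth_equalityI)
    fix i assume "i < length (map (h m) [0..<n])"
    then have i: "i < n" by simp
    then have "(m * n + i) div n = m" "(m * n + i) mod n = i" by auto
    with i show "map (h m) [0..<n] ! i = map (\<lambda>q. h (q div n) (q mod n)) [m * n..<m * n + n] ! i"
      by simp
  qed simp
  moreover have "[0..<Suc m * n] = [0..<m * n] @ [m * n..<m * n + n]"
    using upt_add_eq_append[of 0 "m * n" n] by (simp add: add.commute)
  ultimately show ?case using Suc by simp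
qed simp

lemma encode_instance_eq:
  "encode_instance n E k = instance_word (binary k) n (\<lambda>i j. {i, j} \<in> E)"
proof (cases "n = 0")
  case False
  then show ?thesis
    unfolding encode_instance_def instance_word_def
    using concat_map_rows[of n "\<lambda>i j. of_bool ({i, j} \<in> E)" n] False by (simp add: of_bool_def)
qed (simp add: encode_instance_def instance_word_def)

lemma instance_word_cong:
  assumes "\<And>i j. i < n \<Longrightarrow> j < n \<Longrightarrow> A i j \<longleftrightarrow> B i j"
  shows "instance_word w n A = instance_word w n B"
proof -
  have "q div n < n \<and> q mod n < n" if "q < n * n" for q
    using that by (cases "n = 0") (auto simp: less_mult_imp_div_less)
  then show ?thesis using assms by (auto simp: instance_word_def)
qed

lemma sum_of_bool_less: "m \<le> n \<Longrightarrow> (\<Sum>i<n. of_bool (i < m)) = (m :: nat)"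
proof -
  assume "m \<le> n"
  then have "{..<n} \<inter> {i. i < m} = {..<m}" by auto
  then show ?thesis by simp
qed

lemma sep_eq:
  assumes "2 \<notin> set w"
  shows "sep (w @ 2 # y) = length w"
proof -
  let ?x = "w @ 2 # y"
  have "(\<forall>j<Suc i. \<not> has ?x j 2) \<longleftrightarrow> i < length w" if "i < length ?x" for i
  proof
    assume "\<forall>j<Suc i. \<not> has ?x j 2"
    then have "\<not> length w < Suc i" by (auto simp: has_def)
    then show "i < length w" by simp
  next
    assume i: "i < length w"
    have "\<not> has ?x j 2" if "j < Suc i" for j
    proof -
      have "w ! j \<in> set w" using that i by (intro nth_mem) simp
      then have "w ! j \<noteq> 2" using assms by auto
      then show ?thesis using that i by (simp add: has_def nth_append)
    qed
    then show "\<forall>j<Suc i. \<not> has ?x j 2" by blast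
  qed
  then have "sep ?x = (\<Sum>i<length ?x. of_bool (i < length w))"
    unfolding sep_def by (intro sum.cong) auto
  also have "\<dots> = length w" by (rule sum_of_bool_less) simp
  finally show ?thesis .
qed

lemma side_eq:
  assumes "2 \<notin> set w" "length y = n * n"
  shows "side (w @ 2 # y) = n"
proof -
  let ?x = "w @ 2 # y"
  have "Suc i * Suc i \<le> length ?x - Suc (sep ?x) \<longleftrightarrow> i < n" for i
  proof -
    have "Suc i * Suc i \<le> n * n \<longleftrightarrow> Suc i \<le> n"
      using power2_nat_le_eq_le[of "Suc i" n] by (simp only: power2_eq_square)
    then show ?thesis using assms by (simp add: sep_eq Suc_le_eq)
  qed
  then have "side ?x = (\<Sum>i<length ?x. of_bool (i < n))" unfolding side_def by simp
  also have "\<dots> = n" by (rule sum_of_bool_less) (use assms in \<open>simp add: le_square trans_le_add2 le_SucI\<close>)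
  finally show ?thesis .
qed

lemma pair_index_less:
  assumes "i < m" "j < (n :: nat)"
  shows "i * n + j < m * n"
proof -
  have "Suc i * n \<le> m * n" using assms(1) by (intro mult_le_mono1) simp
  then show ?thesis using assms(2) by simp
qed

lemma adj_eq:
  assumes "2 \<notin> set w" "length y = n * n" "i < n" "j < n"
  shows "adj (w @ 2 # y) i j \<longleftrightarrow> y ! (i * n + j) = 1"
proof -
  have "i * n + j < n * n" using assms(3,4) by (rule pair_index_less)
  then show ?thesis unfolding adj_def side_eq[OF assms(1,2)] sep_eq[OF assms(1)] has_def
    using assms(2) by (simp add: nth_append add.assoc)
qed

lemma instance_word_decode:
  assumes "x = instance_word (binary k) n A"
  shows "sep x = length (binary k)" "side x = n" "\<And>i j. i < n \<Longrightarrow> j < n \<Longrightarrow> adj x i j \<longleftrightarrow> A i j"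
proof -
  let ?y = "map (\<lambda>q. of_bool (A (q div n) (q mod n))) [0..<n * n] :: word"
  have x: "x = binary k @ 2 # ?y" using assms by (simp add: instance_word_def)
  have two: "2 \<notin> set (binary k)" using set_binary[of k] by auto
  show "sep x = length (binary k)" "side x = n" unfolding x by (simp_all add: sep_eq side_eq two)
  fix i j assume ij: "i < n" "j < n"
  have "i * n + j < n * n" using ij by (rule pair_index_less)
  moreover have "(i * n + j) div n = i" "(i * n + j) mod n = j" using ij by auto
  ultimately show "adj x i j \<longleftrightarrow> A i j" unfolding x by (subst adj_eq[OF two _ ij]) auto
qed

lemma binary_eq_Nil [simp]: "binary n = [] \<longleftrightarrow> n = 0"
  by (cases n) auto

lemma encode_instance_valid:
  assumes "simple_graph {..<n} E"
  shows "valid (encode_instance n E k)"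
proof -
  let ?x = "encode_instance n E k"
  note x = encode_instance_eq[of n E k]
  note dec = instance_word_decode[OF x]
  have edge: "{i} \<notin> E" for i using assms by (auto simp: simple_graph_def)
  have "has ?x (length (binary k)) 2" unfolding x by (simp add: has_def instance_word_def)
  then have sep2: "has ?x (sep ?x) 2" using dec(1) by simp
  have len: "length ?x = Suc (length (binary k) + n * n)" unfolding x by (simp add: instance_word_def)
  have "has ?x i 0 \<or> has ?x i 1" if "i < length ?x" "i \<noteq> sep ?x" for i
  proof (cases "i < length (binary k)")
    case True
    then have "?x ! i \<in> set (binary k)" unfolding x by (simp add: instance_word_def nth_append)
    then show ?thesis using set_binary[of k] that by (auto simp: has_def)
  next
    case False
    with that have "i - Suc (length (binary k)) < n * n" "length (binary k) < i"
      unfolding dec(1) len by auto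
    then show ?thesis using that unfolding x has_def instance_word_def by (auto simp: nth_append)
  qed
  moreover have "has ?x (sep ?x - 1) 1" if "sep ?x \<noteq> 0"
  proof -
    have last: "k \<noteq> 0 \<Longrightarrow> last (binary k) = 1" for k
    proof (induction k rule: binary.induct)
      case (2 k)
      then show ?case by (cases "Suc k div 2 = 0") auto
    qed simp
    have "k \<noteq> 0" using that unfolding dec(1) by (cases k) auto
    then have "binary k \<noteq> []" "binary k ! (length (binary k) - 1) = 1"
      using last that unfolding dec(1) by (auto simp: last_conv_nth)
    then have "has ?x (length (binary k) - 1) 1"
      unfolding x by (simp add: has_def instance_word_def nth_append)
    then show ?thesis using dec(1) by simp
  qed
  ultimately show ?thesis unfolding valid_def
    using sep2 dec len edge by (auto simp: insert_commute)
qed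

text \<open>
  The conditions in \<open>valid\<close> are sufficient: a canonical numeral is determined by its value, and
  the symmetric matrix without diagonal entries is the adjacency matrix of \<open>edges x\<close>.
\<close>

lemma valid_decode:
  assumes "valid x"
  shows "simple_graph {..<nnum x} (edges x)" "x = encode_instance (nnum x) (edges x) (knum x)"
    "kword x = binary (knum x)" "\<And>i j. i < nnum x \<Longrightarrow> j < nnum x \<Longrightarrow> {i, j} \<in> edges x \<longleftrightarrow> adj x i j"
proof -
  define n where "n = side x"
  have n: "nnum x = n" using assms by (simp add: nnum_def n_def)
  define w where "w = take (sep x) x"
  define y where "y = drop (Suc (sep x)) x"
  have s: "sep x < length x" "x ! sep x = 2" using assms by (auto simp: valid_def has_def)
  have x: "x = w @ 2 # y" unfolding w_def y_def using id_take_nth_drop[OF s(1)] s(2) by simp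
  have entries: "x ! i = 0 \<or> x ! i = 1" if "i < length x" "i \<noteq> sep x" for i
    using assms that by (auto simp: valid_def has_def)
  have lw: "length w = sep x" unfolding w_def using s by simp
  have w01: "set w \<subseteq> {0, 1}"
  proof
    fix a assume "a \<in> set w"
    then obtain i where "i < length w" "w ! i = a" by (auto simp: in_set_conv_nth)
    then show "a \<in> {0, 1}" using entries[of i] lw s by (auto simp: w_def)
  qed
  have ly: "length y = n * n" using assms by (auto simp: valid_def y_def n_def)
  have y01: "y ! q = 0 \<or> y ! q = 1" if "q < n * n" for q
    using entries[of "Suc (sep x) + q"] that ly s unfolding y_def by auto
  have "map (\<lambda>i. of_bool (has x i 1)) [0..<sep x] = w"
  proof (rule nth_equalityI)
    fix i assume "i < length (map (\<lambda>i. of_bool (has x i 1)) [0..<sep x] :: word)"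
    then show "map (\<lambda>i. of_bool (has x i 1)) [0..<sep x] ! i = w ! i"
      using entries[of i] s by (auto simp: w_def has_def)
  qed (simp add: lw)
  then have kw: "kword x = w" using assms by (simp add: kword_def)
  have "last w = 1" if "w \<noteq> []"
  proof -
    have "sep x \<noteq> 0" using that unfolding lw[symmetric] by simp
    then have "x ! (sep x - 1) = 1" using assms by (auto simp: valid_def has_def)
    then show ?thesis using that lw \<open>sep x \<noteq> 0\<close> by (simp add: last_conv_nth w_def)
  qed
  then have bw: "binary (knum x) = w" unfolding knum_def kw using w01 by (rule binary_bval[rotated])
  then show "kword x = binary (knum x)" using kw by simp
  have irr: "\<not> adj x i i" and sym: "j < n \<Longrightarrow> adj x i j \<Longrightarrow> adj x j i" if "i < n" for i j
    using assms that by (auto simp: valid_def n_def)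
  show edge: "{i, j} \<in> edges x \<longleftrightarrow> adj x i j" if "i < nnum x" "j < nnum x" for i j
    using that sym by (auto simp: edges_def n doubleton_eq_iff)
  have "card {i, j} = 2" if "i < n" "adj x i j" for i j
    using irr that by (cases "i = j") auto
  then show "simple_graph {..<nnum x} (edges x)"
    by (auto simp: simple_graph_def edges_def n)
  have two: "2 \<notin> set w" using w01 by auto
  have "y = map (\<lambda>q. of_bool ({q div n, q mod n} \<in> edges x)) [0..<n * n]"
  proof (rule nth_equalityI)
    fix q assume "q < length y"
    then have q: "q < n * n" using ly by simp
    then have "n > 0" by (cases n) auto
    with q have d: "q div n < n" "q mod n < n" by (auto simp: less_mult_imp_div_less)
    have "adj x (q div n) (q mod n) \<longleftrightarrow> y ! q = 1"
      using adj_eq[OF two ly d] unfolding x[symmetric] by simp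
    then show "y ! q = map (\<lambda>q. of_bool ({q div n, q mod n} \<in> edges x)) [0..<n * n] ! q"
      using q y01[OF q] edge d n by auto
  qed (simp add: ly)
  then show "x = encode_instance (nnum x) (edges x) (knum x)"
    unfolding encode_instance_eq instance_word_def n bw using x by simp
qed

lemma valid_iff: "valid x \<longleftrightarrow> (\<exists>n E k. simple_graph {..<n} E \<and> x = encode_instance n E k)"
  using valid_decode(1,2) encode_instance_valid by blast

lemma invalid_knum: "\<not> valid x \<Longrightarrow> knum x = 0" "\<not> valid x \<Longrightarrow> kword x = []" "\<not> valid x \<Longrightarrow> nnum x = 0"
  by (simp_all add: knum_def kword_def nnum_def)

lemma kword_eq: "kword x = binary (knum x)"
  using valid_decode(3) invalid_knum by (cases "valid x") auto

lemma param_graph_problem: "param (graph_problem F) x = knum x"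
proof (cases "valid x")
  case True
  then show ?thesis using graph_problem_encode_instance(2) valid_decode(1,2) by metis
next
  case False
  then have no: "\<not> (\<exists>n E k. simple_graph {..<n} E \<and> x = encode_instance n E k)"
    by (simp only: valid_iff not_False_eq_True)
  show ?thesis unfolding graph_problem_def problem.simps if_not_P[OF no] using invalid_knum False by simp
qed

lemma count_of_graph_problem:
  "count_of (graph_problem F) x = (if valid x then F {..<nnum x} (edges x) (knum x) else 0)"
proof (cases "valid x")
  case True
  then show ?thesis using graph_problem_encode_instance(1) valid_decode(1,2) by metis
next
  case False
  then have no: "\<not> (\<exists>n E k. simple_graph {..<n} E \<and> x = encode_instance n E k)"
    by (simp only: valid_iff not_False_eq_True)
  show ?thesis unfolding graph_problem_def problem.simps if_not_P[OF no] using False by simp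
qed

lemmas closure_rules = wc_last uc_const
  uc_sum dc_all_less dc_conj dc_disj dc_not dc_imp dc_iff dc_eq dc_less dc_le dc_odd dc_has
  uc_Suc uc_plus uc_minus uc_times uc_shift uc_div uc_mod uc_if wc_length

lemma uc_sep: "wc pl f Q p W x \<Longrightarrow> uc pl f Q p W (\<lambda>g. sep (x g))"
  unfolding sep_def
  subgoal premises x by (rule closure_rules x leaf_rules wc_fixed[OF x])+
  done

lemma uc_side: "wc pl f Q p W x \<Longrightarrow> uc pl f Q p W (\<lambda>g. side (x g))"
  unfolding side_def
  subgoal premises x by (rule closure_rules uc_sep x leaf_rules wc_fixed[OF x])+
  done

lemma dc_adj:
  assumes "wc pl f Q p W x" "uc pl f Q p W i" "uc pl f Q p W j"
  shows "dc pl f Q p W (\<lambda>g. adj (x g) (i g) (j g))"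
  unfolding adj_def by (rule closure_rules uc_sep uc_side assms)+

lemma dc_valid: "wc pl f Q p W x \<Longrightarrow> dc pl f Q p W (\<lambda>g. valid (x g))"
  unfolding valid_def
  subgoal premises x by (rule closure_rules uc_sep uc_side dc_adj x leaf_rules wc_fixed[OF x])+
  done

lemma wc_kword: "wc pl f Q p W x \<Longrightarrow> wc pl f Q p W (\<lambda>g. kword (x g))"
  unfolding kword_def
  subgoal premises x
    by (rule wc_if dc_valid x wc_map wc_word closure_rules uc_sep leaf_rules wc_fixed[OF x] | simp)+
  done

lemma uc_nnum: "wc pl f Q p W x \<Longrightarrow> uc pl f Q p W (\<lambda>g. nnum (x g))"
  unfolding nnum_def
  subgoal premises x by (rule uc_if dc_valid uc_side uc_const x wc_fixed[OF x])+
  done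

lemma wc_instance_word:
  assumes "wc pl f Q p W w" "uc pl f Q p W n"
    and "dc pl f (\<lambda>z. Q (fst z)) (\<lambda>z. p (fst z)) (\<lambda>z. W (fst z) @ [replicate (snd z) 0])
      (\<lambda>z. A (fst z) (snd z div n (fst z)) (snd z mod n (fst z)))"
  shows "wc pl f Q p W (\<lambda>g. instance_word (w g) (n g) (A g))"
  unfolding instance_word_def
  by (rule wc_append wc_map uc_times assms wc_word wc_fixed[OF assms(1)] | simp)+


section \<open>Increasing transversals\<close>

definition rank :: "nat set \<Rightarrow> nat \<Rightarrow> nat" where
  "rank U u = card {v \<in> U. v < u}"

lemma rank_less: "finite U \<Longrightarrow> u \<in> U \<Longrightarrow> u < v \<Longrightarrow> rank U u < rank U v"
  unfolding rank_def by (rule psubset_card_mono) auto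

lemma rank_less_iff: "finite U \<Longrightarrow> u \<in> U \<Longrightarrow> v \<in> U \<Longrightarrow> rank U u < rank U v \<longleftrightarrow> u < v"
  using rank_less[of U u v] rank_less[of U v u] by (cases u v rule: linorder_cases) auto

lemma inj_on_rank: "finite U \<Longrightarrow> inj_on (rank U) U"
  by (rule inj_onI) (metis less_irrefl linorder_neqE_nat rank_less)

lemma rank_less_card: "finite U \<Longrightarrow> u \<in> U \<Longrightarrow> rank U u < card U"
  unfolding rank_def by (rule psubset_card_mono) auto

lemma rank_image: "finite U \<Longrightarrow> rank U ` U = {..<card U}"
  by (rule card_subset_eq) (auto simp: rank_less_card card_image inj_on_rank)

text \<open>
  \<open>C\<close> has as many elements as there are colours and, being a chain, contains no colour twice. So
  it contains every colour, and the colour of an element is the number of elements below it. A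
  transversal that increases in both coordinates is thus determined by its set of second
  coordinates. Both reductions use this to count sets of vertices by sets of coloured vertices.
\<close>

lemma transversal_rank:
  fixes C :: "'a set" and c u :: "'a \<Rightarrow> nat"
  assumes "finite C" "c ` C \<subseteq> {..<k}" "card C = k"
    and "\<forall>a\<in>C. \<forall>b\<in>C. a \<noteq> b \<longrightarrow> (c a < c b \<and> u a < u b) \<or> (c b < c a \<and> u b < u a)"
  shows "inj_on u C" "inj_on c C" "c ` C = {..<k}" "\<And>a. a \<in> C \<Longrightarrow> rank (u ` C) (u a) = c a"
proof -
  have chain: "(c a < c b \<and> u a < u b) \<or> (c b < c a \<and> u b < u a)"
    if "a \<in> C" "b \<in> C" "a \<noteq> b" for a b using assms(4) that by blast
  show inju: "inj_on u C" by (rule inj_onI) (use chain in fastforce)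
  show injc: "inj_on c C" by (rule inj_onI) (use chain in fastforce)
  show img: "c ` C = {..<k}"
    by (rule card_subset_eq) (use assms injc in \<open>auto simp: card_image\<close>)
  fix a assume a: "a \<in> C"
  have less: "u b < u a \<longleftrightarrow> c b < c a" if "b \<in> C" for b
    using chain[OF a that] by (cases "a = b") auto
  have "{v \<in> u ` C. v < u a} = u ` {b \<in> C. c b < c a}" using less by auto
  then have "rank (u ` C) (u a) = card (u ` {b \<in> C. c b < c a})" by (simp add: rank_def)
  also have "\<dots> = card {b \<in> C. c b < c a}"
    by (rule card_image) (rule inj_on_subset[OF inju], auto)
  also have "\<dots> = card (c ` {b \<in> C. c b < c a})"
    by (rule card_image[symmetric]) (rule inj_on_subset[OF injc], auto)
  also have "c ` {b \<in> C. c b < c a} = {..<c a}"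
  proof
    show "{..<c a} \<subseteq> c ` {b \<in> C. c b < c a}"
    proof
      fix i assume i: "i \<in> {..<c a}"
      have "c a < k" using a img by auto
      then have "i \<in> c ` C" using i unfolding img by simp
      with i show "i \<in> c ` {b \<in> C. c b < c a}" by auto
    qed
  qed auto
  finally show "rank (u ` C) (u a) = c a" by simp
qed


section \<open>Sets of pairs as bit masks\<close>

text \<open>
  The numbers below \<open>2 ^ (k * k)\<close> represent the sets of pairs of numbers below \<open>k\<close>, each set
  exactly once (\<open>pset_bij\<close>). So a loop over numbers runs through all these sets, and a number
  can be part of a vertex.
\<close>

definition bitn :: "nat \<Rightarrow> nat \<Rightarrow> nat \<Rightarrow> nat \<Rightarrow> bool" where
  "bitn k h i j \<longleftrightarrow> odd (h div 2 ^ (i * k + j))"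

definition pset :: "nat \<Rightarrow> nat \<Rightarrow> (nat \<times> nat) set" where
  "pset k h = {(i, j). i < k \<and> j < k \<and> bitn k h i j}"

lemma set_decode_bij: "bij_betw set_decode {..<2 ^ m} (Pow {..<m})"
proof (rule bij_betw_byWitness[where f' = set_encode])
  show "\<forall>h\<in>{..<2 ^ m}. set_encode (set_decode h) = h" by simp
  show "\<forall>A\<in>Pow {..<m}. set_decode (set_encode A) = A"
    using finite_subset[OF _ finite_lessThan] by (auto simp: set_encode_inverse)
  show "set_decode ` {..<2 ^ m} \<subseteq> Pow {..<m}"
  proof safe
    fix h p assume h: "h < 2 ^ m" "p \<in> set_decode h"
    show "p < m"
    proof (rule ccontr)
      assume "\<not> p < m"
      then have "(2 :: nat) ^ m \<le> 2 ^ p" by (intro power_increasing) auto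
      with h(1) have "h < 2 ^ p" by (rule less_le_trans)
      then have "h div 2 ^ p = 0" by simp
      with h(2) show False by (simp add: set_decode_def)
    qed
  qed
  show "set_encode ` Pow {..<m} \<subseteq> {..<2 ^ m}"
  proof safe
    fix A assume "A \<subseteq> {..<m}"
    then have "set_encode A \<le> (\<Sum>i<m. 2 ^ i)"
      unfolding set_encode_def by (intro sum_mono2) auto
    also have "\<dots> < 2 ^ m" by (induction m) auto
    finally show "set_encode A < 2 ^ m" .
  qed
qed

lemma pset_bij: "bij_betw (pset k) {..<2 ^ (k * k)} (Pow ({..<k} \<times> {..<k}))"
proof -
  let ?f = "\<lambda>p. (p div k, p mod k)"
  have lt: "p div k < k \<and> p mod k < k" if "p < k * k" for p
    using that by (cases "k = 0") (auto simp: less_mult_imp_div_less)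
  have f: "bij_betw ?f {..<k * k} ({..<k} \<times> {..<k})"
  proof (rule bij_betw_byWitness[where f' = "\<lambda>(i, j). i * k + j"])
    show "?f ` {..<k * k} \<subseteq> {..<k} \<times> {..<k}" using lt by auto
    show "(\<lambda>(i, j). i * k + j) ` ({..<k} \<times> {..<k}) \<subseteq> {..<k * k}"
      by (auto intro: pair_index_less)
  qed auto
  have "bij_betw ((`) ?f \<circ> set_decode) {..<2 ^ (k * k)} (Pow ({..<k} \<times> {..<k}))"
    by (rule bij_betw_trans[OF set_decode_bij bij_betw_Pow[OF f]])
  moreover have "((`) ?f \<circ> set_decode) h = pset k h" if "h \<in> {..<2 ^ (k * k)}" for h
  proof -
    have sub: "set_decode h \<subseteq> {..<k * k}"
      using set_decode_bij that by (auto simp: bij_betw_def)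
    have "?f ` set_decode h = pset k h"
    proof (rule set_eqI, rule iffI)
      fix z assume "z \<in> ?f ` set_decode h"
      then obtain q where q: "q \<in> set_decode h" "z = ?f q" by blast
      then have "q < k * k" using sub by auto
      with q lt[of q] show "z \<in> pset k h" by (auto simp: pset_def bitn_def set_decode_def)
    next
      fix z assume "z \<in> pset k h"
      then obtain i j where z: "z = (i, j)" "j < k" "odd (h div 2 ^ (i * k + j))"
        by (auto simp: pset_def bitn_def)
      then show "z \<in> ?f ` set_decode h"
        by (intro image_eqI[of _ _ "i * k + j"]) (auto simp: set_decode_def)
    qed
    then show ?thesis by simp
  qed
  ultimately show ?thesis using bij_betw_cong[of "{..<2 ^ (k * k)}"] by blast
qed

lemma card_pset: "card (pset k h) = (\<Sum>i<k. \<Sum>j<k. of_bool (bitn k h i j))"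
proof -
  have "pset k h = (SIGMA i:{..<k}. {..<k} \<inter> Collect (bitn k h i))"
    by (auto simp: pset_def)
  then show ?thesis by simp
qed


section \<open>Even and odd subgraphs as cliques\<close>

lemma card_induced_edges:
  assumes "simple_graph V E" "U \<subseteq> V"
  shows "card (induced_edges E U) = card {(u, v :: nat). u \<in> U \<and> v \<in> U \<and> u < v \<and> {u, v} \<in> E}"
proof (rule sym, rule bij_betw_same_card[of "\<lambda>(u, v). {u, v}"], unfold bij_betw_def, intro conjI)
  let ?P = "{(u, v :: nat). u \<in> U \<and> v \<in> U \<and> u < v \<and> {u, v} \<in> E}"
  show "inj_on (\<lambda>(u, v). {u, v}) ?P"
    by (rule inj_onI) (auto simp: doubleton_eq_iff)
  show "(\<lambda>(u, v). {u, v}) ` ?P = induced_edges E U"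
  proof
    show "induced_edges E U \<subseteq> (\<lambda>(u, v). {u, v}) ` ?P"
    proof
      fix e assume e: "e \<in> induced_edges E U"
      then have "card e = 2" using assms by (auto simp: induced_edges_def simple_graph_def)
      then obtain u v where uv: "e = {u, v}" "u \<noteq> v" by (auto simp: card_2_iff)
      show "e \<in> (\<lambda>(u, v). {u, v}) ` ?P"
      proof (cases "u < v")
        case True
        then show ?thesis using e uv by (intro image_eqI[of _ _ "(u, v)"]) (auto simp: induced_edges_def)
      next
        case False
        then show ?thesis using e uv
          by (intro image_eqI[of _ _ "(v, u)"]) (auto simp: induced_edges_def insert_commute)
      qed
    qed
  qed (auto simp: induced_edges_def)
qed

text \<open>
  A mask proposes the edges that \<open>k\<close> increasingly ordered vertices induce; it is good if the
  number of these edges has the wanted parity. Digits for pairs that are not increasing have to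
  vanish: otherwise a pattern would belong to several masks and its vertex sets would be counted
  repeatedly.
\<close>

definition good_mask :: "bool \<Rightarrow> nat \<Rightarrow> nat \<Rightarrow> bool" where
  "good_mask par k h \<longleftrightarrow> (\<forall>i<k. \<forall>j<k. bitn k h i j \<longrightarrow> i < j) \<and>
     (odd (\<Sum>i<k. \<Sum>j<k. of_bool (bitn k h i j) :: nat) \<longleftrightarrow> par)"

text \<open>
  A number \<open>a\<close> stands for the triple of the position \<open>a mod k\<close>, the vertex \<open>a div k mod n\<close> and
  the mask \<open>a div k div n\<close>.
\<close>

definition mask_arc :: "(nat \<Rightarrow> nat \<Rightarrow> bool) \<Rightarrow> nat \<Rightarrow> nat \<Rightarrow> nat \<Rightarrow> nat \<Rightarrow> bool" where
  "mask_arc A k n a b \<longleftrightarrow> a mod k < b mod k \<and> a div k mod n < b div k mod n \<and>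
     (A (a div k mod n) (b div k mod n) \<longleftrightarrow> bitn k (a div k div n) (a mod k) (b mod k))"

definition mask_adj :: "bool \<Rightarrow> (nat \<Rightarrow> nat \<Rightarrow> bool) \<Rightarrow> nat \<Rightarrow> nat \<Rightarrow> nat \<Rightarrow> nat \<Rightarrow> bool" where
  "mask_adj par A k n a b \<longleftrightarrow> a div k div n = b div k div n \<and> good_mask par k (a div k div n) \<and>
     (mask_arc A k n a b \<or> mask_arc A k n b a)"

definition edge_set :: "nat \<Rightarrow> (nat \<Rightarrow> nat \<Rightarrow> bool) \<Rightarrow> nat set set" where
  "edge_set n A = {{i, j} | i j. i < n \<and> j < n \<and> A i j}"

lemma edge_set_iff:
  assumes "\<And>i j. A i j \<Longrightarrow> A j i"
  shows "{i, j} \<in> edge_set n A \<longleftrightarrow> i < n \<and> j < n \<and> A i j"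
  using assms by (auto simp: edge_set_def doubleton_eq_iff)

lemma simple_graph_edge_set:
  assumes "\<And>i. \<not> A i i"
  shows "simple_graph {..<n} (edge_set n A)"
proof -
  have "card {i, j} = 2" if "A i j" for i j using assms that by (cases "i = j") auto
  then show ?thesis by (auto simp: simple_graph_def edge_set_def)
qed

lemma mask_adj_sym: "mask_adj par A k n a b \<Longrightarrow> mask_adj par A k n b a"
  unfolding mask_adj_def by metis

lemma mask_adj_irrefl: "\<not> mask_adj par A k n a a"
  unfolding mask_adj_def mask_arc_def by auto

text \<open>
  All elements of a clique have the same mask. By the order conditions they form an increasing
  transversal, so they are a \<open>k\<close>-subset of the graph with its elements numbered in increasing
  order, and the mask is forced to be the pattern of edges of this subset. Conversely a subset
  whose number of edges has the right parity gives a clique with its own pattern as mask. With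
  fewer than two elements a clique would not be forced to have a good mask, hence \<open>2 \<le> k\<close>.
\<close>

lemma count_mask_cliques:
  assumes "simple_graph {..<n} E" "2 \<le> k"
    and A: "\<And>i j. i < n \<Longrightarrow> j < n \<Longrightarrow> A i j \<longleftrightarrow> {i, j} \<in> E"
  shows "count_cliques {..<k * n * 2 ^ (k * k)} (edge_set (k * n * 2 ^ (k * k)) (mask_adj par A k n)) k =
     card {U. U \<subseteq> {..<n} \<and> card U = k \<and> (odd (card (induced_edges E U)) \<longleftrightarrow> par)}"
proof -
  define N where "N = k * n * 2 ^ (k * k)"
  define col where "col a = a mod k" for a
  define ver where "ver a = a div k mod n" for a
  define msk where "msk a = a div k div n" for a
  define code where "code i v h = i + k * (v + n * h)" for i v h
  have code: "col (code i v h) = i" "ver (code i v h) = v" "msk (code i v h) = h"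
    if "i < k" "v < n" for i v h
    using that by (auto simp: col_def ver_def msk_def code_def)
  have decode: "code (col a) (ver a) (msk a) = a" for a
    by (simp add: col_def ver_def msk_def code_def)
  define Us where "Us = {U. U \<subseteq> {..<n} \<and> card U = k \<and> (odd (card (induced_edges E U)) \<longleftrightarrow> par)}"
  define Cs where "Cs = {C. C \<subseteq> {..<N} \<and> card C = k \<and>
     (\<forall>a\<in>C. \<forall>b\<in>C. a \<noteq> b \<longrightarrow> mask_adj par A k n a b)}"
  have Cs: "{C. C \<subseteq> {..<N} \<and> card C = k \<and>
     (\<forall>a\<in>C. \<forall>b\<in>C. a \<noteq> b \<longrightarrow> {a, b} \<in> edge_set N (mask_adj par A k n))} = Cs"
  proof -
    have "{a, b} \<in> edge_set N (mask_adj par A k n) \<longleftrightarrow> a < N \<and> b < N \<and> mask_adj par A k n a b" for a b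
      by (rule edge_set_iff) (rule mask_adj_sym)
    then show ?thesis unfolding Cs_def by (intro Collect_cong) (meson lessThan_iff subset_iff)
  qed
  \<comment> \<open>The true pattern of edges of a set of vertices, and the only mask that represents it.\<close>
  define pat where "pat U = {(rank U u, rank U v) | u v. u \<in> U \<and> v \<in> U \<and> u < v \<and> {u, v} \<in> E}" for U
  have fin: "finite U" if "U \<subseteq> {..<n}" for U :: "nat set" using that finite_subset by blast
  have card_pat: "card (pat U) = card (induced_edges E U)" if "U \<subseteq> {..<n}" for U
  proof -
    let ?P = "{(u, v :: nat). u \<in> U \<and> v \<in> U \<and> u < v \<and> {u, v} \<in> E}"
    have "pat U = (\<lambda>(u, v). (rank U u, rank U v)) ` ?P" by (auto simp: pat_def)
    moreover have "inj_on (\<lambda>(u, v). (rank U u, rank U v)) ?P"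
      using inj_on_rank[OF fin[OF that]] by (auto simp: inj_on_def)
    ultimately show ?thesis
      using card_induced_edges[OF assms(1) that] by (simp add: card_image)
  qed
  have pat_sub: "pat U \<subseteq> {..<k} \<times> {..<k}" if "U \<subseteq> {..<n}" "card U = k" for U
    using that rank_less_card[OF fin[OF that(1)]] by (auto simp: pat_def)
  have good_iff: "good_mask par k h \<longleftrightarrow> (\<forall>(i, j)\<in>pset k h. i < j) \<and> (odd (card (pset k h)) \<longleftrightarrow> par)" for h
    unfolding good_mask_def card_pset by (auto simp: pset_def)
  define hU where "hU U = (THE h. h < 2 ^ (k * k) \<and> pset k h = pat U)" for U
  have hU: "hU U < 2 ^ (k * k) \<and> pset k (hU U) = pat U" and
    hU_eq: "h < 2 ^ (k * k) \<Longrightarrow> pset k h = pat U \<Longrightarrow> hU U = h"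
    if "U \<subseteq> {..<n}" "card U = k" for U h
  proof -
    have "pat U \<in> pset k ` {..<2 ^ (k * k)}"
      using pset_bij[of k] pat_sub[OF that] by (auto simp: bij_betw_def)
    then obtain h' where h': "h' < 2 ^ (k * k)" "pset k h' = pat U" by auto
    have uniq: "h = h'" if "h < 2 ^ (k * k)" "pset k h = pat U" for h
      by (rule inj_onD[OF bij_betw_imp_inj_on[OF pset_bij[of k]]]) (use that h' in auto)
    have "hU U = h'" unfolding hU_def by (rule the_equality) (use h' uniq in blast)+
    then show "hU U < 2 ^ (k * k) \<and> pset k (hU U) = pat U" using h' by blast
    show "hU U = h" if "h < 2 ^ (k * k)" "pset k h = pat U"
      using uniq[OF that] \<open>hU U = h'\<close> by simp
  qed
  have bit_iff: "bitn k h (rank U u) (rank U v) \<longleftrightarrow> {u, v} \<in> E"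
    if U: "U \<subseteq> {..<n}" "card U = k" and "pset k h = pat U" "u \<in> U" "v \<in> U" "u < v" for U h u v
  proof -
    have r: "rank U u < k" "rank U v < k" using rank_less_card[OF fin[OF U(1)]] that by auto
    have "(rank U u, rank U v) \<in> pat U \<longleftrightarrow> {u, v} \<in> E"
    proof
      assume "(rank U u, rank U v) \<in> pat U"
      then obtain u' v' where "u' \<in> U" "v' \<in> U" "{u', v'} \<in> E" "rank U u = rank U u'" "rank U v = rank U v'"
        by (auto simp: pat_def)
      moreover from this have "u' = u" "v' = v"
        using inj_onD[OF inj_on_rank[OF fin[OF U(1)]]] that(4,5) by metis+
      ultimately show "{u, v} \<in> E" by simp
    qed (use that in \<open>auto simp: pat_def\<close>)
    then show ?thesis using r that(3) by (auto simp: pset_def)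
  qed
  have "bij_betw (\<lambda>C. ver ` C) Cs Us"
  proof (rule bij_betw_byWitness[where f' = "\<lambda>U. (\<lambda>v. code (rank U v) v (hU U)) ` U"])
    have C: "ver ` C \<in> Us \<and> (\<lambda>v. code (rank (ver ` C) v) v (hU (ver ` C))) ` ver ` C = C"
      if C: "C \<in> Cs" for C
    proof -
      let ?U = "ver ` C"
      have CN: "C \<subseteq> {..<N}" and cardC: "card C = k" and
        cl: "\<And>a b. a \<in> C \<Longrightarrow> b \<in> C \<Longrightarrow> a \<noteq> b \<Longrightarrow> mask_adj par A k n a b"
        using C by (auto simp: Cs_def)
      have finC: "finite C" using CN finite_subset by blast
      have "n > 0" using CN cardC assms(2) by (cases "n = 0") (auto simp: N_def)
      then have bnd: "col a < k" "ver a < n" for a using assms(2) by (auto simp: col_def ver_def)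
      have chain: "(col a < col b \<and> ver a < ver b) \<or> (col b < col a \<and> ver b < ver a)"
        if "a \<in> C" "b \<in> C" "a \<noteq> b" for a b
        using cl[OF that] by (auto simp: mask_adj_def mask_arc_def col_def ver_def)
      have "\<forall>a\<in>C. \<forall>b\<in>C. a \<noteq> b \<longrightarrow>
          (col a < col b \<and> ver a < ver b) \<or> (col b < col a \<and> ver b < ver a)"
        "col ` C \<subseteq> {..<k}" using chain bnd by auto
      note tr = transversal_rank[OF finC this(2) cardC this(1)]
      have U: "?U \<subseteq> {..<n}" "card ?U = k" using bnd tr(1) cardC by (auto simp: card_image)
      obtain a0 where a0: "a0 \<in> C" using cardC assms(2) by fastforce
      have msk: "msk a = msk a0" if "a \<in> C" for a
        using cl[OF that a0] by (cases "a = a0") (auto simp: mask_adj_def msk_def)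
      have "\<exists>b\<in>C. b \<noteq> a0"
      proof (rule ccontr)
        assume "\<not> ?thesis"
        then have "C \<subseteq> {a0}" by auto
        then have "card C \<le> 1" using card_mono[of "{a0}" C] by simp
        with cardC assms(2) show False by simp
      qed
      then have good: "good_mask par k (msk a0)"
        using cl[OF a0] by (auto simp: mask_adj_def msk_def)
      have bit: "bitn k (msk a0) (col a) (col b) \<longleftrightarrow> {ver a, ver b} \<in> E"
        if "a \<in> C" "b \<in> C" "col a < col b" for a b
        using cl[of a b] that msk[OF that(1)] msk[OF that(2)] A[OF bnd(2)[of a] bnd(2)[of b]]
        by (auto simp: mask_adj_def mask_arc_def col_def ver_def msk_def)
      have less: "ver a < ver b \<longleftrightarrow> col a < col b" if "a \<in> C" "b \<in> C" for a b
        using chain[OF that] by (cases "a = b") auto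
      have pe: "pset k (msk a0) = pat ?U"
      proof (rule set_eqI, clarify)
        fix i j
        show "(i, j) \<in> pset k (msk a0) \<longleftrightarrow> (i, j) \<in> pat ?U"
        proof
          assume ij: "(i, j) \<in> pset k (msk a0)"
          then have "i < k" "j < k" "i < j" "bitn k (msk a0) i j"
            using good by (auto simp: pset_def good_mask_def)
          moreover obtain a b where "a \<in> C" "b \<in> C" "i = col a" "j = col b"
            using \<open>i < k\<close> \<open>j < k\<close> tr(3) by (metis imageE lessThan_iff)
          ultimately show "(i, j) \<in> pat ?U"
            using bit[of a b] less[of a b] tr(4) unfolding pat_def by force
        next
          assume "(i, j) \<in> pat ?U"
          then obtain a b where "a \<in> C" "b \<in> C" "i = col a" "j = col b" "ver a < ver b"
              "{ver a, ver b} \<in> E"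
            using tr(4) by (auto simp: pat_def)
          then show "(i, j) \<in> pset k (msk a0)"
            using bit[of a b] less[of a b] bnd(1) by (auto simp: pset_def)
        qed
      qed
      have "a0 < k * n * 2 ^ (k * k)" using a0 CN by (auto simp: N_def)
      then have "msk a0 < 2 ^ (k * k)"
        by (simp add: msk_def div_mult2_eq[symmetric] less_mult_imp_div_less mult.commute)
      then have h: "hU ?U = msk a0" using hU_eq[OF U _ pe] by simp
      have "odd (card (induced_edges E ?U)) \<longleftrightarrow> par"
        using good card_pat[OF U(1)] pe by (simp add: good_iff)
      then have "?U \<in> Us" using U by (simp add: Us_def)
      moreover have "code (rank ?U (ver a)) (ver a) (hU ?U) = a" if "a \<in> C" for a
        unfolding h tr(4)[OF that] using decode[of a] msk[OF that] by simp
      then have "(\<lambda>v. code (rank ?U v) v (hU ?U)) ` ?U = C" by (force simp: image_image)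
      ultimately show ?thesis by simp
    qed
    then show "\<forall>C\<in>Cs. (\<lambda>v. code (rank (ver ` C) v) v (hU (ver ` C))) ` ver ` C = C"
      "(`) ver ` Cs \<subseteq> Us" by auto
    have U: "ver ` (\<lambda>v. code (rank U v) v (hU U)) ` U = U \<and> (\<lambda>v. code (rank U v) v (hU U)) ` U \<in> Cs"
      if "U \<in> Us" for U
    proof -
      have U: "U \<subseteq> {..<n}" "card U = k" and par: "odd (card (induced_edges E U)) \<longleftrightarrow> par"
        using that by (auto simp: Us_def)
      note h = hU[OF U]
      let ?C = "(\<lambda>v. code (rank U v) v (hU U)) ` U"
      have r: "rank U v < k" if "v \<in> U" for v using rank_less_card[OF fin[OF U(1)] that] U by simp
      have cd: "col (code (rank U v) v (hU U)) = rank U v" "ver (code (rank U v) v (hU U)) = v"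
        "msk (code (rank U v) v (hU U)) = hU U" if "v \<in> U" for v
        using code[OF r[OF that]] that U by auto
      have verC: "ver ` ?C = U" using cd(2) by (force simp: image_image)
      have "inj_on (\<lambda>v. code (rank U v) v (hU U)) U" by (rule inj_on_inverseI[of _ ver]) (rule cd(2))
      then have cardC: "card ?C = k" using U by (simp add: card_image)
      have "code (rank U v) v (hU U) < N" if "v \<in> U" for v
      proof -
        have "v < n" using that U by auto
        have "v + n * hU U < n * 2 ^ (k * k)"
        proof -
          have "n * Suc (hU U) \<le> n * 2 ^ (k * k)" using h by (intro mult_le_mono2) auto
          then show ?thesis using \<open>v < n\<close> by simp
        qed
        then have "k * Suc (v + n * hU U) \<le> k * (n * 2 ^ (k * k))" by (intro mult_le_mono2) auto
        then show ?thesis using r[OF that] by (simp add: code_def N_def mult.assoc)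
      qed
      then have CN: "?C \<subseteq> {..<N}" by auto
      have "\<forall>(i, j)\<in>pset k (hU U). i < j"
        using h rank_less[OF fin[OF U(1)]] by (auto simp: pat_def)
      then have good: "good_mask par k (hU U)"
        using h card_pat[OF U(1)] par by (simp add: good_iff)
      have arc: "mask_arc A k n (code (rank U u) u (hU U)) (code (rank U v) v (hU U))"
        if "u \<in> U" "v \<in> U" "u < v" for u v
        using cd[OF that(1)] cd[OF that(2)] that rank_less[OF fin[OF U(1)] that(1,3)]
          bit_iff[OF U conjunct2[OF h] that] A[of u v] U
        unfolding mask_arc_def col_def[symmetric] ver_def[symmetric] msk_def[symmetric] by auto
      have "mask_adj par A k n (code (rank U u) u (hU U)) (code (rank U v) v (hU U))"
        if "u \<in> U" "v \<in> U" "u \<noteq> v" for u v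
        using arc[OF that(1,2)] arc[OF that(2,1)] that cd(3)[OF that(1)] cd(3)[OF that(2)] good
        unfolding mask_adj_def msk_def[symmetric] by (cases u v rule: linorder_cases) auto
      then show ?thesis using verC CN cardC by (auto simp: Cs_def)
    qed
    then show "\<forall>U\<in>Us. ver ` (\<lambda>v. code (rank U v) v (hU U)) ` U = U"
      "(\<lambda>U. (\<lambda>v. code (rank U v) v (hU U)) ` U) ` Us \<subseteq> Cs" by auto
  qed
  then have "card Cs = card Us" by (rule bij_betw_same_card)
  then show ?thesis unfolding count_cliques_def N_def[symmetric] Us_def[symmetric] Cs .
qed


section \<open>Cliques from parities\<close>

text \<open>
  The vertices are \<open>k\<close> copies of those of the graph; \<open>a\<close> is the vertex \<open>a mod n\<close> in copy
  \<open>a div n\<close>. Edges between two copies respect the order of copies and vertices and are present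
  only for pairs of copies selected by \<open>S\<close>.
\<close>

definition sel_arc :: "(nat \<Rightarrow> nat \<Rightarrow> bool) \<Rightarrow> nat \<Rightarrow> (nat \<Rightarrow> nat \<Rightarrow> bool) \<Rightarrow> nat \<Rightarrow> nat \<Rightarrow> bool" where
  "sel_arc A n S a b \<longleftrightarrow> a div n < b div n \<and> a mod n < b mod n \<and> A (a mod n) (b mod n) \<and>
     S (a div n) (b div n)"

definition sel_adj :: "(nat \<Rightarrow> nat \<Rightarrow> bool) \<Rightarrow> nat \<Rightarrow> (nat \<Rightarrow> nat \<Rightarrow> bool) \<Rightarrow> nat \<Rightarrow> nat \<Rightarrow> bool" where
  "sel_adj A n S a b \<longleftrightarrow> sel_arc A n S a b \<or> sel_arc A n S b a"

lemma sel_adj_sym: "sel_adj A n S a b \<Longrightarrow> sel_adj A n S b a"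
  unfolding sel_adj_def by blast

lemma sel_adj_irrefl: "\<not> sel_adj A n S a a"
  unfolding sel_adj_def sel_arc_def by auto

definition class_arcs :: "(nat \<Rightarrow> nat \<Rightarrow> bool) \<Rightarrow> nat \<Rightarrow> nat set \<Rightarrow> nat \<times> nat \<Rightarrow> (nat \<times> nat) set" where
  "class_arcs A n U s = {(a, b). a \<in> U \<and> b \<in> U \<and> sel_arc A n (\<lambda>i j. (i, j) = s) a b}"

text \<open>
  Arcs lead from smaller to larger numbers, so each edge is one arc, and it belongs to the class
  of exactly one pair of copies.
\<close>

lemma card_selected_edges:
  assumes "U \<subseteq> {..<k * n}" "finite S" "\<And>i j. i < k \<Longrightarrow> j < k \<Longrightarrow> R i j \<longleftrightarrow> (i, j) \<in> S"
  shows "card (induced_edges (edge_set (k * n) (sel_adj A n R)) U) = (\<Sum>s\<in>S. card (class_arcs A n U s))"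
proof -
  let ?E = "edge_set (k * n) (sel_adj A n R)"
  have E: "{a, b} \<in> ?E \<longleftrightarrow> a < k * n \<and> b < k * n \<and> sel_adj A n R a b" for a b
    by (rule edge_set_iff) (rule sel_adj_sym)
  have "simple_graph {..<k * n} ?E" by (rule simple_graph_edge_set) (rule sel_adj_irrefl)
  note card_induced_edges[OF this assms(1)]
  also have "{(a, b). a \<in> U \<and> b \<in> U \<and> a < b \<and> {a, b} \<in> ?E} = (\<Union>s\<in>S. class_arcs A n U s)"
  proof (rule set_eqI, clarify)
    fix a b
    have arc_less: "sel_arc A n R' a b \<Longrightarrow> a < b" for R' a b
      by (rule ccontr) (auto simp: sel_arc_def not_less dest: div_le_mono[of b a n])
    have cls: "a div n < k" if "a \<in> U" for a
      using that assms(1) by (auto intro: less_mult_imp_div_less)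
    have "(a, b) \<in> {(a, b). a \<in> U \<and> b \<in> U \<and> a < b \<and> {a, b} \<in> ?E} \<longleftrightarrow>
        a \<in> U \<and> b \<in> U \<and> sel_arc A n R a b"
      using arc_less[of R a b] arc_less[of R b a] assms(1) by (auto simp: E sel_adj_def)
    also have "\<dots> \<longleftrightarrow> (a, b) \<in> (\<Union>s\<in>S. class_arcs A n U s)"
      using cls assms(3)[of "a div n" "b div n"] by (auto simp: class_arcs_def sel_arc_def)
    finally show "(a, b) \<in> {(a, b). a \<in> U \<and> b \<in> U \<and> a < b \<and> {a, b} \<in> ?E} \<longleftrightarrow>
        (a, b) \<in> (\<Union>s\<in>S. class_arcs A n U s)" .
  qed
  also have "card (\<Union>s\<in>S. class_arcs A n U s) = (\<Sum>s\<in>S. card (class_arcs A n U s))"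
  proof (rule card_UN_disjoint[OF assms(2)])
    have "finite U" using assms(1) finite_subset by blast
    then show "\<forall>s\<in>S. finite (class_arcs A n U s)"
      by (auto simp: class_arcs_def intro: finite_subset[of _ "U \<times> U"])
  qed (auto simp: class_arcs_def sel_arc_def)
  finally show ?thesis .
qed

definition sgn_mask :: "(nat \<times> nat) set \<Rightarrow> int" where
  "sgn_mask S = (\<Prod>s\<in>S. if fst s < snd s then - 1 else 1)"

text \<open>
  Expanding the product of \<open>1 - (- 1) ^ e s\<close> over the increasing pairs and \<open>1 + (- 1) ^ e s\<close>
  over the others gives the sum. A factor of the first kind vanishes if \<open>e s\<close> is even, and all
  remaining factors are 2.
\<close>

lemma signed_parity_sum:
  assumes "\<And>s. s \<in> {..<k} \<times> {..<k} \<Longrightarrow> \<not> fst s < snd s \<Longrightarrow> even (e s :: nat)"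
  shows "(\<Sum>S\<in>Pow ({..<k} \<times> {..<k}). sgn_mask S * (- 1) ^ (\<Sum>s\<in>S. e s)) =
    (if \<forall>i<k. \<forall>j<k. i < j \<longrightarrow> odd (e (i, j)) then 2 ^ (k * k) else 0)"
proof -
  let ?K = "{..<k} \<times> {..<k}"
  let ?f = "\<lambda>s. (if fst s < snd s then - 1 else 1) * (- 1) ^ e s :: int"
  have "(\<Sum>S\<in>Pow ?K. sgn_mask S * (- 1) ^ (\<Sum>s\<in>S. e s)) =
      (\<Sum>S\<in>Pow ?K. (\<Prod>s\<in>S. ?f s) * (\<Prod>s\<in>?K - S. 1))"
    by (simp add: sgn_mask_def prod.distrib power_sum)
  also have "\<dots> = (\<Prod>s\<in>?K. ?f s + 1)" by (rule prod_add[symmetric]) simp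
  also have "\<dots> = (if \<forall>i<k. \<forall>j<k. i < j \<longrightarrow> odd (e (i, j)) then 2 ^ (k * k) else 0)"
  proof (cases "\<forall>i<k. \<forall>j<k. i < j \<longrightarrow> odd (e (i, j))")
    case True
    then have "?f s + 1 = 2" if "s \<in> ?K" for s using that assms[OF that] by (cases s) auto
    then have "(\<Prod>s\<in>?K. ?f s + 1) = (\<Prod>s\<in>?K. 2)" by (intro prod.cong) auto
    also have "\<dots> = 2 ^ (k * k)" by (simp add: card_cartesian_product)
    finally show ?thesis using True by simp
  next
    case False
    then obtain i j where ij: "i < k" "j < k" "i < j" "even (e (i, j))" by blast
    then have "?f (i, j) + 1 = 0" by simp
    moreover have "(i, j) \<in> ?K" using ij by simp
    ultimately have "(\<Prod>s\<in>?K. ?f s + 1) = 0"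
      by (intro prod_zero bexI[of _ "(i, j)"] finite_cartesian_product finite_lessThan)
    then show ?thesis using False by auto
  qed
  finally show ?thesis .
qed

text \<open>
  An odd number is not zero. So the condition makes \<open>U\<close> meet every copy, hence exactly once,
  because \<open>U\<close> has only \<open>k\<close> elements; the single pair of elements in two copies must then be an
  arc. Being increasing, \<open>U\<close> is determined by the clique that it projects to.
\<close>

lemma count_colourful_cliques:
  assumes "simple_graph {..<n} E" "2 \<le> k"
    and A: "\<And>i j. i < n \<Longrightarrow> j < n \<Longrightarrow> A i j \<longleftrightarrow> {i, j} \<in> E"
  shows "card {U. U \<subseteq> {..<k * n} \<and> card U = k \<and>
      (\<forall>i<k. \<forall>j<k. i < j \<longrightarrow> odd (card (class_arcs A n U (i, j))))} = count_cliques {..<n} E k"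
proof -
  define Us where "Us = {U. U \<subseteq> {..<k * n} \<and> card U = k \<and>
      (\<forall>i<k. \<forall>j<k. i < j \<longrightarrow> odd (card (class_arcs A n U (i, j))))}"
  define Cs where "Cs = {W. W \<subseteq> {..<n} \<and> card W = k \<and> (\<forall>u\<in>W. \<forall>v\<in>W. u \<noteq> v \<longrightarrow> {u, v} \<in> E)}"
  define col where "col a = a div n" for a
  define ver where "ver a = a mod n" for a
  have "bij_betw (\<lambda>U. ver ` U) Us Cs"
  proof (rule bij_betw_byWitness[where f' = "\<lambda>W. (\<lambda>v. rank W v * n + v) ` W"])
    have U: "ver ` U \<in> Cs \<and> (\<lambda>v. rank (ver ` U) v * n + v) ` ver ` U = U" if "U \<in> Us" for U
    proof -
      have UN: "U \<subseteq> {..<k * n}" and cardU: "card U = k"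
        and od: "\<And>i j. i < k \<Longrightarrow> j < k \<Longrightarrow> i < j \<Longrightarrow> odd (card (class_arcs A n U (i, j)))"
        using that by (auto simp: Us_def)
      have finU: "finite U" using UN finite_subset by blast
      have "n > 0" using UN cardU assms(2) by (cases "n = 0") auto
      then have ver: "ver a < n" for a by (simp add: ver_def)
      have col: "col a < k" if "a \<in> U" for a
        using that UN by (auto simp: col_def intro: less_mult_imp_div_less)
      have arc: "\<exists>a\<in>U. \<exists>b\<in>U. col a = i \<and> col b = j \<and> ver a < ver b \<and> {ver a, ver b} \<in> E"
        if ij: "i < k" "j < k" "i < j" for i j
      proof -
        have "class_arcs A n U (i, j) \<noteq> {}" using od[OF ij] by (auto simp del: card_eq_0_iff)
        then obtain a b where "a \<in> U" "b \<in> U" "sel_arc A n (\<lambda>i' j'. (i', j') = (i, j)) a b"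
          by (auto simp: class_arcs_def)
        then show ?thesis using A[OF ver[of a] ver[of b]] unfolding sel_arc_def col_def ver_def by blast
      qed
      have colim: "col ` U = {..<k}"
      proof
        show "{..<k} \<subseteq> col ` U"
        proof
          fix i assume "i \<in> {..<k}"
          then have i: "i < k" by simp
          show "i \<in> col ` U"
          proof (cases "i = 0")
            case True
            then show ?thesis using arc[of 0 1] assms(2) by force
          next
            case False
            then show ?thesis using arc[of 0 i] i by force
          qed
        qed
      qed (use col in auto)
      then have injc: "inj_on col U" using finU cardU by (intro eq_card_imp_inj_on) auto
      have edge: "ver a < ver b \<and> {ver a, ver b} \<in> E" if ab: "a \<in> U" "b \<in> U" "col a < col b" for a b
      proof -
        obtain a' b' where "a' \<in> U" "b' \<in> U" "col a' = col a" "col b' = col b"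
          "ver a' < ver b'" "{ver a', ver b'} \<in> E"
          using arc[OF col[OF ab(1)] col[OF ab(2)] ab(3)] by blast
        moreover from this have "a' = a" "b' = b" using injc ab by (meson inj_onD)+
        ultimately show ?thesis by simp
      qed
      have neq: "col a \<noteq> col b" if "a \<in> U" "b \<in> U" "a \<noteq> b" for a b
        using injc that by (meson inj_onD)
      have "\<forall>a\<in>U. \<forall>b\<in>U. a \<noteq> b \<longrightarrow> (col a < col b \<and> ver a < ver b) \<or> (col b < col a \<and> ver b < ver a)"
        using edge neq by (meson linorder_neqE_nat)
      note tr = transversal_rank[OF finU _ cardU this]
      have "col ` U \<subseteq> {..<k}" using colim by simp
      note tr = tr[OF this]
      have "{ver a, ver b} \<in> E" if "a \<in> U" "b \<in> U" "ver a \<noteq> ver b" for a b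
      proof -
        have "a \<noteq> b" using that by auto
        with neq that consider "col a < col b" | "col b < col a" by (meson linorder_neqE_nat)
        then show ?thesis
          using edge[OF that(1,2)] edge[OF that(2,1)] by cases (auto simp: insert_commute)
      qed
      then have "ver ` U \<in> Cs" using ver tr(1) cardU by (auto simp: Cs_def card_image)
      moreover have "rank (ver ` U) (ver a) * n + ver a = a" if "a \<in> U" for a
        unfolding tr(4)[OF that] by (simp add: col_def ver_def)
      then have "(\<lambda>v. rank (ver ` U) v * n + v) ` ver ` U = U" by (force simp: image_image)
      ultimately show ?thesis by simp
    qed
    then show "\<forall>U\<in>Us. (\<lambda>v. rank (ver ` U) v * n + v) ` ver ` U = U" "(`) ver ` Us \<subseteq> Cs" by auto
    have W: "ver ` (\<lambda>v. rank W v * n + v) ` W = W \<and> (\<lambda>v. rank W v * n + v) ` W \<in> Us"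
      if "W \<in> Cs" for W
    proof -
      have WN: "W \<subseteq> {..<n}" and cardW: "card W = k"
        and cl: "\<And>u v. u \<in> W \<Longrightarrow> v \<in> W \<Longrightarrow> u \<noteq> v \<Longrightarrow> {u, v} \<in> E"
        using that by (auto simp: Cs_def)
      have finW: "finite W" using WN finite_subset by blast
      let ?U = "(\<lambda>v. rank W v * n + v) ` W"
      have cd: "col (rank W v * n + v) = rank W v" "ver (rank W v * n + v) = v" if "v \<in> W" for v
        using that WN by (auto simp: col_def ver_def)
      have verU: "ver ` ?U = W" using cd(2) by (force simp: image_image)
      have "inj_on (\<lambda>v. rank W v * n + v) W" by (rule inj_on_inverseI[of _ ver]) (rule cd(2))
      then have cardU: "card ?U = k" using cardW by (simp add: card_image)
      have r: "rank W v < k" if "v \<in> W" for v using rank_less_card[OF finW that] cardW by simp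
      have UN: "?U \<subseteq> {..<k * n}" using r WN by (auto intro: pair_index_less)
      have "card (class_arcs A n ?U (i, j)) = 1" if ij: "i < k" "j < k" "i < j" for i j
      proof -
        have "i \<in> rank W ` W" "j \<in> rank W ` W" using rank_image[OF finW] cardW ij by auto
        then obtain u v where uv: "u \<in> W" "v \<in> W" "i = rank W u" "j = rank W v" by blast
        have "u < v" using rank_less_iff[OF finW uv(1,2)] ij uv by simp
        then have Auv: "A u v" using A[of u v] cl[OF uv(1,2)] uv WN by auto
        have "class_arcs A n ?U (i, j) = {(rank W u * n + u, rank W v * n + v)}"
        proof (rule set_eqI, clarify)
          fix a b
          show "(a, b) \<in> class_arcs A n ?U (i, j) \<longleftrightarrow> (a, b) \<in> {(rank W u * n + u, rank W v * n + v)}"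
          proof
            assume "(a, b) \<in> class_arcs A n ?U (i, j)"
            then obtain u' v' where "u' \<in> W" "v' \<in> W" "a = rank W u' * n + u'" "b = rank W v' * n + v'"
              "a div n = i" "b div n = j" by (auto simp: class_arcs_def sel_arc_def)
            moreover from this have "rank W u' = rank W u" "rank W v' = rank W v"
              using cd(1) uv unfolding col_def by metis+
            then have "u' = u" "v' = v"
              using inj_onD[OF inj_on_rank[OF finW]] uv \<open>u' \<in> W\<close> \<open>v' \<in> W\<close> by metis+
            ultimately show "(a, b) \<in> {(rank W u * n + u, rank W v * n + v)}" by simp
          next
            assume "(a, b) \<in> {(rank W u * n + u, rank W v * n + v)}"
            then show "(a, b) \<in> class_arcs A n ?U (i, j)"
              using uv cd[OF uv(1)] cd[OF uv(2)] \<open>u < v\<close> Auv ij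
              by (auto simp: class_arcs_def sel_arc_def col_def ver_def)
          qed
        qed
        then show ?thesis by simp
      qed
      then have "?U \<in> Us" using UN cardU by (simp add: Us_def)
      with verU show ?thesis by simp
    qed
    then show "\<forall>W\<in>Cs. ver ` (\<lambda>v. rank W v * n + v) ` W = W"
      "(\<lambda>W. (\<lambda>v. rank W v * n + v) ` W) ` Cs \<subseteq> Us" by auto
  qed
  then show ?thesis unfolding count_cliques_def Us_def[symmetric] Cs_def[symmetric]
    by (rule bij_betw_same_card)
qed


definition count_parity :: "bool \<Rightarrow> 'a set \<Rightarrow> 'a set set \<Rightarrow> nat \<Rightarrow> nat" where
  "count_parity par V E k = card {U. U \<subseteq> V \<and> card U = k \<and> (odd (card (induced_edges E U)) \<longleftrightarrow> par)}"

lemma count_parity_simps: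
  "count_parity False = count_even_subgraphs" "count_parity True = count_odd_subgraphs"
  by (simp_all add: fun_eq_iff count_parity_def count_even_subgraphs_def count_odd_subgraphs_def)

definition neg_mask :: "nat \<Rightarrow> nat \<Rightarrow> bool" where
  "neg_mask k h \<longleftrightarrow> odd (\<Sum>i<k. \<Sum>j<k. of_bool (i < j \<and> bitn k h i j) :: nat)"

lemma sgn_mask_pset: "sgn_mask (pset k h) = (if neg_mask k h then - 1 else 1)"
proof -
  have "pset k h \<inter> {s. fst s < snd s} = (SIGMA i:{..<k}. {..<k} \<inter> {j. i < j \<and> bitn k h i j})"
    by (auto simp: pset_def)
  then have "card (pset k h \<inter> {s. fst s < snd s}) =
      (\<Sum>i<k. \<Sum>j<k. of_bool (i < j \<and> bitn k h i j))" by simp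
  moreover have "finite (pset k h)"
    by (rule finite_subset[of _ "{..<k} \<times> {..<k}"]) (auto simp: pset_def)
  then have "sgn_mask (pset k h) = (- 1) ^ card (pset k h \<inter> {s. fst s < snd s})"
    by (simp add: sgn_mask_def prod.If_cases)
  ultimately show ?thesis unfolding neg_mask_def by (simp add: minus_one_power_iff)
qed

text \<open>
  Twice the number of sets of the wanted parity is the number of all \<open>k\<close>-sets plus or minus the
  sum of \<open>(- 1) ^ e(U)\<close>, where \<open>e(U)\<close> counts the selected edges within \<open>U\<close>. In the alternating
  sum over the masks the former part cancels, as there is an increasing pair, and the latter
  leaves exactly the sets with an odd number of edges between any two copies.
\<close>

lemma cliques_from_parities:
  assumes "simple_graph {..<n} E" "2 \<le> k"
    and A: "\<And>i j. i < n \<Longrightarrow> j < n \<Longrightarrow> A i j \<longleftrightarrow> {i, j} \<in> E"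
  shows "(\<Sum>h<2 ^ (k * k). (if neg_mask k h \<noteq> par then - 1 else 1) *
      int (count_parity par {..<k * n} (edge_set (k * n) (sel_adj A n (bitn k h))) k)) =
    2 ^ (k * k - 1) * int (count_cliques {..<n} E k)"
proof -
  define Ks where "Ks = {U. U \<subseteq> {..<k * n} \<and> card U = k}"
  define c where "c h = count_parity par {..<k * n} (edge_set (k * n) (sel_adj A n (bitn k h))) k" for h
  define e where "e U s = card (class_arcs A n U s)" for U s
  define \<sigma> where "\<sigma> = (if par then - 1 else 1 :: int)"
  define ac where "ac U \<longleftrightarrow> (\<forall>i<k. \<forall>j<k. i < j \<longrightarrow> odd (e U (i, j)))" for U
  let ?P = "Pow ({..<k} \<times> {..<k})"
  have finK: "finite Ks" unfolding Ks_def by (rule finite_subset[of _ "Pow {..<k * n}"]) auto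
  \<comment> \<open>Twice the indicator of the wanted parity of \<open>e\<close> is \<open>1 + \<sigma> * (- 1) ^ e\<close>.\<close>
  have two_c: "2 * int (c h) = (\<Sum>U\<in>Ks. 1 + \<sigma> * (- 1) ^ (\<Sum>s\<in>pset k h. e U s))" for h
  proof -
    have fp: "finite (pset k h)"
      by (rule finite_subset[of _ "{..<k} \<times> {..<k}"]) (auto simp: pset_def)
    have ed: "card (induced_edges (edge_set (k * n) (sel_adj A n (bitn k h))) U) =
        (\<Sum>s\<in>pset k h. e U s)" if "U \<in> Ks" for U
      unfolding e_def by (rule card_selected_edges) (use that fp in \<open>auto simp: Ks_def pset_def\<close>)
    have "{U. U \<subseteq> {..<k * n} \<and> card U = k \<and>
        (odd (card (induced_edges (edge_set (k * n) (sel_adj A n (bitn k h))) U)) \<longleftrightarrow> par)} =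
        {U \<in> Ks. odd (\<Sum>s\<in>pset k h. e U s) \<longleftrightarrow> par}"
      using ed by (auto simp: Ks_def)
    then have "c h = card (Ks \<inter> {U. odd (\<Sum>s\<in>pset k h. e U s) \<longleftrightarrow> par})"
      by (simp add: c_def count_parity_def Int_def)
    also have "\<dots> = (\<Sum>U\<in>Ks. of_bool (odd (\<Sum>s\<in>pset k h. e U s) \<longleftrightarrow> par))"
      using finK by simp
    finally have "2 * int (c h) = (\<Sum>U\<in>Ks. 2 * of_bool (odd (\<Sum>s\<in>pset k h. e U s) \<longleftrightarrow> par))"
      by (simp only: int_sum of_nat_of_bool sum_distrib_left)
    also have "\<dots> = (\<Sum>U\<in>Ks. 1 + \<sigma> * (- 1) ^ (\<Sum>s\<in>pset k h. e U s))"
      by (intro sum.cong) (auto simp: \<sigma>_def minus_one_power_iff)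
    finally show ?thesis .
  qed
  have reindex: "(\<Sum>h<2 ^ (k * k). w (pset k h)) = (\<Sum>S\<in>?P. w S)" for w :: "_ \<Rightarrow> int"
    by (rule sum.reindex_bij_betw[OF pset_bij])
  have zero: "(\<Sum>S\<in>?P. sgn_mask S) = 0"
  proof -
    have "\<not> (\<forall>i<k. \<forall>j<k. i < j \<longrightarrow> odd (0 :: nat))"
    proof
      assume "\<forall>i<k. \<forall>j<k. i < j \<longrightarrow> odd (0 :: nat)"
      from this[rule_format, of 0 1] assms(2) show False by simp
    qed
    then show ?thesis using signed_parity_sum[of k "\<lambda>_. 0"] by simp
  qed
  have signed: "(\<Sum>S\<in>?P. sgn_mask S * (- 1) ^ (\<Sum>s\<in>S. e U s)) = 2 ^ (k * k) * of_bool (ac U)" for U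
  proof -
    have "even (e U s)" if "\<not> fst s < snd s" for s
    proof -
      have "class_arcs A n U s = {}" using that by (auto simp: class_arcs_def sel_arc_def)
      then show ?thesis by (simp add: e_def)
    qed
    then show ?thesis using signed_parity_sum[of k "e U"] by (simp add: ac_def)
  qed
  have "2 * (\<Sum>h<2 ^ (k * k). sgn_mask (pset k h) * int (c h)) =
      (\<Sum>h<2 ^ (k * k). sgn_mask (pset k h) * (2 * int (c h)))"
    by (simp add: sum_distrib_left mult.left_commute)
  also have "\<dots> = (\<Sum>S\<in>?P. sgn_mask S * (\<Sum>U\<in>Ks. 1 + \<sigma> * (- 1) ^ (\<Sum>s\<in>S. e U s)))"
    unfolding two_c by (rule reindex)
  also have "\<dots> = (\<Sum>S\<in>?P. \<Sum>U\<in>Ks. sgn_mask S + \<sigma> * (sgn_mask S * (- 1) ^ (\<Sum>s\<in>S. e U s)))"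
    by (simp only: sum_distrib_left distrib_left mult_1_right mult.left_commute)
  also have "\<dots> = (\<Sum>U\<in>Ks. \<Sum>S\<in>?P. sgn_mask S + \<sigma> * (sgn_mask S * (- 1) ^ (\<Sum>s\<in>S. e U s)))"
    by (rule sum.swap)
  also have "\<dots> = (\<Sum>U\<in>Ks. \<sigma> * (2 ^ (k * k) * of_bool (ac U)))"
    by (simp only: sum.distrib zero signed sum_distrib_left[symmetric] add_0_left)
  also have "\<dots> = \<sigma> * 2 ^ (k * k) * (\<Sum>U\<in>Ks. of_bool (ac U))"
    by (simp only: sum_distrib_left mult.assoc)
  also have "(\<Sum>U\<in>Ks. of_bool (ac U)) = int (card (Ks \<inter> {U. ac U}))" using finK by simp
  also have "Ks \<inter> {U. ac U} = {U. U \<subseteq> {..<k * n} \<and> card U = k \<and>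
      (\<forall>i<k. \<forall>j<k. i < j \<longrightarrow> odd (card (class_arcs A n U (i, j))))}"
    by (auto simp: Ks_def ac_def e_def)
  also have "card \<dots> = count_cliques {..<n} E k" by (rule count_colourful_cliques[OF assms])
  also have "(2 :: int) ^ (k * k) = 2 * 2 ^ (k * k - 1)"
    using assms(2) by (simp add: power_Suc[symmetric])
  finally have "(\<Sum>h<2 ^ (k * k). sgn_mask (pset k h) * int (c h)) =
      \<sigma> * 2 ^ (k * k - 1) * int (count_cliques {..<n} E k)" by simp
  then have "\<sigma> * (\<Sum>h<2 ^ (k * k). sgn_mask (pset k h) * int (c h)) =
      2 ^ (k * k - 1) * int (count_cliques {..<n} E k)" by (simp add: \<sigma>_def)
  moreover have "\<sigma> * (\<Sum>h<2 ^ (k * k). sgn_mask (pset k h) * int (c h)) =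
      (\<Sum>h<2 ^ (k * k). (if neg_mask k h \<noteq> par then - 1 else 1) * int (c h))"
    unfolding sum_distrib_left sgn_mask_pset by (intro sum.cong) (auto simp: \<sigma>_def)
  ultimately show ?thesis by (simp add: c_def)
qed


section \<open>Composing programs\<close>

primrec regs_below :: "nat \<Rightarrow> program \<Rightarrow> bool" where
  "regs_below b Skip \<longleftrightarrow> True"
| "regs_below b (Push r a) \<longleftrightarrow> r < b"
| "regs_below b (Pop r) \<longleftrightarrow> r < b"
| "regs_below b (Query q r) \<longleftrightarrow> q < b \<and> r < b"
| "regs_below b (Seq c1 c2) \<longleftrightarrow> regs_below b c1 \<and> regs_below b c2"
| "regs_below b (Cond r a c1 c2) \<longleftrightarrow> r < b \<and> regs_below b c1 \<and> regs_below b c2"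
| "regs_below b (Until r a c) \<longleftrightarrow> r < b \<and> regs_below b c"

lemma regs_below_mono: "regs_below b c \<Longrightarrow> b \<le> b' \<Longrightarrow> regs_below b' c"
  by (induction c) auto

lemma regs_below_ex: "\<exists>b. regs_below b c"
proof (induction c)
  case (Seq c1 c2)
  then obtain b1 b2 where "regs_below b1 c1" "regs_below b2 c2" by blast
  then have "regs_below (max b1 b2) (Seq c1 c2)" by (auto intro: regs_below_mono)
  then show ?case by blast
next
  case (Cond r a c1 c2)
  then obtain b1 b2 where "regs_below b1 c1" "regs_below b2 c2" by blast
  then have "regs_below (Suc r + b1 + b2) (Cond r a c1 c2)" by (auto intro: regs_below_mono)
  then show ?case by blast
next
  case (Until r a c)
  then obtain b where "regs_below b c" by blast
  then have "regs_below (Suc r + b) (Until r a c)" by (auto intro: regs_below_mono)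
  then show ?case by blast
next
  case (Query q r)
  have "regs_below (Suc (q + r)) (Query q r)" by simp
  then show ?case by blast
qed (auto intro: lessI)

text \<open>
  A program works in the same way whatever the registers beyond its own contain.
\<close>

lemma exec_frame:
  assumes "exec f c s t qs s'" "regs_below b c" "\<And>r. r < b \<Longrightarrow> u r = s r"
  shows "exec f c u t qs (\<lambda>r. if r < b then s' r else u r)"
  using assms
proof (induction arbitrary: u rule: exec.induct)
  case (Skip s)
  then have "(\<lambda>r. if r < b then s r else u r) = u" by auto
  then show ?case using exec.Skip by metis
next
  case (Push r a s)
  then have "(\<lambda>x. if x < b then (s(r := a # s r)) x else u x) = u(r := a # u r)" by auto
  then show ?case using exec.Push by metis
next
  case (Pop r s)
  then have "(\<lambda>x. if x < b then (s(r := tl (s r))) x else u x) = u(r := tl (u r))" by auto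
  then show ?case using exec.Pop by metis
next
  case (Query q r s)
  then have "u q = s q" by simp
  moreover have "(\<lambda>x. if x < b then (s(r := binary (f (s q)))) x else u x) = u(r := binary (f (u q)))"
    using Query by auto
  ultimately show ?case using exec.Query[of f q r u] by simp
next
  case (Seq c1 s t1 qs1 s' c2 t2 qs2 s'')
  let ?u = "\<lambda>r. if r < b then s' r else u r"
  have "exec f c1 u t1 qs1 ?u" by (rule Seq.IH(1)) (use Seq.prems in auto)
  moreover have "exec f c2 ?u t2 qs2 (\<lambda>r. if r < b then s'' r else ?u r)"
    by (rule Seq.IH(2)) (use Seq.prems in auto)
  moreover have "(\<lambda>r. if r < b then s'' r else ?u r) = (\<lambda>r. if r < b then s'' r else u r)" by auto
  ultimately show ?case using exec.Seq by metis
next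
  case (CondT s r a c1 t qs s' c2)
  then have "top_symbol (u r) = a" by simp
  moreover have "exec f c1 u t qs (\<lambda>r. if r < b then s' r else u r)"
    by (rule CondT.IH) (use CondT.prems in auto)
  ultimately show ?case by (rule exec.CondT)
next
  case (CondF s r a c2 t qs s' c1)
  then have "top_symbol (u r) \<noteq> a" by simp
  moreover have "exec f c2 u t qs (\<lambda>r. if r < b then s' r else u r)"
    by (rule CondF.IH) (use CondF.prems in auto)
  ultimately show ?case by (rule exec.CondF)
next
  case (UntilT s r a c)
  then have "(\<lambda>r. if r < b then s r else u r) = u" by auto
  moreover have "top_symbol (u r) = a" using UntilT by simp
  ultimately show ?case using exec.UntilT by metis
next
  case (UntilF s r a c t1 qs1 s' t2 qs2 s'')
  let ?u = "\<lambda>r. if r < b then s' r else u r"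
  have "exec f c u t1 qs1 ?u" by (rule UntilF.IH(1)) (use UntilF.prems in auto)
  moreover have "exec f (Until r a c) ?u t2 qs2 (\<lambda>r. if r < b then s'' r else ?u r)"
    by (rule UntilF.IH(2)) (use UntilF.prems in auto)
  moreover have "(\<lambda>r. if r < b then s'' r else ?u r) = (\<lambda>r. if r < b then s'' r else u r)" by auto
  moreover have "top_symbol (u r) \<noteq> a" using UntilF by simp
  ultimately show ?case using exec.UntilF by metis
qed

primrec wipe :: "nat \<Rightarrow> program" where
  "wipe 0 = Skip"
| "wipe (Suc b) = Seq (wipe b) (clear (Suc b))"

lemma oracle_free_wipe [simp]: "oracle_free (wipe b)" by (induction b) auto

lemma does_wipe:
  assumes "\<And>r. length (s r) \<le> L"
  shows "does f Q (wipe b) s (Suc (b * Suc (2 * L))) (\<lambda>r. if 1 \<le> r \<and> r \<le> b then [] else s r)"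
proof (induction b)
  case 0
  have "(\<lambda>r. if 1 \<le> r \<and> r \<le> 0 then [] else s r) = s" by auto
  then show ?case using does_Skip[of f Q s] by simp
next
  case (Suc b)
  let ?s = "\<lambda>b r. if 1 \<le> r \<and> r \<le> b then [] else s r"
  have "does f Q (clear (Suc b)) (?s b) (Suc (2 * L)) (?s (Suc b))"
    by (rule does_clear) (use assms in auto)
  from does_Seq[OF Suc this] show ?case by (simp add: algebra_simps)
qed

text \<open>
  To be run on its own, a program has to deliver its result in register 0.
\<close>

lemma wc_program:
  fixes W :: "'g \<Rightarrow> word list"
  assumes "wc pl f Q p W V" "\<And>g. W g \<noteq> []"
  obtains c K d where "pl \<Longrightarrow> oracle_free c"
    "\<And>g. ok (W g) \<Longrightarrow> \<exists>t qs s. exec f c (st (W g)) t qs s \<and> s 0 = V g \<and> (\<forall>q\<in>set qs. Q g q) \<and>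
       t \<le> K * Suc (p g + vol (W g)) ^ d"
proof -
  obtain m b c T where c: "computes pl f Q p W V m b c T" by (rule wcE[OF assms(1)])
  note 1 = computesD[OF c]
  have m: "0 < m" using assms(2) 1(5) by (metis length_greater_0_conv)
  let ?T = "\<lambda>n. T n + (Suc (2 * n) + (Suc (6 * T n) + Suc (6 * T n)))"
  have "poly_bounded ?T" by (intro poly_bounded_intros 1(3))
  then obtain K d where K: "\<And>n. ?T n \<le> K * Suc n ^ d" unfolding poly_bounded_def by blast
  let ?c = "Seq c (Seq (clear 0) (Seq (pour m [b]) (pour b [0])))"
  have "\<exists>t qs s. exec f ?c (st (W g)) t qs s \<and> s 0 = V g \<and> (\<forall>q\<in>set qs. Q g q) \<and>
       t \<le> K * Suc (p g + vol (W g)) ^ d" if ok: "ok (W g)" for g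
  proof -
    let ?n = "p g + vol (W g)" and ?s = "st (W g)"
    have s: "?s m = []" "?s b = []" using 1(1) 1(5)[of g] by (auto simp: st_def)
    have "?s 0 \<in> set (W g)" using m 1(5)[of g] by (simp add: st_def)
    then have "length (?s 0) \<le> vol (W g)" by (intro member_le_sum_list) auto
    then have l0: "length (?s 0) \<le> ?n" by simp
    have "does f (Q g) ?c ?s (?T ?n) (?s(0 := V g))"
    proof (intro does_Seq)
      show "does f (Q g) c ?s (T ?n) (?s(m := V g))" by (rule 1(8)[OF ok]) simp
      show "does f (Q g) (clear 0) (?s(m := V g)) (Suc (2 * ?n)) (?s(m := V g, 0 := []))"
        by (rule does_clear) (use m l0 in auto)
      show "does f (Q g) (pour m [b]) (?s(m := V g, 0 := [])) (Suc (6 * T ?n)) (?s(0 := [], b := rev (V g)))"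
        by (rule does_pour1) (use m s 1(1) 1(6)[OF ok] 1(7)[OF ok] in \<open>auto simp: fun_eq_iff\<close>)
      show "does f (Q g) (pour b [0]) (?s(0 := [], b := rev (V g))) (Suc (6 * T ?n)) (?s(0 := V g))"
        by (rule does_pour1) (use m s 1(1) 1(6)[OF ok] 1(7)[OF ok] in \<open>auto simp: fun_eq_iff\<close>)
    qed
    then obtain t qs where "exec f ?c ?s t qs (?s(0 := V g))" "t \<le> ?T ?n" "\<forall>q\<in>set qs. Q g q"
      by (rule doesE)
    with K[of ?n] show ?thesis by (intro exI[of _ t] exI[of _ qs] exI[of _ "?s(0 := V g)"]) auto
  qed
  then show thesis using 1(2) by (intro that[of ?c]) auto
qed

lemma st_single: "st [x] = (\<lambda>_. [])(0 := x)"
  by (auto simp: st_def fun_eq_iff)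

text \<open>
  The first program is arbitrary and leaves unknown words in its registers. Wiping them restores
  the store in which the second program has to start; it takes time linear in the length of the
  input and the running time of the first program.
\<close>

lemma runs_compose:
  assumes c1: "runs_plain c1 x y t1" and b: "regs_below (Suc b) c1"
    and c2: "exec f c2 (st [y]) t2 qs s" "s 0 = z"
  shows "\<exists>t. runs f (Seq c1 (Seq (wipe b) c2)) x z t qs \<and>
    t \<le> t1 + Suc (b * Suc (2 * (length x + t1))) + t2"
proof -
  obtain s' where s': "exec (\<lambda>_. 0) c1 ((\<lambda>_. [])(0 := x)) t1 [] s'" "s' 0 = y" "oracle_free c1"
    using c1 by (auto simp: runs_plain_def runs_def)
  let ?s = "\<lambda>r. if 1 \<le> r \<and> r \<le> b then [] else s' r"
  have e1: "exec f c1 ((\<lambda>_. [])(0 := x)) t1 [] s'" using exec_oracle_free[OF s'(1,3)] by blast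
  from exec_deterministic[OF exec_frame[OF s'(1) b] s'(1)]
  have "s' = (\<lambda>r. if r < Suc b then s' r else ((\<lambda>_. [])(0 := x)) r)" by auto
  then have out: "s' r = []" if "b < r" for r using that by (metis fun_upd_apply not_less_eq not_less_zero)
  have st: "?s = st [y]" unfolding st_single using s'(2) out by (auto simp: fun_eq_iff)
  have len: "length (s' r) \<le> length x + t1" for r
    using exec_length[OF e1, of r] by (cases "r = 0") auto
  have "does f (\<lambda>_. False) (wipe b) s' (Suc (b * Suc (2 * (length x + t1)))) (st [y])"
    using does_wipe[of s' "length x + t1" f _ b, OF len] unfolding st .
  then obtain tw where tw: "tw \<le> Suc (b * Suc (2 * (length x + t1)))" "exec f (wipe b) s' tw [] (st [y])"
    by (auto simp: does_def)
  have "exec f (Seq c1 (Seq (wipe b) c2)) ((\<lambda>_. [])(0 := x)) (t1 + (tw + t2)) ([] @ ([] @ qs)) s"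
    by (intro exec.Seq[OF e1] exec.Seq[OF tw(2)] c2)
  with c2(2) tw(1) show ?thesis unfolding runs_def by (intro exI[of _ "t1 + (tw + t2)"]) auto
qed


subsection \<open>Computable bounds\<close>

lemma ternary_binary: "ternary (binary n)"
  using set_binary by blast

text \<open>
  For the computability of a function the running time does not matter.
\<close>

definition leads :: "program \<Rightarrow> store \<Rightarrow> store \<Rightarrow> bool" where
  "leads c s s' \<longleftrightarrow> oracle_free c \<and> (\<exists>t. exec (\<lambda>_. 0) c s t [] s')"

lemma leads_Seq: "leads c1 s s' \<Longrightarrow> leads c2 s' s'' \<Longrightarrow> leads (Seq c1 c2) s s''"
  unfolding leads_def using exec.Seq[of "\<lambda>_. 0" c1 s _ "[]" s' c2 _ "[]" s''] by fastforce

lemma leads_does: "oracle_free c \<Longrightarrow> does (\<lambda>_. 0) (\<lambda>_. False) c s T s' \<Longrightarrow> leads c s s'"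
  unfolding leads_def does_def by auto

lemma leads_pour1:
  "r \<noteq> d \<Longrightarrow> ternary (s r) \<Longrightarrow> s' = s(r := [], d := rev (s r) @ s d) \<Longrightarrow> leads (pour r [d]) s s'"
  by (rule leads_does[OF _ does_pour1[OF _ _ order_refl]]) simp_all

lemma leads_pour2:
  "r \<noteq> d \<Longrightarrow> r \<noteq> e \<Longrightarrow> d \<noteq> e \<Longrightarrow> ternary (s r) \<Longrightarrow>
    s' = s(r := [], d := rev (s r) @ s d, e := rev (s r) @ s e) \<Longrightarrow> leads (pour r [d, e]) s s'"
  by (rule leads_does[OF _ does_pour2[OF _ _ _ _ order_refl]]) simp_all

lemma leads_wipe:
  assumes "finite {r. s r \<noteq> []}" "s' = (\<lambda>r. if 1 \<le> r \<and> r \<le> b then [] else s r)"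
  shows "leads (wipe b) s s'"
proof -
  let ?L = "Max (insert 0 ((\<lambda>r. length (s r)) ` {r. s r \<noteq> []}))"
  have "length (s r) \<le> ?L" for r
    using assms(1) by (cases "s r = []") (auto intro!: Max_ge)
  from leads_does[OF _ does_wipe[of s ?L, OF this]] assms(2) show ?thesis by simp
qed

lemma computable_leads:
  assumes "computable g"
  obtains c b where "\<And>n s. s 0 = binary n \<Longrightarrow> (\<And>r. 0 < r \<Longrightarrow> r < b \<Longrightarrow> s r = []) \<Longrightarrow>
    \<exists>s'. leads c s s' \<and> s' 0 = binary (g n) \<and> (\<forall>r\<ge>b. s' r = s r)" "0 < b"
proof -
  obtain c where c: "\<And>n. \<exists>t. runs_plain c (binary n) (binary (g n)) t"
    using assms unfolding computable_def by blast
  obtain b0 where "regs_below b0 c" using regs_below_ex by blast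
  then have b: "regs_below (Suc b0) c" by (rule regs_below_mono) simp
  show thesis
  proof (rule that[of "Suc b0" c])
    fix n and s :: store assume s: "s 0 = binary n" "\<And>r. 0 < r \<Longrightarrow> r < Suc b0 \<Longrightarrow> s r = []"
    obtain t s' where s': "exec (\<lambda>_. 0) c ((\<lambda>_. [])(0 := binary n)) t [] s'" "s' 0 = binary (g n)"
        "oracle_free c" using c[of n] by (auto simp: runs_plain_def runs_def)
    have "exec (\<lambda>_. 0) c s t [] (\<lambda>r. if r < Suc b0 then s' r else s r)"
      by (rule exec_frame[OF s'(1) b]) (use s in auto)
    then show "\<exists>s'. leads c s s' \<and> s' 0 = binary (g n) \<and> (\<forall>r\<ge>Suc b0. s' r = s r)"
      using s'(2,3) by (intro exI[of _ "\<lambda>r. if r < Suc b0 then s' r else s r"]) (auto simp: leads_def)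
  qed simp
qed

text \<open>
  The factor of the running time that depends on the parameter has to be a computable function
  of it. This form covers the reductions below: \<open>g\<close> bounds the new parameter, \<open>h\<close> the running
  time of the reduction composed with. The program evaluates \<open>g\<close> and \<open>h\<close> one after the other,
  keeping the argument and the first result out of reach, and then continues with both values.
  As computability knows no time limit, the budget can be chosen so large that it contains the
  values themselves.
\<close>

lemma computable_bound:
  assumes "computable g" "computable h"
  shows "computable (\<lambda>n. A * (2 ^ (g n * g n) * Suc (h n)) ^ D)"
proof -
  obtain c1 b1 where c1: "\<And>n s. s 0 = binary n \<Longrightarrow> (\<And>r. 0 < r \<Longrightarrow> r < b1 \<Longrightarrow> s r = []) \<Longrightarrow>
    \<exists>s'. leads c1 s s' \<and> s' 0 = binary (g n) \<and> (\<forall>r\<ge>b1. s' r = s r)" "0 < b1"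
    using computable_leads[OF assms(1)] by metis
  obtain c2 b2 where c2: "\<And>n s. s 0 = binary n \<Longrightarrow> (\<And>r. 0 < r \<Longrightarrow> r < b2 \<Longrightarrow> s r = []) \<Longrightarrow>
    \<exists>s'. leads c2 s s' \<and> s' 0 = binary (h n) \<and> (\<forall>r\<ge>b2. s' r = s r)" "0 < b2"
    using computable_leads[OF assms(2)] by metis
  define b where "b = Suc (b1 + b2)"
  have b: "1 < b" "b1 \<le> b" "b2 \<le> b" using c1(2) c2(2) by (auto simp: b_def)
  define W :: "nat \<times> nat \<Rightarrow> word list" where "W z = ([] @ [binary (fst z)]) @ [binary (snd z)]" for z
  let ?p = "\<lambda>z. fst z + snd z + 2 ^ (snd z * snd z)"
  have fx: "fixed W" "fixed (\<lambda>z :: nat \<times> nat. [])" by (simp_all add: fixed_def W_def)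
  have u: "uc True (\<lambda>_. 0) (\<lambda>_ _. False) ?p W fst"
  proof -
    have "uc True (\<lambda>_. 0) (\<lambda>_ _. False) ?p W (\<lambda>z. bval (binary (fst z)))"
      by (rule uc_bval, unfold W_def, rule wc_snoc, rule wc_last[OF fx(2)])
        (rule size_bounded_budget, simp)
    then show ?thesis by simp
  qed
  have v: "uc True (\<lambda>_. 0) (\<lambda>_ _. False) ?p W snd"
  proof -
    have "uc True (\<lambda>_. 0) (\<lambda>_ _. False) ?p W (\<lambda>z. bval (binary (snd z)))"
      by (rule uc_bval, unfold W_def, rule wc_last, rule fixed_snoc[OF fx(2)])
        (rule size_bounded_budget, simp)
    then show ?thesis by simp
  qed
  have "wc True (\<lambda>_. 0) (\<lambda>_ _. False) ?p W
      (\<lambda>z. binary (A * (2 ^ (snd z * snd z) * Suc (fst z)) ^ D))"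
    by (rule wc_binary uc_times uc_power uc_pow2 uc_Suc u v uc_const fx size_bounded_budget | simp)+
  then obtain c3 K d where c3: "oracle_free c3"
    "\<And>z. ok (W z) \<Longrightarrow> \<exists>t qs s. exec (\<lambda>_. 0) c3 (st (W z)) t qs s \<and>
       s 0 = binary (A * (2 ^ (snd z * snd z) * Suc (fst z)) ^ D) \<and> (\<forall>q\<in>set qs. False) \<and>
       t \<le> K * Suc (?p z + vol (W z)) ^ d"
    by (rule wc_program) (auto simp: W_def)
  let ?c = "Seq (pour 0 [b + 1]) (Seq (pour (b + 1) [0, b]) (Seq c1 (Seq (pour 0 [b + 1])
    (Seq (wipe (b - 1)) (Seq (pour b [b + 2]) (Seq (pour (b + 2) [0]) (Seq c2 (Seq (wipe (b - 1))
    (Seq (pour (b + 1) [1]) c3)))))))))"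
  have "\<exists>t. runs_plain ?c (binary n) (binary (A * (2 ^ (g n * g n) * Suc (h n)) ^ D)) t" for n
  proof -
    let ?n = "binary n"
    let ?s0 = "(\<lambda>_. [])(0 := ?n) :: store"
    let ?s1 = "(\<lambda>_. [])(b + 1 := rev ?n) :: store"
    let ?s2 = "(\<lambda>_. [])(0 := ?n, b := ?n) :: store"
    have 1: "leads (pour 0 [b + 1]) ?s0 ?s1"
      by (rule leads_pour1) (use b ternary_binary in \<open>auto simp: fun_eq_iff\<close>)
    have 2: "leads (pour (b + 1) [0, b]) ?s1 ?s2"
      by (rule leads_pour2) (use b ternary_binary in \<open>auto simp: fun_eq_iff\<close>)
    obtain s3 where s3: "leads c1 ?s2 s3" "s3 0 = binary (g n)" "\<And>r. b1 \<le> r \<Longrightarrow> s3 r = ?s2 r"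
      using c1(1)[of ?s2 n] b by auto
    let ?s4 = "s3(0 := [], b + 1 := rev (binary (g n)))"
    have 4: "leads (pour 0 [b + 1]) s3 ?s4"
      by (rule leads_pour1) (use b ternary_binary s3 in \<open>auto simp: fun_eq_iff\<close>)
    let ?s5 = "(\<lambda>_. [])(b := ?n, b + 1 := rev (binary (g n))) :: store"
    have 5: "leads (wipe (b - 1)) ?s4 ?s5"
    proof (rule leads_wipe)
      have "?s4 r = []" if "b + 1 < r" for r using s3(3)[of r] that b by simp
      then have "{r. ?s4 r \<noteq> []} \<subseteq> {..b + 1}" by (auto simp: not_le[symmetric] simp del: fun_upd_apply)
      then show "finite {r. ?s4 r \<noteq> []}" by (rule finite_subset) simp
      show "?s5 = (\<lambda>r. if 1 \<le> r \<and> r \<le> b - 1 then [] else ?s4 r)"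
      proof
        fix r
        show "?s5 r = (if 1 \<le> r \<and> r \<le> b - 1 then [] else ?s4 r)"
          using s3(3)[of r] b by (cases "r < b"; cases "r = 0") auto
      qed
    qed
    let ?s6 = "(\<lambda>_. [])(b + 2 := rev ?n, b + 1 := rev (binary (g n))) :: store"
    have 6: "leads (pour b [b + 2]) ?s5 ?s6"
      by (rule leads_pour1) (use b ternary_binary in \<open>auto simp: fun_eq_iff\<close>)
    let ?s7 = "(\<lambda>_. [])(0 := ?n, b + 1 := rev (binary (g n))) :: store"
    have 7: "leads (pour (b + 2) [0]) ?s6 ?s7"
      by (rule leads_pour1) (use b ternary_binary in \<open>auto simp: fun_eq_iff\<close>)
    obtain s8 where s8: "leads c2 ?s7 s8" "s8 0 = binary (h n)" "\<And>r. b2 \<le> r \<Longrightarrow> s8 r = ?s7 r"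
      using c2(1)[of ?s7 n] b by auto
    let ?s9 = "(\<lambda>_. [])(0 := binary (h n), b + 1 := rev (binary (g n))) :: store"
    have 9: "leads (wipe (b - 1)) s8 ?s9"
    proof (rule leads_wipe)
      have "s8 r = []" if "b + 1 < r" for r using s8(3)[of r] that b by simp
      then have "{r. s8 r \<noteq> []} \<subseteq> {..b + 1}" by (auto simp: not_le[symmetric])
      then show "finite {r. s8 r \<noteq> []}" by (rule finite_subset) simp
      show "?s9 = (\<lambda>r. if 1 \<le> r \<and> r \<le> b - 1 then [] else s8 r)"
      proof
        fix r
        show "?s9 r = (if 1 \<le> r \<and> r \<le> b - 1 then [] else s8 r)"
          using s8(2) s8(3)[of r] b by (cases "r < b"; cases "r = 0") auto
      qed
    qed
    have 10: "leads (pour (b + 1) [1]) ?s9 (st (W (h n, g n)))"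
      by (rule leads_pour1) (use b ternary_binary in \<open>auto simp: fun_eq_iff st_def W_def nth_Cons'\<close>)
    have "ok (W (h n, g n))" using ternary_binary by (auto simp: W_def)
    then obtain t qs s where t: "exec (\<lambda>_. 0) c3 (st (W (h n, g n))) t qs s"
       "s 0 = binary (A * (2 ^ (g n * g n) * Suc (h n)) ^ D)" using c3(2)[of "(h n, g n)"] by auto
    then have 11: "leads c3 (st (W (h n, g n))) s"
      using exec_oracle_free[OF t(1) c3(1)] c3(1) unfolding leads_def by blast
    have "leads ?c ?s0 s"
      by (intro leads_Seq[OF 1] leads_Seq[OF 2] leads_Seq[OF s3(1)] leads_Seq[OF 4] leads_Seq[OF 5]
          leads_Seq[OF 6] leads_Seq[OF 7] leads_Seq[OF s8(1)] leads_Seq[OF 9] leads_Seq[OF 10] 11)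
    then show ?thesis using t(2) unfolding leads_def runs_plain_def runs_def by blast
  qed
  then show ?thesis unfolding computable_def by blast
qed

lemma computable_id: "computable (\<lambda>n. n)"
proof -
  have "runs_plain Skip (binary n) (binary n) 1" for n
    unfolding runs_plain_def runs_def
    by (intro conjI exI[of _ "(\<lambda>_. [])(0 := binary n)"] exec.Skip) simp_all
  then show ?thesis unfolding computable_def by blast
qed


section \<open>Signed accumulation of binary numbers\<close>

text \<open>
  The carry into position \<open>j\<close> in closed form: it was generated at some position, or comes from
  outside, and was passed on by all positions in between. The existential quantifier is written
  with \<open>\<forall>\<close> to suit \<open>dc_all_less\<close>.
\<close>

definition carry :: "bool \<Rightarrow> (nat \<Rightarrow> bool) \<Rightarrow> (nat \<Rightarrow> bool) \<Rightarrow> nat \<Rightarrow> bool" where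
  "carry s A B j \<longleftrightarrow> (s \<and> (\<forall>l<j. A l \<or> B l)) \<or>
     \<not> (\<forall>i<j. \<not> (A i \<and> B i \<and> (\<forall>l<j. i < l \<longrightarrow> A l \<or> B l)))"

lemma carry_0: "carry s A B 0 = s"
  by (simp add: carry_def)

lemma carry_Suc: "carry s A B (Suc j) \<longleftrightarrow> (A j \<and> B j) \<or> ((A j \<or> B j) \<and> carry s A B j)"
  unfolding carry_def less_Suc_eq by (cases "A j"; cases "B j") auto

definition bitsum :: "(nat \<Rightarrow> bool) \<Rightarrow> nat \<Rightarrow> nat" where
  "bitsum P l = (\<Sum>j<l. 2 ^ j * of_bool (P j))"

lemma carry_sum:
  "bitsum (\<lambda>j. (A j \<noteq> B j) \<noteq> carry s A B j) l + 2 ^ l * of_bool (carry s A B l) =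
    bitsum A l + bitsum B l + of_bool s"
proof (induction l)
  case 0
  show ?case by (simp add: bitsum_def carry_0)
next
  case (Suc l)
  then show ?case
    by (cases "A l"; cases "B l"; cases "carry s A B l") (auto simp: bitsum_def carry_Suc)
qed

lemma bitsum_not: "bitsum (\<lambda>j. \<not> P j) l + bitsum P l + 1 = 2 ^ l"
  by (induction l) (auto simp: bitsum_def)

lemma bitsum_Suc_left: "bitsum P (Suc l) = of_bool (P 0) + 2 * bitsum (\<lambda>j. P (Suc j)) l"
  unfolding bitsum_def
  by (subst sum.lessThan_Suc_shift) (simp only: sum_distrib_left power_0 mult_1 power_Suc mult.assoc)

lemma bval_eq_bitsum: "length w \<le> l \<Longrightarrow> bval w = bitsum (\<lambda>j. has w j 1) l"
proof (induction w arbitrary: l)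
  case Nil
  then show ?case by (simp add: bitsum_def has_def)
next
  case (Cons a w)
  then obtain l' where l: "l = Suc l'" "length w \<le> l'" by (cases l) auto
  show ?case unfolding l(1) bitsum_Suc_left using Cons.IH[OF l(2)] by (simp add: has_def)
qed

lemma bitsum_cong_mod:
  assumes "l \<le> l'"
  shows "\<exists>c. bitsum P l' = bitsum P l + 2 ^ l * c"
proof -
  from assms have "2 ^ l dvd (\<Sum>j\<in>{l..<l'}. 2 ^ j * of_bool (P j) :: nat)"
    by (intro dvd_sum dvd_mult2 le_imp_power_dvd) auto
  then obtain c where "(\<Sum>j\<in>{l..<l'}. 2 ^ j * of_bool (P j)) = (2 :: nat) ^ l * c" by (elim dvdE)
  moreover have "bitsum P l' = bitsum P l + (\<Sum>j\<in>{l..<l'}. 2 ^ j * of_bool (P j))"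
    unfolding bitsum_def lessThan_atLeast0
    by (rule sum.atLeastLessThan_concat[symmetric]) (use assms in auto)
  ultimately show ?thesis by metis
qed

lemma bval_mod: "\<exists>c. bval w = bitsum (\<lambda>j. has w j 1) l + 2 ^ l * c"
proof (cases "length w \<le> l")
  case True
  then show ?thesis using bval_eq_bitsum by (intro exI[of _ 0]) simp
next
  case False
  then show ?thesis
    using bitsum_cong_mod[of l "length w" "\<lambda>j. has w j 1"] bval_eq_bitsum[of w "length w"] by auto
qed

text \<open>
  Addition, or subtraction if \<open>s\<close> holds, of words with \<open>L\<close> digits. Subtracting means to add the
  complement with a carry from outside. Overflow is lost, so the result is right modulo \<open>2 ^ L\<close>.
\<close>

definition addsub :: "bool \<Rightarrow> nat \<Rightarrow> word \<Rightarrow> word \<Rightarrow> word" where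
  "addsub s L a b = map (\<lambda>j. of_bool ((has a j 1 \<noteq> (has b j 1 \<noteq> s)) \<noteq>
     carry s (\<lambda>j. has a j 1) (\<lambda>j. has b j 1 \<noteq> s) j)) [0..<L]"

lemma length_addsub [simp]: "length (addsub s L a b) = L"
  by (simp add: addsub_def)

lemma bval_map: "bval (map (\<lambda>j. of_bool (P j)) [0..<L]) = bitsum P L"
proof -
  have "bitsum (\<lambda>j. has (map (\<lambda>j. of_bool (P j)) [0..<L]) j 1) L = bitsum P L"
    unfolding bitsum_def by (intro sum.cong) (auto simp: has_def)
  then show ?thesis by (subst bval_eq_bitsum[of _ L]) auto
qed

lemma bval_addsub:
  assumes "length a \<le> L"
  shows "\<exists>c. int (bval (addsub s L a b)) = int (bval a) + (if s then - 1 else 1) * int (bval b) + 2 ^ L * c"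
proof -
  let ?A = "\<lambda>j. has a j 1" and ?b = "\<lambda>j. has b j 1"
  let ?B = "\<lambda>j. ?b j \<noteq> s"
  have sum: "int (bval (addsub s L a b)) + 2 ^ L * of_bool (carry s ?A ?B L) =
      int (bval a) + int (bitsum ?B L) + of_bool s"
    using arg_cong[OF carry_sum[of ?A ?B s L], of int]
    unfolding addsub_def bval_map bval_eq_bitsum[OF assms] by simp
  obtain c where c: "bval b = bitsum ?b L + 2 ^ L * c" using bval_mod by blast
  have "int (bitsum ?B L) + of_bool s = (if s then - 1 else 1) * int (bitsum ?b L) + 2 ^ L * of_bool s"
    using arg_cong[OF bitsum_not[of ?b L], of int] by (cases s) auto
  then have "int (bval (addsub s L a b)) = int (bval a) + (if s then - 1 else 1) * int (bval b) +
      2 ^ L * (of_bool s - of_bool (carry s ?A ?B L) - (if s then - 1 else 1) * int c)"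
    using sum unfolding c by (simp add: algebra_simps)
  then show ?thesis by blast
qed

lemma bits_eq_binary:
  "\<exists>r. map (\<lambda>i. of_bool (has w i 1)) [0..<length w] = binary (bval w) @ replicate r 0"
proof (induction w)
  case (Cons a w)
  have "map (\<lambda>i. of_bool (has (a # w) i 1)) [0..<length (a # w)] =
      of_bool (a = 1) # map (\<lambda>i. of_bool (has w i 1)) [0..<length w]"
    unfolding length_Cons by (subst upt_conv_Cons) (auto simp: has_def map_Suc_upt[symmetric] simp del: upt_Suc)
  moreover obtain r where "map (\<lambda>i. of_bool (has w i 1)) [0..<length w] = binary (bval w) @ replicate r 0"
    using Cons by blast
  moreover have "\<exists>r'. of_bool (a = 1) # binary (bval w) @ replicate r 0 = binary (bval (a # w)) @ replicate r' 0"
  proof (cases "bval (a # w) = 0")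
    case True
    then have "a \<noteq> 1" "bval w = 0" by (auto split: if_splits)
    then show ?thesis by (intro exI[of _ "Suc r"]) simp
  next
    case False
    then obtain m where m: "bval (a # w) = Suc m" by (cases "bval (a # w)") auto
    have "Suc m mod 2 = of_bool (a = 1)" "Suc m div 2 = bval w" unfolding m[symmetric] by auto
    then show ?thesis unfolding m by (intro exI[of _ r]) simp
  qed
  ultimately show ?case by metis
qed simp

text \<open>
  The canonical numeral results from deleting the digits above the last 1.
\<close>

lemma binary_bval_eq_map:
  "binary (bval w) = map (\<lambda>i. of_bool (has w i 1))
     [0..<\<Sum>i<length w. of_bool (\<not> (\<forall>j<length w. \<not> (i \<le> j \<and> has w j 1)))]"
proof -
  obtain r where r: "map (\<lambda>i. of_bool (has w i 1)) [0..<length w] = binary (bval w) @ replicate r 0"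
    using bits_eq_binary by blast
  let ?l = "length (binary (bval w))"
  have len: "length w = ?l + r" using arg_cong[OF r, of length] by simp
  have nth: "of_bool (has w i 1) = (if i < ?l then binary (bval w) ! i else 0)" if "i < length w" for i
    using arg_cong[OF r, of "\<lambda>u. u ! i"] that len by (simp add: nth_append)
  have last: "?l > 0 \<Longrightarrow> has w (?l - 1) 1"
  proof -
    assume l: "?l > 0"
    then have "0 < bval w div 2 ^ (?l - 1)" using less_length_binary[of "?l - 1" "bval w"] by simp
    moreover have "bval w div 2 ^ (?l - 1) div 2 = 0"
      using less_length_binary[of ?l "bval w"] l
      by (simp add: div_mult2_eq[symmetric] power_Suc2[symmetric] del: power_Suc)
    ultimately have "bval w div 2 ^ (?l - 1) = 1" by simp
    then have "binary (bval w) ! (?l - 1) = 1" using nth_binary[of "?l - 1" "bval w"] l by simp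
    moreover have "?l - 1 < length w" using l len by linarith
    ultimately have "of_bool (has w (?l - 1) 1) = (1 :: nat)" using nth[of "?l - 1"] l by simp
    then show ?thesis by (cases "has w (?l - 1) 1") auto
  qed
  have "(\<not> (\<forall>j<length w. \<not> (i \<le> j \<and> has w j 1))) \<longleftrightarrow> i < ?l" for i
  proof
    assume "\<not> (\<forall>j<length w. \<not> (i \<le> j \<and> has w j 1))"
    then obtain j where "j < length w" "i \<le> j" "has w j 1" by blast
    then show "i < ?l" using nth[of j] by (auto split: if_splits)
  next
    assume "i < ?l"
    then show "\<not> (\<forall>j<length w. \<not> (i \<le> j \<and> has w j 1))"
    proof -
      have "has w (?l - 1) 1" by (rule last) (use \<open>i < ?l\<close> in linarith)
      moreover have "?l - 1 < length w" "i \<le> ?l - 1" using \<open>i < ?l\<close> len by linarith+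
      ultimately show ?thesis by blast
    qed
  qed
  then have "(\<Sum>i<length w. of_bool (\<not> (\<forall>j<length w. \<not> (i \<le> j \<and> has w j 1)))) = ?l"
    using sum_of_bool_less[of ?l "length w"] len by simp
  then show ?thesis
    using nth len by (auto intro!: nth_equalityI)
qed

lemma wc_canonical:
  assumes "wc pl f Q p W x"
  shows "wc pl f Q p W (\<lambda>g. binary (bval (x g)))"
  unfolding binary_bval_eq_map
  by (rule wc_map closure_rules assms leaf_rules wc_fixed[OF assms] | simp)+

lemma wc_addsub:
  assumes "dc pl f Q p W s" "uc pl f Q p W L" "wc pl f Q p W a" "wc pl f Q p W b"
  shows "wc pl f Q p W (\<lambda>g. addsub (s g) (L g) (a g) (b g))"
  unfolding addsub_def carry_def
  by (rule wc_map closure_rules assms leaf_rules wc_fixed[OF assms(1)] | simp)+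


lemma bval_less: "bval w < 2 ^ length w"
  by (induction w) auto

lemma bval_drop: "bval (drop i w) = bval w div 2 ^ i"
proof (induction w arbitrary: i)
  case (Cons a w)
  then show ?case by (cases i) (auto simp: div_mult2_eq)
qed simp


section \<open>The reduction to p-clique\<close>

lemma ternary_instance_word: "ternary (instance_word (binary k) n A)"
  using set_binary[of k] by (auto simp: instance_word_def)

lemma instance_word_problem:
  assumes "\<And>i j. A i j \<Longrightarrow> A j i" "\<And>i. \<not> A i i"
  shows "count_of (graph_problem F) (instance_word (binary k) n A) = F {..<n} (edge_set n A) k"
    and "param (graph_problem F) (instance_word (binary k) n A) = k"
proof -
  have "instance_word (binary k) n A = encode_instance n (edge_set n A) k"
    unfolding encode_instance_eq by (rule instance_word_cong) (simp add: edge_set_iff[of A] assms(1))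
  then show "count_of (graph_problem F) (instance_word (binary k) n A) = F {..<n} (edge_set n A) k"
    "param (graph_problem F) (instance_word (binary k) n A) = k"
    using graph_problem_encode_instance[OF simple_graph_edge_set[of A n, OF assms(2)]] by simp_all
qed

text \<open>
  Both constructions depend on pairs of vertices, so the parameters 0 and 1 are treated
  separately. Sets with at most one vertex are cliques and induce no edge.
\<close>

lemma small_subsets:
  assumes "simple_graph V E" "k \<le> 1"
  shows "count_cliques V E k = card V choose k" "count_parity False V E k = card V choose k"
    "count_parity True V E k = 0"
proof -
  have finV: "finite V" using assms(1) by (simp add: simple_graph_def)
  have single: "u = v" if "U \<subseteq> V" "card U = k" "u \<in> U" "v \<in> U" for U u v
  proof -
    have "finite U" using finV that(1) finite_subset by blast
    then have "card {u, v} \<le> card U" using that by (intro card_mono) auto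
    then show ?thesis using that assms(2) by (cases "u = v") auto
  qed
  have none: "induced_edges E U = {}" if "U \<subseteq> V" "card U = k" for U
  proof -
    have "finite U" using finV that(1) finite_subset by blast
    then have "\<not> e \<subseteq> U" if "e \<in> E" for e
      using card_mono[of U e] that assms \<open>card U = k\<close> by (auto simp: simple_graph_def)
    then show ?thesis by (auto simp: induced_edges_def)
  qed
  have "{U. U \<subseteq> V \<and> card U = k \<and> (\<forall>u\<in>U. \<forall>v\<in>U. u \<noteq> v \<longrightarrow> {u, v} \<in> E)} = {U. U \<subseteq> V \<and> card U = k}"
    using single by blast
  then show "count_cliques V E k = card V choose k"
    using n_subsets[OF finV] by (simp add: count_cliques_def)
  have "{U. U \<subseteq> V \<and> card U = k \<and> (odd (card (induced_edges E U)) \<longleftrightarrow> False)} = {U. U \<subseteq> V \<and> card U = k}"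
    using none by auto
  then show "count_parity False V E k = card V choose k"
    using n_subsets[OF finV] by (simp add: count_parity_def)
  have no: "{U. U \<subseteq> V \<and> card U = k \<and> (odd (card (induced_edges E U)) \<longleftrightarrow> True)} = {}"
    using none by auto
  show "count_parity True V E k = 0" unfolding count_parity_def no by simp
qed

text \<open>
  For \<open>k \<le> 1\<close> every \<open>k\<close>-set is even and is a clique, so the instance itself serves for even
  subgraphs, and a word of count 0 for odd ones.
\<close>

definition clique_word :: "bool \<Rightarrow> word \<Rightarrow> word" where
  "clique_word par x = (if \<not> valid x then [] else if knum x \<le> 1 then (if par then [] else x)
     else instance_word (kword x) (knum x * nnum x * 2 ^ (knum x * knum x))
       (mask_adj par (adj x) (knum x) (nnum x)))"

lemma valid_adj:
  assumes "valid x" "i < nnum x" "j < nnum x"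
  shows "adj x i j \<longleftrightarrow> {i, j} \<in> edges x"
  using valid_decode(4)[OF assms] by simp

lemma not_valid_Nil: "\<not> valid []"
  by (simp add: valid_def has_def)

lemma count_of_clique_word:
  "count_of p_clique (clique_word par x) = count_of (graph_problem (count_parity par)) x"
proof -
  consider "\<not> valid x" | "valid x" "knum x \<le> 1" | "valid x" "2 \<le> knum x" by linarith
  then show ?thesis
  proof cases
    case 1
    then show ?thesis
      by (simp add: p_clique_def count_of_graph_problem clique_word_def not_valid_Nil)
  next
    case 2
    then show ?thesis using small_subsets[OF valid_decode(1)[OF 2(1)] 2(2)]
      by (cases par) (simp_all add: p_clique_def count_of_graph_problem clique_word_def not_valid_Nil)
  next
    case 3
    let ?k = "knum x" and ?n = "nnum x"
    have "count_of p_clique (clique_word par x) = count_cliques {..<?k * ?n * 2 ^ (?k * ?k)}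
        (edge_set (?k * ?n * 2 ^ (?k * ?k)) (mask_adj par (adj x) ?k ?n)) ?k"
      using 3 unfolding p_clique_def clique_word_def kword_eq
      by (simp add: instance_word_problem mask_adj_sym mask_adj_irrefl)
    also have "\<dots> = count_parity par {..<?n} (edges x) ?k"
      unfolding count_parity_def
      by (rule count_mask_cliques[OF valid_decode(1)[OF 3(1)] 3(2)]) (rule valid_adj[OF 3(1)])
    finally show ?thesis using 3(1) by (simp add: count_of_graph_problem)
  qed
qed

lemma param_clique_word: "param p_clique (clique_word par x) \<le> knum x"
proof -
  have "knum [] = 0" by (rule invalid_knum(1)) (rule not_valid_Nil)
  then show ?thesis
    using param_graph_problem[of count_cliques x] param_graph_problem[of count_cliques "[]"]
    unfolding p_clique_def clique_word_def kword_eq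
    by (simp add: instance_word_problem mask_adj_sym mask_adj_irrefl)
qed

lemma ternary_clique_word: "ternary x \<Longrightarrow> ternary (clique_word par x)"
  unfolding clique_word_def kword_eq using ternary_instance_word by simp

lemma dc_bitn:
  assumes "uc pl f Q p W k" "uc pl f Q p W h" "uc pl f Q p W i" "uc pl f Q p W j"
  shows "dc pl f Q p W (\<lambda>g. bitn (k g) (h g) (i g) (j g))"
  unfolding bitn_def by (rule closure_rules assms)+

lemma dc_good_mask:
  assumes "uc pl f Q p W k" "uc pl f Q p W h"
  shows "dc pl f Q p W (\<lambda>g. good_mask par (k g) (h g))"
  unfolding good_mask_def
  by (rule closure_rules dc_bitn assms leaf_rules wc_fixed[OF assms(1)])+

lemma dc_neg_mask:
  assumes "uc pl f Q p W k" "uc pl f Q p W h"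
  shows "dc pl f Q p W (\<lambda>g. neg_mask (k g) (h g))"
  unfolding neg_mask_def
  by (rule closure_rules dc_bitn assms leaf_rules wc_fixed[OF assms(1)])+

lemma dc_mask_adj:
  assumes "wc pl f Q p W x" "uc pl f Q p W k" "uc pl f Q p W n" "uc pl f Q p W a" "uc pl f Q p W b"
  shows "dc pl f Q p W (\<lambda>g. mask_adj par (adj (x g)) (k g) (n g) (a g) (b g))"
  unfolding mask_adj_def mask_arc_def
  by (rule closure_rules dc_good_mask dc_bitn dc_adj assms)+

lemma dc_sel_adj:
  assumes "wc pl f Q p W x" "uc pl f Q p W k" "uc pl f Q p W n" "uc pl f Q p W h"
    "uc pl f Q p W a" "uc pl f Q p W b"
  shows "dc pl f Q p W (\<lambda>g. sel_adj (adj (x g)) (n g) (bitn (k g) (h g)) (a g) (b g))"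
  unfolding sel_adj_def sel_arc_def
  by (rule closure_rules dc_bitn dc_adj assms)+

text \<open>
  The only superpolynomial quantities in both reductions are the unary value of \<open>k\<close> and the
  number of masks.
\<close>

abbreviation budget :: "word \<Rightarrow> nat" where
  "budget x \<equiv> knum x + 2 ^ (knum x * knum x)"

text \<open>
  Written with \<open>@\<close>, the single input register is found by \<open>wc_last\<close> like any other.
\<close>

abbreviation input :: "word \<Rightarrow> word list" where
  "input \<equiv> \<lambda>x. [] @ [x]"

lemma fixed_input: "fixed input"
  by (simp add: fixed_def)

lemma wc_input: "wc pl f Q p input (\<lambda>x. x)"
  by (rule wc_last) (simp add: fixed_def)

lemma uc_knum: "uc pl f Q budget input knum"
proof -
  have "uc pl f Q budget input (\<lambda>x. bval (kword x))"
    by (rule uc_bval[OF wc_kword[OF wc_input]], rule size_bounded_budget)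
      (simp add: knum_def[symmetric])
  then show ?thesis by (simp only: knum_def[symmetric])
qed

lemma uc_masks: "uc pl f Q budget input (\<lambda>x. 2 ^ (knum x * knum x))"
  by (rule uc_pow2 uc_times uc_knum size_bounded_budget | simp)+

lemma wc_clique_word: "wc pl f Q budget input (clique_word par)"
proof -
  note base = wc_input uc_knum uc_masks uc_nnum[OF wc_input]
  have "wc pl f Q budget input (\<lambda>x. if \<not> valid x then [] else if knum x \<le> 1 then (if par then [] else x)
     else instance_word (kword x) (knum x * nnum x * 2 ^ (knum x * knum x))
       (mask_adj par (adj x) (knum x) (nnum x)))"
    by (rule wc_if dc_valid wc_kword wc_instance_word dc_mask_adj base
        uc_times uc_div uc_mod dc_not dc_le uc_const wc_last leaf_rules
        wc_word fixed_input | simp)+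
  then show ?thesis by (simp only: clique_word_def[abs_def])
qed


section \<open>The reduction from p-clique\<close>

definition parity_problem :: "bool \<Rightarrow> problem" where
  "parity_problem par = graph_problem (count_parity par)"

definition query :: "word \<Rightarrow> nat \<Rightarrow> word" where
  "query x h = instance_word (kword x) (knum x * nnum x) (sel_adj (adj x) (nnum x) (bitn (knum x) h))"

lemma query_problem:
  "count_of (parity_problem par) (query x h) =
    count_parity par {..<knum x * nnum x}
      (edge_set (knum x * nnum x) (sel_adj (adj x) (nnum x) (bitn (knum x) h))) (knum x)"
  "param (parity_problem par) (query x h) = knum x"
  unfolding parity_problem_def query_def kword_eq
  by (simp_all add: instance_word_problem sel_adj_sym sel_adj_irrefl)

text \<open>
  There are at most \<open>2 ^ (k * n)\<close> sets of vertices, so answers have polynomially many digits.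
\<close>

lemma length_answer_le: "length (binary (count_of (parity_problem par) (query x h))) \<le> Suc (knum x * nnum x)"
proof (rule length_binary_le)
  have "count_of (parity_problem par) (query x h) \<le> card (Pow {..<knum x * nnum x})"
    unfolding query_problem count_parity_def by (rule card_mono) auto
  also have "\<dots> < 2 ^ Suc (knum x * nnum x)" by (simp add: card_Pow)
  finally show "count_of (parity_problem par) (query x h) < 2 ^ Suc (knum x * nnum x)" .
qed

text \<open>
  The final sum is at most \<open>2 ^ (k * k - 1) * 2 ^ n\<close>, hence determined by its residue modulo
  \<open>2 ^ sum_width x\<close>; intermediate sums may be negative or overflow.
\<close>

definition sum_width :: "word \<Rightarrow> nat" where
  "sum_width x = nnum x + knum x * knum x"

text \<open>
  Even and odd subgraphs differ only in the signs of the summands, so \<open>par\<close> is merely added to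
  the sign of a mask.
\<close>

primrec signed_sum :: "bool \<Rightarrow> word \<Rightarrow> nat \<Rightarrow> word" where
  "signed_sum par x 0 = []"
| "signed_sum par x (Suc h) = addsub (neg_mask (knum x) h \<noteq> par) (sum_width x) (signed_sum par x h)
     (binary (count_of (parity_problem par) (query x h)))"

lemma length_signed_sum: "length (signed_sum par x h) \<le> sum_width x"
  by (cases h) auto

lemma bval_signed_sum:
  "\<exists>c. int (bval (signed_sum par x h)) = (\<Sum>h'<h. (if neg_mask (knum x) h' \<noteq> par then - 1 else 1) *
     int (count_of (parity_problem par) (query x h'))) + 2 ^ sum_width x * c"
proof (induction h)
  case 0
  show ?case by (intro exI[of _ 0]) simp
next
  case (Suc h)
  then obtain c where c: "int (bval (signed_sum par x h)) =
    (\<Sum>h'<h. (if neg_mask (knum x) h' \<noteq> par then - 1 else 1) *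
     int (count_of (parity_problem par) (query x h'))) + 2 ^ sum_width x * c" by blast
  obtain d where "int (bval (signed_sum par x (Suc h))) = int (bval (signed_sum par x h)) +
      (if neg_mask (knum x) h \<noteq> par then - 1 else 1) *
      int (count_of (parity_problem par) (query x h)) + 2 ^ sum_width x * d"
    using bval_addsub[OF length_signed_sum] by (metis signed_sum.simps(2) bval_binary)
  then show ?case unfolding c by (intro exI[of _ "c + d"]) (simp add: algebra_simps)
qed

definition clique_count_word :: "bool \<Rightarrow> word \<Rightarrow> word" where
  "clique_count_word par x = (if \<not> valid x then []
     else if knum x \<le> 1 then binary (if knum x = 0 then 1 else nnum x)
     else binary (bval (drop (knum x * knum x - 1) (signed_sum par x (2 ^ (knum x * knum x))))))"

lemma clique_count_word: "clique_count_word par x = binary (count_of p_clique x)"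
proof -
  let ?k = "knum x" and ?n = "nnum x"
  consider "\<not> valid x" | "valid x" "?k \<le> 1" | "valid x" "2 \<le> ?k" by linarith
  then show ?thesis
  proof cases
    case 1
    then show ?thesis by (simp add: clique_count_word_def p_clique_def count_of_graph_problem)
  next
    case 2
    have "?n choose ?k = (if ?k = 0 then 1 else ?n)" using 2(2) by (cases "?k = 0") (auto simp: le_Suc_eq)
    then show ?thesis using 2 small_subsets(1)[OF valid_decode(1)[OF 2(1)] 2(2)]
      by (simp add: clique_count_word_def p_clique_def count_of_graph_problem)
  next
    case 3
    let ?N = "count_cliques {..<?n} (edges x) ?k"
    have "count_cliques {..<?n} (edges x) ?k \<le> card (Pow {..<?n})"
      unfolding count_cliques_def by (rule card_mono) auto
    then have N: "?N \<le> 2 ^ ?n" by (simp add: card_Pow)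
    obtain c where c: "int (bval (signed_sum par x (2 ^ (?k * ?k)))) =
        (\<Sum>h<2 ^ (?k * ?k). (if neg_mask ?k h \<noteq> par then - 1 else 1) *
          int (count_of (parity_problem par) (query x h))) + 2 ^ sum_width x * c"
      using bval_signed_sum by blast
    then have c: "int (bval (signed_sum par x (2 ^ (?k * ?k)))) = 2 ^ (?k * ?k - 1) * int ?N + 2 ^ sum_width x * c"
      unfolding query_problem
      using cliques_from_parities[OF valid_decode(1)[OF 3(1)] 3(2) valid_adj[OF 3(1)], of par] by simp
    have "2 ^ (?k * ?k - 1) * ?N \<le> 2 ^ (?k * ?k - 1) * 2 ^ ?n" using N by (rule mult_le_mono2)
    also have "\<dots> = 2 ^ (?k * ?k - 1 + ?n)" by (rule power_add[symmetric])
    also have "\<dots> < 2 ^ sum_width x"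
    proof (rule power_strict_increasing)
      have "0 < ?k * ?k" using 3(2) by simp
      then show "?k * ?k - 1 + ?n < sum_width x" unfolding sum_width_def by linarith
    qed simp
    finally have lt: "2 ^ (?k * ?k - 1) * ?N < 2 ^ sum_width x" .
    have "bval (signed_sum par x (2 ^ (?k * ?k))) < 2 ^ sum_width x"
      using less_le_trans[OF bval_less power_increasing[OF length_signed_sum, of 2]] by simp
    then have "int (bval (signed_sum par x (2 ^ (?k * ?k)))) mod 2 ^ sum_width x =
        int (bval (signed_sum par x (2 ^ (?k * ?k))))"
      by (intro mod_pos_pos_trivial) (simp_all add: of_nat_less_numeral_power_cancel_iff)
    moreover have "(2 ^ (?k * ?k - 1) * int ?N) mod 2 ^ sum_width x = 2 ^ (?k * ?k - 1) * int ?N"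
    proof (rule mod_pos_pos_trivial)
      have "int (2 ^ (?k * ?k - 1) * ?N) < int (2 ^ sum_width x)" using lt by (simp only: of_nat_less_iff)
      then show "2 ^ (?k * ?k - 1) * int ?N < 2 ^ sum_width x" by simp
    qed simp
    ultimately have "int (bval (signed_sum par x (2 ^ (?k * ?k)))) = int (2 ^ (?k * ?k - 1) * ?N)"
      unfolding c by simp
    then have "bval (signed_sum par x (2 ^ (?k * ?k))) = 2 ^ (?k * ?k - 1) * ?N" by (simp only: of_nat_eq_iff)
    then show ?thesis using 3
      by (simp add: clique_count_word_def p_clique_def count_of_graph_problem bval_drop)
  qed
qed

lemma size_bounded_le:
  "size_bounded p W N \<Longrightarrow> (\<And>g. M g \<le> N g) \<Longrightarrow> size_bounded p W M"
  unfolding size_bounded_def by (meson le_trans)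

text \<open>
  The program asks the oracle anew for each digit of an answer that it reads, which costs a
  polynomial factor.
\<close>

lemma wc_clique_count_word:
  fixes par :: bool
  defines "Q \<equiv> \<lambda>x q. q \<in> lists {0, 1, 2} \<and> param (parity_problem par) q \<le> knum x"
  shows "wc False (count_of (parity_problem par)) Q budget input (clique_count_word par)"
proof -
  let ?f = "count_of (parity_problem par)"
  note base = wc_input uc_knum uc_masks uc_nnum[OF wc_input]
  have L: "uc False ?f Q budget input sum_width"
    unfolding sum_width_def[abs_def] by (rule uc_plus uc_times base)+
  have signed_sum: "wc False ?f Q budget input (\<lambda>x. signed_sum par x (2 ^ (knum x * knum x)))"
  proof (rule wc_rec[where V = "signed_sum par" and M = sum_width])
    \<comment> \<open>The context of one step of the recursion: the input, the current mask and the sum so far.\<close>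
    let ?Q = "\<lambda>z :: word \<times> nat. Q (fst z)" and ?p = "\<lambda>z :: word \<times> nat. budget (fst z)" and
      ?W = "\<lambda>z. (input (fst z) @ [replicate (snd z) 0]) @ [signed_sum par (fst z) (snd z)]"
    have fx: "fixed ?W" by (simp add: fixed_def)
    have i: "uc False ?f ?Q ?p ?W snd" and a: "wc False ?f ?Q ?p ?W (\<lambda>z. signed_sum par (fst z) (snd z))"
      by (rule wc_last leaf_rules fixed_input)+
    have x: "wc False ?f ?Q ?p ?W fst" and k: "uc False ?f ?Q ?p ?W (\<lambda>z. knum (fst z))"
      and n: "uc False ?f ?Q ?p ?W (\<lambda>z. nnum (fst z))" and l: "uc False ?f ?Q ?p ?W (\<lambda>z. sum_width (fst z))"
      by (rule wc_snoc wc_fst base L)+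
    have q: "wc False ?f ?Q ?p ?W (\<lambda>z. query (fst z) (snd z))"
      unfolding query_def
      by (rule wc_instance_word wc_kword dc_sel_adj uc_times uc_div uc_mod x k n i wc_last leaf_rules fx)+
    have ans: "wc False ?f ?Q ?p ?W (\<lambda>z. binary (?f (query (fst z) (snd z))))"
    proof (rule wc_query[OF q])
      show "?Q z (query (fst z) (snd z))" for z
        unfolding Q_def query_problem
        using ternary_instance_word unfolding query_def kword_eq by auto
      have "uc False ?f ?Q ?p ?W (\<lambda>z. Suc (knum (fst z) * nnum (fst z)))"
        by (rule uc_Suc uc_times k n)+
      then show "size_bounded ?p ?W (\<lambda>z. length (binary (?f (query (fst z) (snd z)))))"
        by (rule size_bounded_le[OF size_bounded_value]) (rule length_answer_le)
    qed simp
    have "wc False ?f ?Q ?p ?W (\<lambda>z. addsub (neg_mask (knum (fst z)) (snd z) \<noteq> par) (sum_width (fst z))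
        (signed_sum par (fst z) (snd z)) (binary (?f (query (fst z) (snd z)))))"
      by (rule wc_addsub dc_not dc_iff dc_neg_mask k i l a ans uc_const fx)+
    then show "wc False ?f ?Q ?p ?W (\<lambda>z. signed_sum par (fst z) (Suc (snd z)))"
      by (simp only: signed_sum.simps)
    show "wc False ?f Q budget input (\<lambda>x. signed_sum par x 0)"
      unfolding signed_sum.simps by (rule wc_word[OF fixed_input]) simp
    show "size_bounded budget input sum_width" by (rule size_bounded_value[OF L])
  qed (rule uc_masks length_signed_sum)+
  have "wc False ?f Q budget input (\<lambda>x. if \<not> valid x then []
     else if knum x \<le> 1 then binary (if knum x = 0 then 1 else nnum x)
     else binary (bval (drop (knum x * knum x - 1) (signed_sum par x (2 ^ (knum x * knum x))))))"
    by (rule wc_if uc_if wc_binary wc_canonical wc_drop uc_minus uc_times dc_valid dc_not dc_le dc_eq signed_sum base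
        uc_const wc_word fixed_input | simp)+
  then show ?thesis by (simp only: clique_count_word_def[abs_def])
qed


section \<open>Completeness\<close>

lemma budget_bound:
  assumes "knum x \<le> \<gamma>"
  shows "budget x \<le> 2 * 2 ^ (\<gamma> * \<gamma>)"
proof -
  have "knum x \<le> 2 ^ (\<gamma> * \<gamma>)"
    using assms le_square[of \<gamma>] less_exp[of "\<gamma> * \<gamma>"] by linarith
  moreover have "(2 :: nat) ^ (knum x * knum x) \<le> 2 ^ (\<gamma> * \<gamma>)"
    using assms by (intro power_increasing mult_le_mono) auto
  ultimately show ?thesis unfolding mult_2 by (rule add_mono)
qed

lemma st_input: "st (input x) = (\<lambda>_. [])(0 := x)"
  using st_single by simp

lemma ok_input: "x \<in> lists {0, 1, 2} \<Longrightarrow> ok (input x)"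
  by auto

lemma parity_problem_parameterised: "parameterised_counting_problem (parity_problem par)"
proof -
  obtain c K d where c: "True \<Longrightarrow> oracle_free c"
    "\<And>x. ok (input x) \<Longrightarrow> \<exists>t qs s. exec (\<lambda>_. 0) c (st (input x)) t qs s \<and> s 0 = kword x \<and>
       (\<forall>q\<in>set qs. False) \<and> t \<le> K * Suc (0 + vol (input x)) ^ d"
    by (rule wc_program[OF wc_kword[OF wc_input[where pl = True and f = "\<lambda>_. 0" and
          Q = "\<lambda>_ _. False" and p = "\<lambda>_. 0"]]]) auto
  have "\<exists>t. runs_plain c x (binary (knum x)) t \<and> t \<le> K * Suc (length x) ^ d"
    if x: "x \<in> lists {0, 1, 2}" for x
  proof -
    obtain t qs s where t: "exec (\<lambda>_. 0) c (st (input x)) t qs s" "s 0 = kword x" "\<forall>q\<in>set qs. False"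
      "t \<le> K * Suc (0 + vol (input x)) ^ d" using c(2)[OF ok_input[OF x]] by blast
    then have "runs_plain c x (binary (knum x)) t"
      using c(1) unfolding runs_plain_def runs_def st_input kword_eq by auto
    with t(4) show ?thesis by auto
  qed
  then show ?thesis
    unfolding parameterised_counting_problem_def poly_time_on_def parity_problem_def
    by (simp add: param_graph_problem graph_problem_def[of "count_parity par", THEN arg_cong[of _ _ alphabet]]) blast
qed

lemma alphabet_graph_problem: "alphabet (graph_problem F) = {0, 1, 2}"
  by (simp add: graph_problem_def)

text \<open>
  The time for \<open>clique_word\<close> is polynomial in the length of the input and \<open>2 ^ (k * k)\<close>; a power
  of a product separates into a factor that depends on \<open>k\<close> and a polynomial in the length, as
  required.
\<close>

lemma parity_problem_to_clique: "fpt_parsimonious_reducible (parity_problem par) p_clique"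
proof -
  obtain c K d where c: "True \<Longrightarrow> oracle_free c"
    "\<And>x. ok (input x) \<Longrightarrow> \<exists>t qs s. exec (\<lambda>_. 0) c (st (input x)) t qs s \<and> s 0 = clique_word par x \<and>
       (\<forall>q\<in>set qs. False) \<and> t \<le> K * Suc (budget x + vol (input x)) ^ d"
    by (rule wc_program[OF wc_clique_word[where pl = True and f = "\<lambda>_. 0" and Q = "\<lambda>_ _. False"]]) auto
  let ?h = "\<lambda>k. K * 3 ^ d * (2 ^ (k * k) * Suc k) ^ d"
  have main: "clique_word par x \<in> lists (alphabet p_clique) \<and>
      count_of (parity_problem par) x = count_of p_clique (clique_word par x) \<and>
      param p_clique (clique_word par x) \<le> param (parity_problem par) x \<and>
      (\<exists>t. runs_plain c x (clique_word par x) t \<and> t \<le> ?h (param (parity_problem par) x) * Suc (length x) ^ d)"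
    if "x \<in> lists (alphabet (parity_problem par))" for x
  proof (intro conjI)
    have x: "x \<in> lists {0, 1, 2}" using that by (simp add: parity_problem_def alphabet_graph_problem)
    then show "clique_word par x \<in> lists (alphabet p_clique)"
      using ternary_clique_word[of x par] by (auto simp: p_clique_def alphabet_graph_problem)
    show "count_of (parity_problem par) x = count_of p_clique (clique_word par x)"
      by (simp add: count_of_clique_word parity_problem_def)
    have k: "param (parity_problem par) x = knum x" by (simp add: parity_problem_def param_graph_problem)
    then show "param p_clique (clique_word par x) \<le> param (parity_problem par) x"
      using param_clique_word by simp
    obtain t qs s where t: "exec (\<lambda>_. 0) c (st (input x)) t qs s" "s 0 = clique_word par x" "\<forall>q\<in>set qs. False"
      "t \<le> K * Suc (budget x + vol (input x)) ^ d" using c(2)[OF ok_input[OF x]] by blast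
    then have r: "runs_plain c x (clique_word par x) t"
      using c(1) unfolding runs_plain_def runs_def st_input by auto
    let ?T = "2 ^ (knum x * knum x) * Suc (knum x)" and ?S = "Suc (length x)"
    have "budget x \<le> 2 * ?T"
      using budget_bound[of x "knum x"] by (simp add: algebra_simps)
    also have "\<dots> \<le> 2 * (?T * ?S)" by simp
    finally have "budget x \<le> 2 * (?T * ?S)" .
    moreover have "1 \<le> ?T" unfolding One_nat_def Suc_le_eq by simp
    then have "1 * ?S \<le> ?T * ?S" by (rule mult_le_mono1)
    ultimately have "Suc (budget x + vol (input x)) \<le> 3 * (?T * ?S)" by simp
    then have "Suc (budget x + vol (input x)) ^ d \<le> (3 * (?T * ?S)) ^ d" by (rule power_mono) simp
    then have "K * Suc (budget x + vol (input x)) ^ d \<le> K * (3 * (?T * ?S)) ^ d" by (rule mult_le_mono2)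
    also have "\<dots> = ?h (knum x) * ?S ^ d" by (simp only: power_mult_distrib mult.assoc)
    finally have "t \<le> ?h (knum x) * ?S ^ d" using t(4) by (rule le_trans[rotated])
    then show "\<exists>t. runs_plain c x (clique_word par x) t \<and>
        t \<le> ?h (param (parity_problem par) x) * Suc (length x) ^ d"
      using r unfolding k by blast
  qed
  show ?thesis unfolding fpt_parsimonious_reducible_def
    by (intro exI[of _ "clique_word par"] exI[of _ c] exI[of _ ?h] exI[of _ d] exI[of _ "\<lambda>k. k"]
        conjI ballI computable_id computable_bound[OF computable_id computable_id] main)
qed

text \<open>
  \<open>\<eta>\<close> and \<open>\<gamma>\<close> bound the running time and the new parameter of the first reduction, \<open>n\<close> and \<open>m\<close>
  are the lengths of its input and output. Every quantity is bounded by a multiple of one number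
  \<open>X\<close>, up to the exponent \<open>d\<close>.
\<close>

lemma reduction_time:
  fixes t1 t2 \<gamma> \<eta> S :: nat
  assumes "t1 \<le> \<eta> * S ^ e" "n \<le> S" "1 \<le> S" "m \<le> n + t1" "p \<le> 2 * 2 ^ (\<gamma> * \<gamma>)"
    and "t2 \<le> K * Suc (p + m) ^ d" "t \<le> t1 + Suc (b * Suc (2 * (n + t1))) + t2"
  shows "t \<le> (2 + 5 * b + K * 5 ^ d) * (2 ^ (\<gamma> * \<gamma>) * Suc \<eta>) ^ Suc d * S ^ (Suc e * Suc d)"
proof -
  define X where "X = 2 ^ (\<gamma> * \<gamma>) * Suc \<eta> * S ^ Suc e"
  have S1: "1 \<le> S ^ Suc e" using assms(3) by (rule one_le_power)
  have Se: "S ^ e \<le> S ^ Suc e" using assms(3) by (intro power_increasing) auto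
  have S: "S \<le> S ^ Suc e" using assms(3) power_increasing[of 1 "Suc e" S] by simp
  have "1 * (Suc \<eta> * S ^ Suc e) \<le> 2 ^ (\<gamma> * \<gamma>) * (Suc \<eta> * S ^ Suc e)" by (rule mult_le_mono1) simp
  then have X1: "Suc \<eta> * S ^ Suc e \<le> X" by (simp only: X_def mult.assoc mult_1)
  then have SX: "S ^ Suc e \<le> X" by simp
  have "\<eta> * S ^ e \<le> Suc \<eta> * S ^ Suc e" using Se by (intro mult_le_mono) auto
  then have t1: "t1 \<le> X" using assms(1) X1 by linarith
  have n: "n \<le> X" "1 \<le> X" using assms(2) S SX S1 by linarith+
  have "2 ^ (\<gamma> * \<gamma>) * 1 \<le> 2 ^ (\<gamma> * \<gamma>) * (Suc \<eta> * S ^ Suc e)"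
    by (rule mult_le_mono2) (use assms(3) in \<open>simp add: Suc_le_eq\<close>)
  then have p: "p \<le> 2 * X" using assms(5) unfolding X_def by (simp only: mult_1_right mult.assoc)
  have "Suc (p + m) \<le> 5 * X" using p n t1 assms(4) by linarith
  then have "Suc (p + m) ^ d \<le> (5 * X) ^ d" by (rule power_mono) simp
  then have "t2 \<le> K * (5 * X) ^ d" using assms(6) by (meson le_trans mult_le_mono2)
  also have "(5 * X) ^ d = 5 ^ d * X ^ d" by (rule power_mult_distrib)
  finally have t2: "t2 \<le> K * 5 ^ d * X ^ d" by (simp add: mult.assoc)
  have XX: "X \<le> X ^ Suc d" "X ^ d \<le> X ^ Suc d"
    using n(2) power_increasing[of 1 "Suc d" X] power_increasing[of d "Suc d" X] by auto
  have "Suc (2 * (n + t1)) \<le> 5 * X" using n t1 by simp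
  then have "b * Suc (2 * (n + t1)) \<le> b * (5 * X)" by (rule mult_le_mono2)
  then have "t \<le> X + (X + b * (5 * X)) + K * 5 ^ d * X ^ d" using assms(7) t1 t2 n(2) by linarith
  also have "\<dots> = (2 + 5 * b) * X + K * 5 ^ d * X ^ d" by (simp add: algebra_simps)
  also have "\<dots> \<le> (2 + 5 * b) * X ^ Suc d + K * 5 ^ d * X ^ Suc d"
    by (intro add_mono mult_le_mono2 XX)
  also have "\<dots> = (2 + 5 * b + K * 5 ^ d) * X ^ Suc d" by (rule add_mult_distrib[symmetric])
  also have "X ^ Suc d = (2 ^ (\<gamma> * \<gamma>) * Suc \<eta>) ^ Suc d * S ^ (Suc e * Suc d)"
    unfolding X_def by (simp only: power_mult_distrib power_mult)
  finally show ?thesis by (simp only: mult.assoc)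
qed

text \<open>
  The given reduction to \<open>p_clique\<close> is followed by the program that counts cliques with the
  oracle. The queries have the parameter of the intermediate instance, which the given reduction
  keeps bounded.
\<close>

lemma clique_to_parity_problem:
  assumes "fpt_parsimonious_reducible P p_clique"
  shows "fpt_turing_reducible P (parity_problem par)"
proof -
  obtain R c1 h e g where computable: "computable h" "computable g" and
    R: "\<And>x. x \<in> lists (alphabet P) \<Longrightarrow> R x \<in> lists (alphabet p_clique) \<and>
      count_of P x = count_of p_clique (R x) \<and> param p_clique (R x) \<le> g (param P x) \<and>
      (\<exists>t. runs_plain c1 x (R x) t \<and> t \<le> h (param P x) * Suc (length x) ^ e)"
    using assms unfolding fpt_parsimonious_reducible_def by blast
  let ?f = "count_of (parity_problem par)"
  obtain c K d where c: "\<And>y. ok (input y) \<Longrightarrow> \<exists>t qs s. exec ?f c (st (input y)) t qs s \<and>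
      s 0 = clique_count_word par y \<and>
      (\<forall>q\<in>set qs. q \<in> lists {0, 1, 2} \<and> param (parity_problem par) q \<le> knum y) \<and>
      t \<le> K * Suc (budget y + vol (input y)) ^ d"
    by (rule wc_program[OF wc_clique_count_word[of par]]) auto
  obtain b0 where "regs_below b0 c1" using regs_below_ex by blast
  then have b: "regs_below (Suc b0) c1" by (rule regs_below_mono) simp
  let ?h = "\<lambda>k. (2 + 5 * b0 + K * 5 ^ d) * (2 ^ (g k * g k) * Suc (h k)) ^ Suc d"
  have main: "\<exists>t qs. runs ?f (Seq c1 (Seq (wipe b0) c)) x (binary (count_of P x)) t qs \<and>
      t \<le> ?h (param P x) * Suc (length x) ^ (Suc e * Suc d) \<and>
      (\<forall>y\<in>set qs. y \<in> lists (alphabet (parity_problem par)) \<and> param (parity_problem par) y \<le> g (param P x))"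
    if x: "x \<in> lists (alphabet P)" for x
  proof -
    let ?y = "R x"
    have y: "?y \<in> lists {0, 1, 2}" and cnt: "count_of P x = count_of p_clique ?y"
      and k: "knum ?y \<le> g (param P x)"
      using R[OF x] by (auto simp: p_clique_def alphabet_graph_problem param_graph_problem)
    obtain t1 where t1: "runs_plain c1 x ?y t1" "t1 \<le> h (param P x) * Suc (length x) ^ e"
      using R[OF x] by blast
    obtain t2 qs s where t2: "exec ?f c (st (input ?y)) t2 qs s" "s 0 = clique_count_word par ?y"
      "\<forall>q\<in>set qs. q \<in> lists {0, 1, 2} \<and> param (parity_problem par) q \<le> knum ?y"
      "t2 \<le> K * Suc (budget ?y + vol (input ?y)) ^ d" using c[OF ok_input[OF y]] by blast
    obtain t where t: "runs ?f (Seq c1 (Seq (wipe b0) c)) x (clique_count_word par ?y) t qs"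
      "t \<le> t1 + Suc (b0 * Suc (2 * (length x + t1))) + t2"
      using runs_compose[OF t1(1) b, of ?f c t2 qs s] t2(1,2) by auto
    have "length ?y \<le> length x + t1"
    proof -
      obtain s' where "exec (\<lambda>_. 0) c1 ((\<lambda>_. [])(0 := x)) t1 [] s'" "s' 0 = ?y"
        using t1(1) by (auto simp: runs_plain_def runs_def)
      moreover from exec_length[OF this(1), of 0] have "length (s' 0) \<le> length x + t1" by simp
      ultimately show ?thesis by simp
    qed
    then have "t \<le> ?h (param P x) * Suc (length x) ^ (Suc e * Suc d)"
      using t1(2) t2(4) t(2) budget_bound[OF k]
      by (intro reduction_time[where ?t1.0 = t1 and ?t2.0 = t2 and n = "length x" and
            m = "length ?y" and p = "budget ?y"]) auto
    moreover have "\<forall>q\<in>set qs. q \<in> lists (alphabet (parity_problem par)) \<and>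
        param (parity_problem par) q \<le> g (param P x)"
      using t2(3) k by (auto simp: parity_problem_def alphabet_graph_problem)
    ultimately show ?thesis using t(1) unfolding cnt clique_count_word by blast
  qed
  show ?thesis unfolding fpt_turing_reducible_def
    by (intro exI[of _ "Seq c1 (Seq (wipe b0) c)"] exI[of _ ?h] exI[of _ "Suc e * Suc d"] exI[of _ g]
        conjI ballI computable computable_bound main)
qed

lemma parity_problem_complete: "sharp_W1_complete (parity_problem par)"
  unfolding sharp_W1_complete_def sharp_W1_def
  using parity_problem_parameterised parity_problem_to_clique clique_to_parity_problem by blast

theorem corollary2p5:
  "sharp_W1_complete p_even_subgraph \<and> sharp_W1_complete p_odd_subgraph"
  using parity_problem_complete[of False] parity_problem_complete[of True]
  by (simp add: parity_problem_def p_even_subgraph_def p_odd_subgraph_def count_parity_simps)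

end
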